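(* Let $W_n$ be the Hamming weight $\#\{h\in\mathcal S: a(h)\neq 0\}$ of a multi-base representation $a$ of $n$ chosen uniformly at random among all $P(n)$ representations. Then \[ \mathbb E[W_n]=\frac{\kappa(d-1)}{d\log d}(\log n)^m+O\big((\log n)^{m-1}\log\log n\big),\qquad \operatorname{Var}[W_n]=\frac{\kappa(d-1)}{d^2\log d}(\log n)^m+O\big((\log n)^{m-1}\log\log n\big), \] and $(W_n-\mathbb E[W_n])/\sqrt{\operatorname{Var}[W_n]}$ converges in distribution to a standard Gaussian random variable as $n\to\infty$.
   Context: Fix integers $d\geq 2$ and $m\geq 2$, and integers $1<p_1<p_2<\dots<p_m$ with $\gcd(p_i,p_j)=1$ for $i\neq j$. Let $\mathcal S=\{p_1^{\alpha_1}p_2^{\alpha_2}\cdots p_m^{\alpha_m}:\alpha_1,\dots,\alpha_m\in\mathbb Z_{\ge 0}\}$. A multi-base representation of a positive integer $n$ (with bases $p_1,\dots,p_m$ and digit set $\{0,1,\dots,d-1\}$) is a function $a:\mathcal S\to\{0,1,\dots,d-1\}$ with finite support such that $\sum_{h\in\mathcal S}a(h)\,h=n$. Let $P(n)$ be the (finite) number of multi-base representations of $n$. Set $\kappa=\frac{\log d}{m!}\prod_{j=1}^m\frac{1}{\log p_j}$. *)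

theory Defs
  imports "HOL-Probability.Probability" "HOL-Library.Landau_Symbols"
begin

text \<open>Bases p 0 < p 1 < ... < p (m-1) (0-indexed). The set S of all products
  p_0^a_0 ... p_(m-1)^a_(m-1).\<close>
definition mb_S :: "nat \<Rightarrow> (nat \<Rightarrow> nat) \<Rightarrow> nat set" where
  "mb_S m p = {(\<Prod>i<m. p i ^ \<alpha> i) | \<alpha>. True}"

text \<open>Multi-base representations of n with digits {0..d-1}: finitely supported
  functions a on S (extended by 0 outside S) with sum of a(h)*h equal to n.\<close>
definition mb_reps :: "nat \<Rightarrow> nat \<Rightarrow> (nat \<Rightarrow> nat) \<Rightarrow> nat \<Rightarrow> (nat \<Rightarrow> nat) set" where
  "mb_reps d m p n = {a. (\<forall>h. a h < d) \<and> (\<forall>h. h \<notin> mb_S m p \<longrightarrow> a h = 0)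
      \<and> finite {h. a h \<noteq> 0} \<and> (\<Sum>h\<in>{h. a h \<noteq> 0}. a h * h) = n}"

definition mb_P :: "nat \<Rightarrow> nat \<Rightarrow> (nat \<Rightarrow> nat) \<Rightarrow> nat \<Rightarrow> nat" where
  "mb_P d m p n = card (mb_reps d m p n)"

definition hweight :: "(nat \<Rightarrow> nat) \<Rightarrow> nat" where
  "hweight a = card {h. a h \<noteq> 0}"

definition W_dist :: "nat \<Rightarrow> nat \<Rightarrow> (nat \<Rightarrow> nat) \<Rightarrow> nat \<Rightarrow> real pmf" where
  "W_dist d m p n = map_pmf (\<lambda>a. real (hweight a)) (pmf_of_set (mb_reps d m p n))"

definition W_mean :: "nat \<Rightarrow> nat \<Rightarrow> (nat \<Rightarrow> nat) \<Rightarrow> nat \<Rightarrow> real" where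
  "W_mean d m p n = measure_pmf.expectation (W_dist d m p n) (\<lambda>x. x)"

definition W_var :: "nat \<Rightarrow> nat \<Rightarrow> (nat \<Rightarrow> nat) \<Rightarrow> nat \<Rightarrow> real" where
  "W_var d m p n = measure_pmf.variance (W_dist d m p n) (\<lambda>x. x)"

definition mb_kappa :: "nat \<Rightarrow> nat \<Rightarrow> (nat \<Rightarrow> nat) \<Rightarrow> real" where
  "mb_kappa d m p = ln (real d) / fact m * (\<Prod>j<m. 1 / ln (real (p j)))"

end

theory Submission
  imports Defs "HOL-Real_Asymp.Real_Asymp"
begin

text \<open>
  Give every h in S an independent digit with weights proportional to exp (- r k h), where r is chosen
  so that the sum X of all digits times h has mean n. Conditioned on X = n this is the uniform
  distribution on the representations of n. For h up to N = n / (log n)^(6m) the weights are almost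
  uniform, while only O((log n)^(m-1) log log n) elements of S lie between N and n, so it suffices to
  show that conditioning on X = n hardly affects the small digits.

  Colour S by the sum of the exponents of the first two bases modulo K. The partial sum of X over a
  single colour class has a density which is smooth on the scale of its standard deviation, by Fourier
  inversion. On the minor arcs the characteristic function at x is controlled by the distances of
  x P^a Q^b to the nearest integer, with P and Q powers of the first two bases. A row (b fixed) without
  large distances places x near a fraction with denominator Q^b, and a column (a fixed) without large
  distances near one with denominator P^a; both together force x to be near an integer. Hence away from
  the major arc at least a constant times log n distances are large. Moreover the transfer operator of
  multiplication by P shows that the set of x for which not many more are large has measure n^(o(1)-1).

  Hence small digits outside one colour class are asymptotically independent of each other and of all
  other digits outside that class, even after conditioning. Three colours give all covariances, and
  K \<longrightarrow> \<infinity> colours give the central limit theorem, because the class left out carries a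
  fraction 1/K of the variance.
\<close>

subsection \<open>Distances to the nearest integer along a two-dimensional lattice of multipliers\<close>

text \<open>The obstacle is the resolution that Fourier inversion must reach. Up to powers of log n,
  the standard deviation of X is n and the probability of X = n is 1/n, whereas order log n large
  distances give on the minor arcs only a pointwise saving n^(-delta) with a tiny delta. The
  exponent of the decay is therefore halved: one half is bounded pointwise by n^(-delta), the other
  half is integrated and yields n^(-1 + delta/2). Only the product of the two beats 1/n. The
  integrated half needs a gain close to P for every power of P, although a single digit contributes
  only a small fixed constant. This is bought by running J parallel lines P^a Q^b with b < J, where
  J is fixed but large. For the denominator, the probability of X = n, a lower bound of the right
  order suffices, because afterwards only ratios to it matter.\<close>

definition dist_int :: "real \<Rightarrow> real" where "dist_int u = \<bar>u - of_int (round u)\<bar>"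

lemma dist_int_nonneg [simp]: "0 \<le> dist_int u" by (simp add: dist_int_def)

lemma dist_int_le: "dist_int u \<le> \<bar>u - of_int k\<bar>" unfolding dist_int_def by (rule round_diff_minimal)

lemma dist_int_le_half: "dist_int u \<le> 1/2"
  using of_int_round_abs_le[of u] by (simp add: dist_int_def abs_minus_commute)

lemma dist_int_eq_abs: assumes "\<bar>u\<bar> \<le> 1/2" shows "dist_int u = \<bar>u\<bar>"
proof (rule antisym)
  show "dist_int u \<le> \<bar>u\<bar>" using dist_int_le[of u 0] by simp
  show "\<bar>u\<bar> \<le> dist_int u"
  proof (cases "round u = 0")
    case False
    hence "\<bar>real_of_int (round u)\<bar> \<ge> 1" by linarith
    thus ?thesis using assms unfolding dist_int_def by linarith
  qed (simp add: dist_int_def)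
qed

lemma half_le_sin: assumes "0 \<le> z" "z \<le> pi/2" shows "z/2 \<le> sin z"
proof -
  have "\<bar>sin z - z\<bar> \<le> z^3/6"
    using Maclaurin_sin_bound[of z 3] assms
    by (simp add: eval_nat_numeral sin_coeff_def fact_numeral)
  moreover have "z^3/6 \<le> z/2"
  proof -
    have "pi/2 \<le> 17/10" using pi_approx by simp
    hence "z^2 \<le> (17/10)^2" using assms by (intro power_mono) auto
    hence "z^2 \<le> 3" by (simp add: power2_eq_square)
    hence "z * z^2 \<le> z * 3" using assms by (intro mult_left_mono) auto
    thus ?thesis by (simp add: eval_nat_numeral)
  qed
  ultimately show ?thesis by linarith
qed

text \<open>With v the signed distance, 1 - cos (2 pi u) = 2 sin^2 (pi v); then sin z >= z/2 and pi
  > 3 give at least 2 (3 v / 2)^2 >= 4 v^2.\<close>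

lemma dist_int_sq_le_cos: "4 * (dist_int u)\<^sup>2 \<le> 1 - cos (2*pi*u)"
proof -
  define v where "v = u - of_int (round u)"
  have v: "\<bar>v\<bar> = dist_int u" by (simp add: v_def dist_int_def)
  have "cos (2*pi*u) = cos (2*pi * v + 2*pi * of_int (round u))" by (simp add: v_def algebra_simps)
  also have "\<dots> = cos (2*pi * v)" by (simp add: cos_add)
  also have "\<dots> = cos (2*(pi*\<bar>v\<bar>))" by (cases "v \<ge> 0") (auto simp: mult.assoc)
  also have "\<dots> = 1 - 2 * (sin (pi*\<bar>v\<bar>))\<^sup>2" by (rule cos_double_sin)
  finally have eq: "1 - cos (2*pi*u) = 2 * (sin (pi*\<bar>v\<bar>))\<^sup>2" by simp
  have "pi*\<bar>v\<bar> \<le> pi * (1/2)" using dist_int_le_half[of u] by (intro mult_left_mono) (auto simp: v)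
  hence "(pi*\<bar>v\<bar>)/2 \<le> sin (pi*\<bar>v\<bar>)" by (intro half_le_sin) auto
  moreover have "3*\<bar>v\<bar>/2 \<le> (pi*\<bar>v\<bar>)/2" using pi_gt3 by (auto intro!: mult_right_mono)
  ultimately have "3*\<bar>v\<bar>/2 \<le> sin (pi*\<bar>v\<bar>)" by linarith
  hence "(3*\<bar>v\<bar>/2)\<^sup>2 \<le> (sin (pi*\<bar>v\<bar>))\<^sup>2" by (intro power_mono) auto
  hence "9/4 * \<bar>v\<bar>\<^sup>2 \<le> (sin (pi*\<bar>v\<bar>))\<^sup>2" by (simp add: power2_eq_square)
  moreover have "0 \<le> \<bar>v\<bar>\<^sup>2" by simp
  ultimately show ?thesis unfolding eq v by linarith
qed

text \<open>The nearest integer to P u and P times the nearest integer to u differ by less than (P +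
  1) delta <= 1, so they coincide. Smallness at both ends thus forces the distance to grow by
  exactly the factor P.\<close>

lemma dist_int_mult:
  assumes "dist_int u < \<delta>" "dist_int (real P * u) < \<delta>" "(real P + 1) * \<delta> \<le> 1"
  shows "dist_int (real P * u) = real P * dist_int u"
proof -
  have "\<bar>real P * u - real P * of_int (round u)\<bar> \<le> real P * \<delta>"
    using assms(1) unfolding dist_int_def right_diff_distrib[symmetric] abs_mult
    by (intro mult_mono) auto
  hence "\<bar>of_int (round (real P * u)) - real P * of_int (round u)\<bar> < real P * \<delta> + \<delta>"
    using assms(2) unfolding dist_int_def by linarith
  also have "\<dots> \<le> 1" using assms(3) by (simp add: algebra_simps)
  finally have "\<bar>real_of_int (round (real P * u) - int P * round u)\<bar> < 1" by simp
  hence "round (real P * u) = int P * round u" by linarith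
  hence "real P * u - of_int (round (real P * u)) = real P * (u - of_int (round u))"
    by (simp add: algebra_simps)
  thus ?thesis unfolding dist_int_def by (simp add: abs_mult)
qed

lemma dist_int_power:
  assumes "\<And>a. a \<le> A \<Longrightarrow> dist_int (real P ^ a * u) < \<delta>" "(real P + 1) * \<delta> \<le> 1"
  shows "dist_int (real P ^ A * u) = real P ^ A * dist_int u"
  using assms(1)
proof (induction A)
  case (Suc A)
  have "dist_int (real P * (real P ^ A * u)) = real P * dist_int (real P ^ A * u)"
    using Suc.prems[of A] Suc.prems[of "Suc A"] assms(2)
    by (intro dist_int_mult[of _ \<delta>]) (auto simp: mult.assoc)
  thus ?case using Suc by (simp add: mult.assoc)
qed simp

text \<open>Without a large distance on R, P R, P^2 R, ... up to Z, the distance grows by exactly P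
  at each step and still ends below delta. It must therefore start below delta P R / Z; for integral
  R this places y within delta P / Z of a fraction with denominator R.\<close>

lemma free_line:
  fixes P :: nat and Z y R \<delta> :: real
  assumes "P \<ge> 2" "R > 0" "R \<le> Z" "(real P + 1) * \<delta> \<le> 1"
    and free: "\<And>a. real P ^ a * R \<le> Z \<Longrightarrow> dist_int (real P ^ a * (y * R)) < \<delta>"
  shows "dist_int (y * R) * Z < \<delta> * real P * R"
proof -
  have "\<exists>a. Z < real P ^ a * R"
    using real_arch_pow[of "real P" "Z/R"] assms by (auto simp: field_simps)
  \<comment> \<open>The first exponent that overshoots Z; its predecessor \<open>A\<close> is the
    last one covered by \<open>free\<close>.\<close>
  then obtain a where a: "Z < real P ^ a * R" "\<And>b. b < a \<Longrightarrow> real P ^ b * R \<le> Z"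
    using exists_least_iff[of "\<lambda>a. Z < real P ^ a * R"] by (auto simp: not_less)
  have "a \<noteq> 0" using a(1) assms by (intro notI) auto
  then obtain A where A: "a = Suc A" by (cases a) auto
  have "dist_int (real P ^ A * (y*R)) = real P ^ A * dist_int (y*R)"
  proof (rule dist_int_power)
    fix b assume "b \<le> A"
    thus "dist_int (real P ^ b * (y*R)) < \<delta>" using A by (intro free a(2)) auto
  qed (use assms in auto)
  moreover have "dist_int (real P ^ A * (y*R)) < \<delta>" using A by (intro free a(2)) auto
  ultimately have 1: "real P ^ A * dist_int (y*R) < \<delta>" by simp
  have "dist_int (y*R) * Z \<le> dist_int (y*R) * (real P ^ a * R)" using a(1) by (intro mult_left_mono) auto
  also have "\<dots> = (real P ^ A * dist_int (y*R)) * (real P * R)" by (simp add: A mult_ac)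
  also have "\<dots> < \<delta> * (real P * R)" using 1 assms by (intro mult_strict_right_mono) auto
  finally show ?thesis by (simp add: mult.assoc)
qed

text \<open>If k and l are the integers nearest to y a and y b, then k b - l a is an integer of
  absolute value below 1, hence 0, and a divides k. Two close fractions with coprime denominators
  are thus equal and integral.\<close>

lemma coprime_approx_int:
  fixes a b :: nat and y :: real
  assumes "coprime a b" "dist_int (y * real a) * real b + dist_int (y * real b) * real a < 1"
  shows "\<exists>j::int. round (y * real a) = int a * j"
proof -
  define k l where "k = round (y * real a)" and "l = round (y * real b)"
  have "\<bar>real_of_int (k * int b - l * int a)\<bar>
      = \<bar>(y * real b - of_int l) * real a - (y * real a - of_int k) * real b\<bar>"
    by (simp add: algebra_simps)
  also have "\<dots> \<le> dist_int (y * real a) * real b + dist_int (y * real b) * real a"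
    unfolding dist_int_def k_def[symmetric] l_def[symmetric]
    by (rule order.trans[OF abs_triangle_ineq4]) (simp add: abs_mult)
  also have "\<dots> < 1" by fact
  finally have "k * int b = l * int a" by linarith
  hence "int a dvd k * int b" by simp
  hence "int a dvd k" using assms(1) by (simp add: coprime_dvd_mult_left_iff)
  thus ?thesis unfolding k_def by (auto elim: dvdE)
qed

lemma finite_smooth_pairs:
  fixes P Q :: nat
  assumes "P \<ge> 2" "Q \<ge> 2"
  shows "finite {(a,b). real P ^ a * real Q ^ b \<le> Z}"
proof (rule finite_subset)
  show "{(a,b). real P ^ a * real Q ^ b \<le> Z} \<subseteq> {..nat \<lceil>Z\<rceil>} \<times> {..nat \<lceil>Z\<rceil>}"
  proof safe
    fix a b assume Z: "real P ^ a * real Q ^ b \<le> Z"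
    have *: "real a \<le> real P ^ a" if "P \<ge> 2" for a P :: nat
    proof -
      have "real a \<le> 2 ^ a" using less_exp[of a] by (metis of_nat_le_iff of_nat_numeral of_nat_power less_imp_le)
      also have "\<dots> \<le> real P ^ a" using that by (intro power_mono) auto
      finally show ?thesis .
    qed
    have 1: "1 \<le> real P ^ a" "1 \<le> real Q ^ b" using assms by (auto intro!: one_le_power)
    have "real P ^ a * 1 \<le> real P ^ a * real Q ^ b" "1 * real Q ^ b \<le> real P ^ a * real Q ^ b"
      using 1 by (intro mult_left_mono mult_right_mono; simp)+
    hence "real a \<le> Z" "real b \<le> Z" using *[OF assms(1), of a] *[OF assms(2), of b] Z by linarith+
    thus "a \<le> nat \<lceil>Z\<rceil>" "b \<le> nat \<lceil>Z\<rceil>" by linarith+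
  qed
qed auto

text \<open>A row and a column of the exponent lattice cannot both avoid large values of dist_int, because
  then y would be close to a fraction with denominator a power of P and to one with
  denominator a power of Q, hence to an integer.\<close>
lemma card_bad_pairs_ge:
  fixes P Q :: nat and Z y :: real
  assumes PQ: "P \<ge> 2" "Q \<ge> 2" "coprime P Q" and Z: "Z \<ge> 1" and y: "dist_int y \<ge> 1 / Z"
  shows "ln Z / ln (real P * real Q) \<le> real (card {(a,b). real P ^ a * real Q ^ b \<le> Z \<and>
      dist_int (y * (real P ^ a * real Q ^ b)) \<ge> 1 / (real P + real Q)})" (is "_ \<le> real (card ?B)")
proof -
  \<comment> \<open>With this choice delta P + delta Q = 1, exactly what the contradiction below can
    afford, and (P + 1) delta <= 1 and (Q + 1) delta <= 1 hold as well.\<close>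
  define \<delta> where "\<delta> = 1 / (real P + real Q)"
  have \<delta>: "\<delta> > 0" "(real P + 1) * \<delta> \<le> 1" "(real Q + 1) * \<delta> \<le> 1" "\<delta> * (real P + real Q) = 1"
    "\<delta> * real P \<le> 1"
    using PQ by (auto simp: \<delta>_def field_simps)
  define B where "B = ?B"
  have finB: "finite B" unfolding B_def
    by (rule finite_subset[OF _ finite_smooth_pairs[OF PQ(1,2), of Z]]) auto
  \<comment> \<open>All exponent pairs in the square [0, t] x [0, t] stay below Z, because (P Q)^t
    <= Z.\<close>
  define t where "t = nat \<lfloor>ln Z / ln (real P * real Q)\<rfloor>"
  have "real P * real Q \<ge> 2 * 2" using PQ by (intro mult_mono) auto
  hence PQ1: "real P * real Q > 1" by simp
  hence lnPQ: "ln (real P * real Q) > 0" by simp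
  have t0: "0 \<le> ln Z / ln (real P * real Q)" using Z lnPQ by simp
  have "real t \<le> ln Z / ln (real P * real Q)" using t0 unfolding t_def by linarith
  hence "real t * ln (real P * real Q) \<le> ln Z" using lnPQ by (simp add: field_simps)
  hence "ln ((real P * real Q) ^ t) \<le> ln Z" using PQ1 by (simp add: ln_realpow)
  moreover have "0 < (real P * real Q) ^ t" using PQ1 by (intro zero_less_power) linarith
  ultimately have tZ: "(real P * real Q) ^ t \<le> Z" using Z by (subst (asm) ln_le_cancel_iff) auto
  have abZ: "real P ^ a * real Q ^ b \<le> Z" if "a \<le> t" "b \<le> t" for a b
  proof -
    have "real P ^ a * real Q ^ b \<le> real P ^ t * real Q ^ t"
      using that PQ by (intro mult_mono power_increasing) auto
    also have "\<dots> \<le> Z" using tZ by (simp add: power_mult_distrib)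
    finally show ?thesis .
  qed
  have tcard: "ln Z / ln (real P * real Q) \<le> real (Suc t)" using t0 unfolding t_def by linarith
  have not_both: False if ab: "a \<le> t" "b \<le> t" and row: "\<And>a. (a,b) \<notin> B" and col: "\<And>b. (a,b) \<notin> B" for a b
  proof -
    have r: "dist_int (y * real Q ^ b) * Z < \<delta> * real P * real Q ^ b"
    proof (rule free_line)
      show "real Q ^ b \<le> Z" using abZ[of 0 b] ab by simp
      fix a assume "real P ^ a * real Q ^ b \<le> Z"
      thus "dist_int (real P ^ a * (y * real Q ^ b)) < \<delta>"
        using row[of a] by (auto simp: B_def \<delta>_def not_le mult_ac)
    qed (use PQ \<delta> in auto)
    have c: "dist_int (y * real P ^ a) * Z < \<delta> * real Q * real P ^ a"
    proof (rule free_line)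
      show "real P ^ a \<le> Z" using abZ[of a 0] ab by simp
      fix b assume "real Q ^ b * real P ^ a \<le> Z"
      thus "dist_int (real Q ^ b * (y * real P ^ a)) < \<delta>"
        using col[of b] by (auto simp: B_def \<delta>_def not_le mult_ac)
    qed (use PQ \<delta> in auto)
    have "(dist_int (y * real Q ^ b) * real P ^ a + dist_int (y * real P ^ a) * real Q ^ b) * Z
        = (dist_int (y * real Q ^ b) * Z) * real P ^ a + (dist_int (y * real P ^ a) * Z) * real Q ^ b"
      by (simp add: algebra_simps)
    also have "\<dots> < (\<delta> * real P * real Q ^ b) * real P ^ a + (\<delta> * real Q * real P ^ a) * real Q ^ b"
      using r c PQ by (intro add_strict_mono mult_strict_right_mono) auto
    also have "\<dots> = \<delta> * (real P + real Q) * (real P ^ a * real Q ^ b)" by (simp add: algebra_simps)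
    also have "\<dots> \<le> Z" using abZ[OF ab] \<delta> by simp
    finally have "dist_int (y * real Q ^ b) * real P ^ a + dist_int (y * real P ^ a) * real Q ^ b < 1"
      using Z by simp
    moreover have "coprime (Q ^ b) (P ^ a)" using PQ(3) by (simp add: coprime_commute)
    ultimately obtain j where "round (y * real (Q ^ b)) = int (Q ^ b) * j"
      using coprime_approx_int[of "Q ^ b" "P ^ a" y] by auto
    hence "dist_int (y * real Q ^ b) = \<bar>(y - of_int j) * real Q ^ b\<bar>"
      unfolding dist_int_def by (simp add: algebra_simps)
    hence "dist_int (y * real Q ^ b) = \<bar>y - of_int j\<bar> * real Q ^ b" by (simp add: abs_mult)
    hence "dist_int y * real Q ^ b \<le> dist_int (y * real Q ^ b)" using dist_int_le[of y j] by (simp add: mult_right_mono)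
    hence "dist_int y * real Q ^ b * Z \<le> dist_int (y * real Q ^ b) * Z" using Z by (intro mult_right_mono) auto
    also note r
    finally have "dist_int y * Z * real Q ^ b < \<delta> * real P * real Q ^ b" by (simp add: mult_ac)
    hence "dist_int y * Z < \<delta> * real P" using PQ by (subst (asm) mult_less_cancel_right) auto
    hence "dist_int y * Z < 1" using \<delta> by linarith
    thus False using y Z by (simp add: field_simps)
  qed
  \<comment> \<open>Either each of the t + 1 rows meets \<open>B\<close>, or some row avoids it and
    then, by \<open>not_both\<close>, each of the t + 1 columns meets it.\<close>
  have "Suc t \<le> card B"
  proof (cases "\<forall>b\<le>t. \<exists>a. (a,b) \<in> B")
    case True
    then obtain f where f: "\<And>b. b \<le> t \<Longrightarrow> (f b, b) \<in> B" by metis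
    have "card ((\<lambda>b. (f b, b)) ` {..t}) \<le> card B" using f finB by (intro card_mono) auto
    thus ?thesis by (subst (asm) card_image) (auto simp: inj_on_def)
  next
    case False
    then obtain b where b: "b \<le> t" "\<And>a. (a,b) \<notin> B" by blast
    have "\<forall>a\<le>t. \<exists>b. (a,b) \<in> B" using not_both b by blast
    then obtain f where f: "\<And>a. a \<le> t \<Longrightarrow> (a, f a) \<in> B" by metis
    have "card ((\<lambda>a. (a, f a)) ` {..t}) \<le> card B" using f finB by (intro card_mono) auto
    thus ?thesis by (subst (asm) card_image) (auto simp: inj_on_def)
  qed
  thus ?thesis using tcard unfolding B_def by linarith
qed

lemma sum_cos_bad_pairs_ge:
  fixes P Q :: nat and Z y :: real
  assumes PQ: "P \<ge> 2" "Q \<ge> 2" "coprime P Q" and Z: "Z \<ge> 1" and y: "dist_int y \<ge> 1 / Z"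
  shows "4 / (real P + real Q)\<^sup>2 / ln (real P * real Q) * ln Z
     \<le> (\<Sum>(a,b)\<in>{(a,b). real P ^ a * real Q ^ b \<le> Z}. 1 - cos (2 * pi * (y * (real P ^ a * real Q ^ b))))"
proof -
  let ?I = "{(a,b). real P ^ a * real Q ^ b \<le> Z}"
  let ?B = "{(a,b). real P ^ a * real Q ^ b \<le> Z \<and> dist_int (y * (real P ^ a * real Q ^ b)) \<ge> 1 / (real P + real Q)}"
  have "4 / (real P + real Q)\<^sup>2 / ln (real P * real Q) * ln Z = 4 / (real P + real Q)\<^sup>2 * (ln Z / ln (real P * real Q))"
    by simp
  also have "\<dots> \<le> 4 / (real P + real Q)\<^sup>2 * real (card ?B)"
    using card_bad_pairs_ge[OF assms] by (intro mult_left_mono) auto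
  also have "\<dots> = (\<Sum>(a,b)\<in>?B. 4 / (real P + real Q)\<^sup>2)" by (simp add: case_prod_beta)
  also have "\<dots> \<le> (\<Sum>(a,b)\<in>?B. 1 - cos (2 * pi * (y * (real P ^ a * real Q ^ b))))"
  proof (rule sum_mono, safe)
    fix a b assume "1 / (real P + real Q) \<le> dist_int (y * (real P ^ a * real Q ^ b))"
    hence "(1 / (real P + real Q))\<^sup>2 \<le> (dist_int (y * (real P ^ a * real Q ^ b)))\<^sup>2" by (intro power_mono) auto
    thus "4 / (real P + real Q)\<^sup>2 \<le> 1 - cos (2 * pi * (y * (real P ^ a * real Q ^ b)))"
      using dist_int_sq_le_cos[of "y * (real P ^ a * real Q ^ b)"] by (simp add: power_divide)
  qed
  also have "\<dots> \<le> (\<Sum>(a,b)\<in>?I. 1 - cos (2 * pi * (y * (real P ^ a * real Q ^ b))))"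
    by (rule sum_mono2[OF finite_smooth_pairs[OF PQ(1,2)]]) auto
  finally show ?thesis .
qed

section \<open>The transfer operator of x -> P x on the circle\<close>

lemma integral_unit_split:
  fixes f :: "real \<Rightarrow> real" and P :: nat
  assumes f: "continuous_on UNIV f" and P: "P \<ge> 1"
  shows "integral {0..1} f = (\<Sum>j<P. integral {0..1} (\<lambda>x. f ((x + real j) / real P))) / real P"
proof -
  have int: "f integrable_on {a..b}" for a b
    by (rule integrable_continuous_interval) (rule continuous_on_subset[OF f], auto)
  have piece: "integral {real j / real P .. real (Suc j) / real P} f
      = integral {0..1} (\<lambda>x. f ((x + real j) / real P)) / real P" for j
  proof -
    have hi: "(f has_integral integral {real j / real P .. real (Suc j) / real P} f)
        (cbox (real j / real P) (real (Suc j) / real P))"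
      using int by (auto intro: integrable_integral)
    have e1: "(1 / real P) *\<^sub>R x + real j / real P = (x + real j) / real P" for x
      by (simp add: add_divide_distrib)
    have e2: "(real (Suc j) / real P - real j / real P) /\<^sub>R (1 / real P) = 1"
      using P by (simp add: divide_simps)
    from has_integral_affinity'[OF hi, of "1 / real P" "real j / real P"] P
    have "((\<lambda>x. f ((x + real j) / real P)) has_integral
        integral {real j / real P .. real (Suc j) / real P} f * real P) {0..1}"
      unfolding e1 e2 by (simp add: field_simps)
    hence "integral {0..1} (\<lambda>x. f ((x + real j) / real P)) =
        integral {real j / real P .. real (Suc j) / real P} f * real P"
      by (rule integral_unique)
    thus ?thesis using P by simp
  qed
  have "integral {0..real k / real P} f =
      (\<Sum>j<k. integral {0..1} (\<lambda>x. f ((x + real j) / real P)) / real P)" for k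
  proof (induction k)
    case (Suc k)
    have "integral {0..real (Suc k) / real P} f =
        integral {0..real k / real P} f + integral {real k / real P..real (Suc k) / real P} f"
      using P int by (intro Henstock_Kurzweil_Integration.integral_combine[symmetric]) (auto simp: field_simps)
    thus ?case using Suc piece[of k] by simp
  qed simp
  from this[of P] show ?thesis using P by (simp add: sum_divide_distrib)
qed

lemma periodic_shift_nat:
  assumes "\<And>x::real. G (x + 1) = G x"
  shows "G (x + real j) = G x"
proof (induction j)
  case (Suc j)
  show ?case using assms[of "x + real j"] Suc by (simp add: add_ac)
qed simp

text \<open>On the inverse branch x -> (x + j) / P the factor G (P x) becomes G x by periodicity, so
  only the weights add up over j. The number k bounds the weighted transfer operator applied to a
  constant.\<close>

lemma integral_transfer_le:
  fixes w G :: "real \<Rightarrow> real" and P :: nat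
  assumes P: "P \<ge> 1" and w: "continuous_on UNIV w" and G: "continuous_on UNIV G"
    and per: "\<And>x. G (x + 1) = G x" and G0: "\<And>x. 0 \<le> G x"
    and k: "\<And>x. (\<Sum>j<P. w ((x + real j) / real P)) \<le> k * real P"
  shows "integral {0..1} (\<lambda>x. w x * G (real P * x)) \<le> k * integral {0..1} G"
proof -
  have cw: "continuous_on A (\<lambda>x. w (h x))" if "continuous_on A h" for A h
    using continuous_on_compose2[OF w that] by auto
  have cG: "continuous_on A (\<lambda>x. G (h x))" if "continuous_on A h" for A h
    using continuous_on_compose2[OF G that] by auto
  have "integral {0..1} (\<lambda>x. w x * G (real P * x)) =
      (\<Sum>j<P. integral {0..1} (\<lambda>x. w ((x + real j) / real P) * G (real P * ((x + real j) / real P)))) / real P"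
    using P by (intro integral_unit_split continuous_intros cw cG) auto
  also have "(\<Sum>j<P. integral {0..1} (\<lambda>x. w ((x + real j) / real P) * G (real P * ((x + real j) / real P))))
      = (\<Sum>j<P. integral {0..1} (\<lambda>x. w ((x + real j) / real P) * G x))"
    using P by (intro sum.cong refl) (simp add: periodic_shift_nat[of G, OF per])
  also have "\<dots> = integral {0..1} (\<lambda>x. \<Sum>j<P. w ((x + real j) / real P) * G x)"
    using P by (intro integral_sum[symmetric] integrable_continuous_interval continuous_intros cw cG) auto
  also have "\<dots> \<le> integral {0..1} (\<lambda>x. k * real P * G x)"
  proof (rule integral_le)
    fix x :: real
    show "(\<Sum>j<P. w ((x + real j) / real P) * G x) \<le> k * real P * G x"
      unfolding sum_distrib_right[symmetric] by (intro mult_right_mono k G0)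
  qed (use P in \<open>auto intro!: integrable_continuous_interval continuous_intros cw cG\<close>)
  also have "\<dots> = k * real P * integral {0..1} G" by simp
  finally show ?thesis using P by (simp add: field_simps)
qed

lemma integral_dilate_le:
  fixes G :: "real \<Rightarrow> real" and P :: nat
  assumes P: "P \<ge> 1" and G: "continuous_on UNIV G"
    and per: "\<And>x. G (x + 1) = G x" and G0: "\<And>x. 0 \<le> G x"
  shows "integral {0..1} (\<lambda>x. G (real P * x)) \<le> integral {0..1} G"
  using integral_transfer_le[OF P _ G per G0, of "\<lambda>_. 1" 1] by simp

text \<open>The points (x + j) / P are spaced 1/P apart on the circle, so at most one lies within
  1/(2 P) of an integer. That one costs at most 1; at every other point 1 - cos is at least 4 / (2
  P)^2 = 1 / P^2.\<close>

lemma sum_exp_cos_le: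
  fixes P :: nat and c x :: real
  assumes P: "P \<ge> 1" and c: "c > 0"
  shows "(\<Sum>j<P. exp (- c * (1 - cos (2 * pi * ((x + real j) / real P))))) \<le> 1 + real P * exp (- c / (real P)\<^sup>2)"
proof -
  let ?w = "\<lambda>j. exp (- c * (1 - cos (2 * pi * ((x + real j) / real P))))"
  let ?n = "\<lambda>j. dist_int ((x + real j) / real P)"
  define B where "B = {j. j < P \<and> ?n j < 1 / (2 * real P)}"
  have finB: "finite B" by (simp add: B_def)
  have eq: "i = j" if "i \<in> B" "j \<in> B" for i j
  proof (rule ccontr)
    assume ij: "i \<noteq> j"
    define k where "k = round ((x + real i) / real P) - round ((x + real j) / real P)"
    have "\<bar>(real i - real j) / real P - of_int k\<bar> =
        \<bar>((x + real i) / real P - of_int (round ((x + real i) / real P))) -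
         ((x + real j) / real P - of_int (round ((x + real j) / real P)))\<bar>"
      by (simp add: k_def diff_divide_distrib add_divide_distrib)
    also have "\<dots> \<le> ?n i + ?n j" unfolding dist_int_def by (rule abs_triangle_ineq4)
    also have "\<dots> < 1 / real P" using that by (auto simp: B_def)
    finally have "\<bar>(real i - real j) / real P - of_int k\<bar> * real P < 1" using P by (simp add: field_simps)
    hence "\<bar>((real i - real j) / real P - of_int k) * real P\<bar> < 1" by (simp add: abs_mult)
    also have "((real i - real j) / real P - of_int k) * real P = real_of_int (int i - int j - k * int P)"
      using P by (simp add: field_simps)
    finally have "int i - int j = k * int P" by linarith
    moreover have "\<bar>int i - int j\<bar> < int P" using that by (auto simp: B_def)
    ultimately have "\<bar>k\<bar> * int P < 1 * int P" by (metis abs_mult abs_of_nat mult_1)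
    hence "k = 0" using P by (subst (asm) mult_less_cancel_right) auto
    with \<open>int i - int j = k * int P\<close> ij show False by simp
  qed
  have "card B \<le> 1" using eq by (metis card_le_Suc0_iff_eq finB One_nat_def)
  have "(\<Sum>j<P. ?w j) \<le> (\<Sum>j<P. (if j \<in> B then 1 else 0) + exp (- c / (real P)\<^sup>2))"
  proof (rule sum_mono)
    fix j assume j: "j \<in> {..<P}"
    show "?w j \<le> (if j \<in> B then 1 else 0) + exp (- c / (real P)\<^sup>2)"
    proof (cases "j \<in> B")
      case True
      have "?w j \<le> 1" using c by auto
      moreover have "0 < exp (- c / (real P)\<^sup>2)" by simp
      ultimately have "?w j \<le> 1 + exp (- c / (real P)\<^sup>2)" by linarith
      thus ?thesis using True by (simp only: if_True)
    next
      case False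
      hence "1 / (2 * real P) \<le> ?n j" using j by (auto simp: B_def)
      hence "(1 / (2 * real P))\<^sup>2 \<le> (?n j)\<^sup>2" by (intro power_mono) auto
      hence "1 / (real P)\<^sup>2 \<le> 4 * (?n j)\<^sup>2" by (simp add: power_divide power_mult_distrib)
      also have "\<dots> \<le> 1 - cos (2 * pi * ((x + real j) / real P))" by (rule dist_int_sq_le_cos)
      finally have "c * (1 / (real P)\<^sup>2) \<le> c * (1 - cos (2 * pi * ((x + real j) / real P)))"
        using c by (intro mult_left_mono) auto
      thus ?thesis using False by simp
    qed
  qed
  also have "\<dots> = real (card B) + real P * exp (- c / (real P)\<^sup>2)"
  proof -
    have "(\<Sum>j<P. if j \<in> B then 1 else 0::real) = real (card B)"
      by (subst sum.If_cases) (auto simp: B_def Int_def intro!: arg_cong[where f = card])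
    thus ?thesis by (simp add: sum.distrib)
  qed
  also have "\<dots> \<le> 1 + real P * exp (- c / (real P)\<^sup>2)" using \<open>card B \<le> 1\<close> by simp
  finally show ?thesis .
qed

lemma cos_periodic_nat_mult: "cos (2 * pi * (real k * (x + 1))) = cos (2 * pi * (real k * x))"
proof -
  have "cos (2 * pi * (real k * (x + 1))) = cos (2 * pi * (real k * x) + 2 * pi * real k)"
    by (simp add: algebra_simps)
  also have "\<dots> = cos (2 * pi * (real k * x))"
    using cos_int_2pin[of "int k"] sin_int_2pin[of "int k"] by (simp add: cos_add)
  finally show ?thesis .
qed

text \<open>The factor a = 0 serves as the weight and the remaining factors form the same product of
  length A at P x, so each power of P gains the same factor. It is close to 1/P only when c is
  large.\<close>

lemma integral_exp_cos_powers_le: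
  fixes P :: nat and c :: real
  assumes P: "P \<ge> 1" and c: "c > 0"
  shows "integral {0..1} (\<lambda>x. exp (- c * (\<Sum>a<A. 1 - cos (2 * pi * (real (P ^ a) * x)))))
    \<le> ((1 + real P * exp (- c / (real P)\<^sup>2)) / real P) ^ A"
proof (induction A)
  case (Suc A)
  let ?G = "\<lambda>A x. exp (- c * (\<Sum>a<A. 1 - cos (2 * pi * (real (P ^ a) * x))))"
  let ?k = "(1 + real P * exp (- c / (real P)\<^sup>2)) / real P"
  have "integral {0..1} (?G (Suc A)) =
      integral {0..1} (\<lambda>x. exp (- c * (1 - cos (2 * pi * x))) * ?G A (real P * x))"
    by (subst sum.lessThan_Suc_shift)
       (simp add: exp_add[symmetric] algebra_simps del: sum.lessThan_Suc of_nat_power)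
  also have "\<dots> \<le> ?k * integral {0..1} (?G A)"
  proof (rule integral_transfer_le[OF P])
    fix x
    show "?G A (x + 1) = ?G A x" by (simp only: cos_periodic_nat_mult)
    show "(\<Sum>j<P. exp (- c * (1 - cos (2 * pi * ((x + real j) / real P))))) \<le> ?k * real P"
      using sum_exp_cos_le[OF P c, of x] P by simp
  qed (auto intro!: continuous_intros)
  also have "\<dots> \<le> ?k * ?k ^ A" using Suc by (intro mult_left_mono) (auto intro!: divide_nonneg_nonneg add_nonneg_nonneg)
  finally show ?case by simp
qed simp

text \<open>Some line has at most the average exponent, so the exponential of the total is dominated
  by a sum over the J lines of exponentials with c J in place of c. This turns a fixed small c into
  a large one at the cost of a factor J; the dilation by g Q^b does not increase the
  integral.\<close>

lemma integral_exp_cos_lines_le: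
  fixes P Q g J :: nat and c :: real
  assumes P: "P \<ge> 1" "Q \<ge> 1" "g \<ge> 1" "J \<ge> 1" and c: "c > 0"
  shows "integral {0..1} (\<lambda>x. exp (- c * (\<Sum>b<J. \<Sum>a<A. 1 - cos (2 * pi * (real (P ^ a) * (real (g * Q ^ b) * x))))))
    \<le> real J * ((1 + real P * exp (- (c * real J) / (real P)\<^sup>2)) / real P) ^ A"
proof -
  let ?E = "\<lambda>x. \<Sum>a<A. 1 - cos (2 * pi * (real (P ^ a) * x))"
  have "exp (- c * (\<Sum>b<J. ?E (real (g * Q ^ b) * x))) \<le>
     (\<Sum>b<J. exp (- (c * real J) * ?E (real (g * Q ^ b) * x)))" for x
  proof -
    have "\<exists>b<J. real J * ?E (real (g * Q ^ b) * x) \<le> (\<Sum>b<J. ?E (real (g * Q ^ b) * x))"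
    proof (rule ccontr)
      assume "\<not> ?thesis"
      hence "(\<Sum>b<J. (\<Sum>b<J. ?E (real (g * Q ^ b) * x))) < (\<Sum>b<J. real J * ?E (real (g * Q ^ b) * x))"
        using P by (intro sum_strict_mono) (auto simp: not_le lessThan_empty_iff)
      thus False by (simp add: sum_distrib_left)
    qed
    then obtain b where b: "b < J" "real J * ?E (real (g * Q ^ b) * x) \<le> (\<Sum>b<J. ?E (real (g * Q ^ b) * x))" by blast
    have "exp (- c * (\<Sum>b<J. ?E (real (g * Q ^ b) * x))) \<le> exp (- (c * real J) * ?E (real (g * Q ^ b) * x))"
      using b(2) c mult_left_mono[OF b(2), of c] by (simp add: mult.assoc)
    also have "\<dots> \<le> (\<Sum>b<J. exp (- (c * real J) * ?E (real (g * Q ^ b) * x)))"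
      by (rule member_le_sum) (use b in auto)
    finally show ?thesis .
  qed
  hence "integral {0..1} (\<lambda>x. exp (- c * (\<Sum>b<J. ?E (real (g * Q ^ b) * x)))) \<le>
      integral {0..1} (\<lambda>x. \<Sum>b<J. exp (- (c * real J) * ?E (real (g * Q ^ b) * x)))"
    by (intro integral_le) (auto intro!: integrable_continuous_interval continuous_intros)
  also have "\<dots> = (\<Sum>b<J. integral {0..1} (\<lambda>x. exp (- (c * real J) * ?E (real (g * Q ^ b) * x))))"
    by (intro integral_sum) (auto intro!: integrable_continuous_interval continuous_intros)
  also have "\<dots> \<le> (\<Sum>b<J. integral {0..1} (\<lambda>x. exp (- (c * real J) * ?E x)))"
  proof (rule sum_mono)
    fix b
    show "integral {0..1} (\<lambda>x. exp (- (c * real J) * ?E (real (g * Q ^ b) * x))) \<le> integral {0..1} (\<lambda>x. exp (- (c * real J) * ?E x))"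
      by (rule integral_dilate_le[of "g * Q ^ b" "\<lambda>x. exp (- (c * real J) * ?E x)"])
         (use P in \<open>auto intro!: continuous_intros simp: cos_periodic_nat_mult simp del: of_nat_power\<close>)
  qed
  also have "\<dots> \<le> (\<Sum>b<J. ((1 + real P * exp (- (c * real J) / (real P)\<^sup>2)) / real P) ^ A)"
    by (intro sum_mono integral_exp_cos_powers_le) (use P c in auto)
  finally show ?thesis by simp
qed

section \<open>Counting the elements of S on a logarithmic scale\<close>

lemma power_Suc_diff_le:
  fixes x y :: real
  assumes "0 \<le> y" "y \<le> x"
  shows "x ^ Suc k - y ^ Suc k \<le> real (Suc k) * x ^ k * (x - y)"
    and "real (Suc k) * y ^ k * (x - y) \<le> x ^ Suc k - y ^ Suc k"
proof (induction k)
  case (Suc k)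
  have e: "x ^ Suc (Suc k) - y ^ Suc (Suc k) = x * (x ^ Suc k - y ^ Suc k) + y ^ Suc k * (x - y)"
    "x ^ Suc (Suc k) - y ^ Suc (Suc k) = y * (x ^ Suc k - y ^ Suc k) + x ^ Suc k * (x - y)"
    by (simp_all add: algebra_simps)
  {
    case 1
    have "x * (x ^ Suc k - y ^ Suc k) \<le> x * (real (Suc k) * x ^ k * (x - y))"
      using Suc assms by (intro mult_left_mono) auto
    moreover have "y ^ Suc k * (x - y) \<le> x ^ Suc k * (x - y)"
      using assms by (intro mult_right_mono power_mono) auto
    ultimately show ?case unfolding e(1) by (simp add: algebra_simps)
  next
    case 2
    have "y * (real (Suc k) * y ^ k * (x - y)) \<le> y * (x ^ Suc k - y ^ Suc k)"
      using Suc assms by (intro mult_left_mono) auto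
    moreover have "y ^ Suc k * (x - y) \<le> x ^ Suc k * (x - y)"
      using assms by (intro mult_right_mono power_mono) auto
    ultimately show ?case unfolding e(2) by (simp add: algebra_simps)
  }
qed simp_all

text \<open>The upper Riemann sum of step w against the integral of s^k over [0, t]; the topmost
  term is peeled off.\<close>

lemma sum_progression_power_ge:
  fixes w t :: real
  assumes "w > 0" "real T * w \<le> t" "t < real (Suc T) * w"
  shows "t ^ Suc k \<le> real (Suc k) * w * (\<Sum>a\<le>T. (t - real a * w) ^ k)"
  using assms(2,3)
proof (induction T arbitrary: t)
  case 0
  have "t * t ^ k \<le> (real (Suc k) * w) * t ^ k"
  proof (rule mult_right_mono)
    have "t \<le> 1 * w" using 0 by simp
    also have "\<dots> \<le> real (Suc k) * w" using assms by (intro mult_right_mono) auto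
    finally show "t \<le> real (Suc k) * w" .
  qed (use 0 in auto)
  thus ?case by simp
next
  case (Suc T)
  have tw: "0 \<le> t - w" using Suc.prems assms(1) by (simp add: algebra_simps) (smt (verit) mult_nonneg_nonneg of_nat_0_le_iff)
  have "t ^ Suc k - (t - w) ^ Suc k \<le> real (Suc k) * t ^ k * (t - (t - w))"
    using tw assms(1) by (intro power_Suc_diff_le) auto
  moreover have "(t - w) ^ Suc k \<le> real (Suc k) * w * (\<Sum>a\<le>T. ((t - w) - real a * w) ^ k)"
    using Suc.prems by (intro Suc.IH) (auto simp: algebra_simps)
  moreover have "(\<Sum>a\<le>Suc T. (t - real a * w) ^ k) = t ^ k + (\<Sum>a\<le>T. ((t - w) - real a * w) ^ k)"
    by (subst sum.atMost_Suc_shift) (simp add: algebra_simps)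
  ultimately show ?case by (simp add: algebra_simps)
qed

text \<open>The companion bound with the interval enlarged by one step. In
  \<open>mb_cnt_bounds\<close> the shift \<open>v\<close> is the error accumulated from the
  lower-dimensional slices.\<close>

lemma sum_progression_power_le:
  fixes w t v :: real
  assumes "w > 0" "v \<ge> 0" "real T * w \<le> t"
  shows "real (Suc k) * w * (\<Sum>a\<le>T. (t - real a * w + v) ^ k) \<le> (t + w + v) ^ Suc k"
  using assms(3)
proof (induction T arbitrary: t)
  case 0
  have "real (Suc k) * (t + v) ^ k * ((t + w + v) - (t + v)) \<le> (t + w + v) ^ Suc k - (t + v) ^ Suc k"
    using 0 assms by (intro power_Suc_diff_le) auto
  moreover have "0 \<le> (t + v) ^ Suc k" using 0 assms by (intro zero_le_power) auto
  ultimately show ?case by (simp add: algebra_simps)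
next
  case (Suc T)
  have tw: "0 \<le> t - w" using Suc.prems assms(1) by (simp add: algebra_simps) (smt (verit) mult_nonneg_nonneg of_nat_0_le_iff)
  have "real (Suc k) * (t + v) ^ k * ((t + w + v) - (t + v)) \<le> (t + w + v) ^ Suc k - (t + v) ^ Suc k"
    using tw assms by (intro power_Suc_diff_le) auto
  moreover have "real (Suc k) * w * (\<Sum>a\<le>T. ((t - w) - real a * w + v) ^ k) \<le> ((t - w) + w + v) ^ Suc k"
    using Suc.prems by (intro Suc.IH) (auto simp: algebra_simps)
  moreover have "(\<Sum>a\<le>Suc T. (t - real a * w + v) ^ k) = (t + v) ^ k + (\<Sum>a\<le>T. ((t - w) - real a * w + v) ^ k)"
    by (subst sum.atMost_Suc_shift) (simp add: algebra_simps)
  ultimately show ?case by (simp add: algebra_simps)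
qed

lemma mb_S_0: "mb_S 0 p = {1}" by (auto simp: mb_S_def)

lemma mb_S_Suc: "mb_S (Suc m) p = {g * p m ^ a |g a. g \<in> mb_S m p}"
proof (intro set_eqI iffI)
  fix h assume "h \<in> {g * p m ^ a |g a. g \<in> mb_S m p}"
  then obtain \<alpha> a where h: "h = (\<Prod>i<m. p i ^ \<alpha> i) * p m ^ a" by (auto simp: mb_S_def)
  have "h = (\<Prod>i<Suc m. p i ^ (\<alpha>(m := a)) i)" unfolding h by simp
  thus "h \<in> mb_S (Suc m) p" unfolding mb_S_def by blast
qed (auto simp: mb_S_def)

lemma mb_S_pos: "(\<And>i. i < m \<Longrightarrow> p i > 0) \<Longrightarrow> h \<in> mb_S m p \<Longrightarrow> h > 0"
  by (auto simp: mb_S_def intro!: prod_pos)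

lemma finite_mb_S_le: "finite {h \<in> mb_S m p. real h \<le> z}"
  by (rule finite_subset[of _ "{..nat \<lfloor>z\<rfloor>}"]) (auto simp: le_nat_floor)

text \<open>For pairwise coprime bases this counts the integer points of the simplex in which the
  sum of alpha_i ln p_i is at most t; its volume is t^m / (m! prod ln p_i).\<close>

definition mb_cnt :: "nat \<Rightarrow> (nat \<Rightarrow> nat) \<Rightarrow> real \<Rightarrow> nat" where
  "mb_cnt m p t = card {h \<in> mb_S m p. real h \<le> exp t}"

text \<open>Slicing by the exponent of the last base; the slices are disjoint because that base is
  coprime to all others.\<close>

lemma mb_cnt_Suc:
  assumes p: "\<And>i. i \<le> m \<Longrightarrow> p i > 1"
    and cop: "\<And>i j. i \<le> m \<Longrightarrow> j \<le> m \<Longrightarrow> i \<noteq> j \<Longrightarrow> coprime (p i) (p j)" and t: "t \<ge> 0"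
  shows "mb_cnt (Suc m) p t = (\<Sum>a\<le>nat \<lfloor>t / ln (real (p m))\<rfloor>. mb_cnt m p (t - real a * ln (real (p m))))"
proof -
  define w where "w = ln (real (p m))"
  have w: "w > 0" using p[of m] by (simp add: w_def)
  define T where "T = nat \<lfloor>t / w\<rfloor>"
  have pw: "real (p m) ^ a = exp (real a * w)" for a
    using p[of m] by (simp add: w_def exp_of_nat_mult)
  define B where "B = (\<lambda>a. (\<lambda>g. g * p m ^ a) ` {h \<in> mb_S m p. real h \<le> exp (t - real a * w)})"
  have le_iff: "real (g * p m ^ a) \<le> exp t \<longleftrightarrow> real g \<le> exp (t - real a * w)" for g a
    using p[of m] by (simp add: pw exp_diff field_simps)
  have aT: "a \<le> T" if "g \<in> mb_S m p" "real g \<le> exp (t - real a * w)" for a g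
  proof -
    have "g > 0" using that(1) mb_S_pos[of m p g] p by (meson less_imp_le less_trans zero_less_one)
    hence "1 \<le> real g" by simp
    hence "1 \<le> exp (t - real a * w)" using that(2) by linarith
    hence "real a * w \<le> t" by simp
    hence "real a \<le> t / w" using w by (simp add: field_simps)
    thus ?thesis unfolding T_def by (simp add: le_nat_floor)
  qed
  have "{h \<in> mb_S (Suc m) p. real h \<le> exp t} = (\<Union>a\<in>{..T}. B a)"
  proof (intro set_eqI iffI)
    fix h assume "h \<in> {h \<in> mb_S (Suc m) p. real h \<le> exp t}"
    then obtain g a where g: "g \<in> mb_S m p" "h = g * p m ^ a" "real (g * p m ^ a) \<le> exp t"
      unfolding mb_S_Suc by blast
    from g(3) have "real g \<le> exp (t - real a * w)" by (simp only: le_iff)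
    with g aT[OF g(1)] show "h \<in> (\<Union>a\<in>{..T}. B a)" unfolding B_def by blast
  next
    fix h assume "h \<in> (\<Union>a\<in>{..T}. B a)"
    then obtain g a where g: "g \<in> mb_S m p" "h = g * p m ^ a" "real g \<le> exp (t - real a * w)"
      unfolding B_def by blast
    from g(3) have "real (g * p m ^ a) \<le> exp t" by (simp only: le_iff)
    with g show "h \<in> {h \<in> mb_S (Suc m) p. real h \<le> exp t}" unfolding mb_S_Suc by blast
  qed
  moreover have "card (\<Union>a\<in>{..T}. B a) = (\<Sum>a\<le>T. card (B a))"
  proof (rule card_UN_disjoint)
    have cg: "coprime g (p m)" if "g \<in> mb_S m p" for g
      using that cop by (auto simp: mb_S_def intro!: prod_coprime_left)
    have key: "a = b" if "g \<in> mb_S m p" "g' \<in> mb_S m p" "g * p m ^ a = g' * p m ^ b" "a \<le> b" for g g' a b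
    proof -
      have "g * p m ^ a = g' * p m ^ (b - a) * p m ^ a" using that(3,4) by (simp add: mult.assoc power_add[symmetric])
      hence "g = g' * p m ^ (b - a)" using p[of m] by simp
      hence "coprime (p m ^ (b - a)) (p m)" using cg[OF that(1)] by simp
      hence "b - a = 0" using p[of m] by (cases "b - a") auto
      thus ?thesis using that(4) by simp
    qed
    have "a = b" if "g \<in> mb_S m p" "g' \<in> mb_S m p" "g * p m ^ a = g' * p m ^ b" for g g' a b
      using key[of g g' a b] key[of g' g b a] that by (metis nat_le_linear)
    thus "\<forall>i\<in>{..T}. \<forall>j\<in>{..T}. i \<noteq> j \<longrightarrow> B i \<inter> B j = {}" unfolding B_def by blast
    show "\<forall>a\<in>{..T}. finite (B a)" unfolding B_def by (auto intro!: finite_imageI finite_mb_S_le)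
  qed auto
  moreover have "card (B a) = mb_cnt m p (t - real a * w)" for a
    unfolding B_def mb_cnt_def using p[of m] by (subst card_image) (auto simp: inj_on_def)
  ultimately show ?thesis unfolding mb_cnt_def T_def w_def by simp
qed

text \<open>Iterated slicing compares the count with simplex volumes: size t from below, and from
  above size t plus the edge lengths ln p_i of a unit cell.\<close>

lemma mb_cnt_bounds:
  assumes p: "\<And>i. i < m \<Longrightarrow> p i > 1"
    and cop: "\<And>i j. i < m \<Longrightarrow> j < m \<Longrightarrow> i \<noteq> j \<Longrightarrow> coprime (p i) (p j)" and t: "t \<ge> 0"
  shows "t ^ m \<le> fact m * (\<Prod>i<m. ln (real (p i))) * real (mb_cnt m p t)"
    and "fact m * (\<Prod>i<m. ln (real (p i))) * real (mb_cnt m p t) \<le> (t + (\<Sum>i<m. ln (real (p i)))) ^ m"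
proof -
  have "t ^ m \<le> fact m * (\<Prod>i<m. ln (real (p i))) * real (mb_cnt m p t) \<and>
     fact m * (\<Prod>i<m. ln (real (p i))) * real (mb_cnt m p t) \<le> (t + (\<Sum>i<m. ln (real (p i)))) ^ m"
    using assms
  proof (induction m arbitrary: t)
    case 0
    have "{h \<in> mb_S 0 p. real h \<le> exp t} = {1}" using 0(3) by (auto simp: mb_S_0)
    thus ?case by (simp add: mb_cnt_def)
  next
    case (Suc m)
    define w where "w = ln (real (p m))"
    define T where "T = nat \<lfloor>t / w\<rfloor>"
    define W where "W = (\<Prod>i<m. ln (real (p i)))"
    define v where "v = (\<Sum>i<m. ln (real (p i)))"
    have w: "w > 0" using Suc.prems(1)[of m] by (simp add: w_def)
    have v: "v \<ge> 0" unfolding v_def using Suc.prems(1) 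
      by (intro sum_nonneg ln_ge_zero) (metis lessThan_iff less_Suc_eq less_imp_le of_nat_1 of_nat_le_iff)
    have "t / w \<ge> 0" using w Suc.prems(3) by simp
    hence "real T \<le> t / w" "t / w < real (Suc T)" unfolding T_def by linarith+
    hence T: "real T * w \<le> t" "t < real (Suc T) * w" using w by (simp_all add: field_simps)
    have aw: "0 \<le> t - real a * w" if "a \<le> T" for a
    proof -
      have "real a * w \<le> real T * w" using that w by (intro mult_right_mono) auto
      thus ?thesis using T by linarith
    qed
    have IH: "(t - real a * w) ^ m \<le> fact m * W * real (mb_cnt m p (t - real a * w))"
       "fact m * W * real (mb_cnt m p (t - real a * w)) \<le> (t - real a * w + v) ^ m" if "a \<le> T" for a
      using Suc.IH[of "t - real a * w"] aw[OF that] Suc.prems(1,2) unfolding W_def v_def by auto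
    have eq: "fact (Suc m) * (\<Prod>i<Suc m. ln (real (p i))) * real (mb_cnt (Suc m) p t)
        = real (Suc m) * w * (\<Sum>a\<le>T. fact m * W * real (mb_cnt m p (t - real a * w)))"
      using mb_cnt_Suc[of m p t] Suc.prems
      by (simp add: T_def[unfolded w_def] w_def W_def sum_distrib_left mult_ac)
    have "t ^ Suc m \<le> real (Suc m) * w * (\<Sum>a\<le>T. (t - real a * w) ^ m)"
      by (rule sum_progression_power_ge[OF w T])
    also have "\<dots> \<le> real (Suc m) * w * (\<Sum>a\<le>T. fact m * W * real (mb_cnt m p (t - real a * w)))"
      using w IH(1) by (intro mult_left_mono sum_mono) auto
    finally have 1: "t ^ Suc m \<le> \<dots>" .
    have "real (Suc m) * w * (\<Sum>a\<le>T. fact m * W * real (mb_cnt m p (t - real a * w))) \<le>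
       real (Suc m) * w * (\<Sum>a\<le>T. (t - real a * w + v) ^ m)"
      using w IH(2) by (intro mult_left_mono sum_mono) auto
    also have "\<dots> \<le> (t + w + v) ^ Suc m" by (rule sum_progression_power_le[OF w v T(1)])
    finally have 2: "real (Suc m) * w * (\<Sum>a\<le>T. fact m * W * real (mb_cnt m p (t - real a * w))) \<le> \<dots>" .
    show ?case using 1 2 unfolding eq by (simp add: v_def w_def add_ac)
  qed
  thus "t ^ m \<le> fact m * (\<Prod>i<m. ln (real (p i))) * real (mb_cnt m p t)"
    and "fact m * (\<Prod>i<m. ln (real (p i))) * real (mb_cnt m p t) \<le> (t + (\<Sum>i<m. ln (real (p i)))) ^ m"
    by auto
qed

subsection \<open>Independent digits and Fourier inversion\<close>

text \<open>The geometric law with ratio exp (- r h), truncated to the digits below d.\<close>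

definition digit_wt :: "nat \<Rightarrow> real \<Rightarrow> nat \<Rightarrow> nat \<Rightarrow> real" where
  "digit_wt d r h k = exp (- r * real k * real h) / (\<Sum>j<d. exp (- r * real j * real h))"

text \<open>The default value 0 off A lets configurations on disjoint sets be glued by pointwise
  addition.\<close>

abbreviation cfgs :: "nat \<Rightarrow> nat set \<Rightarrow> (nat \<Rightarrow> nat) set" where
  "cfgs d A \<equiv> PiE_dflt A 0 (\<lambda>_. {..<d})"

text \<open>Expectation for independent digits, written as a finite sum so that real and complex
  integrands share one set of rules.\<close>

definition digit_exp :: "nat \<Rightarrow> real \<Rightarrow> nat set \<Rightarrow> ((nat \<Rightarrow> nat) \<Rightarrow> 'a::real_normed_field) \<Rightarrow> 'a" where
  "digit_exp d r A F = (\<Sum>a\<in>cfgs d A. (\<Prod>h\<in>A. digit_wt d r h (a h)) *\<^sub>R F a)"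

text \<open>Stands in for measurability with respect to the digits in A.\<close>

definition depends_on :: "nat set \<Rightarrow> ((nat \<Rightarrow> nat) \<Rightarrow> 'a) \<Rightarrow> bool" where
  "depends_on A F \<longleftrightarrow> (\<forall>a b. (\<forall>h\<in>A. a h = b h) \<longrightarrow> F a = F b)"

definition digit_sum :: "nat set \<Rightarrow> (nat \<Rightarrow> nat) \<Rightarrow> nat" where "digit_sum A a = (\<Sum>h\<in>A. a h * h)"

definition nonzeros :: "nat set \<Rightarrow> (nat \<Rightarrow> nat) \<Rightarrow> nat" where "nonzeros A a = (\<Sum>h\<in>A. of_bool (a h \<noteq> 0))"

definition digit_char :: "nat \<Rightarrow> real \<Rightarrow> nat set \<Rightarrow> real \<Rightarrow> complex" where
  "digit_char d r A x = digit_exp d r A (\<lambda>a. cis (2 * pi * x * real (digit_sum A a)))"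

lemma depends_onI: "(\<And>a b. (\<And>h. h \<in> A \<Longrightarrow> a h = b h) \<Longrightarrow> F a = F b) \<Longrightarrow> depends_on A F"
  unfolding depends_on_def by blast

lemma depends_onD: "depends_on A F \<Longrightarrow> (\<And>h. h \<in> A \<Longrightarrow> a h = b h) \<Longrightarrow> F a = F b"
  unfolding depends_on_def by blast

lemma depends_digit_sum: "depends_on A (digit_sum A)" by (rule depends_onI) (auto simp: digit_sum_def)
lemma depends_nonzeros: "depends_on A (nonzeros A)" by (rule depends_onI) (auto simp: nonzeros_def intro!: sum.cong)
lemma depends_comp: "depends_on A F \<Longrightarrow> depends_on A (\<lambda>a. g (F a))" unfolding depends_on_def by metis
lemma depends_comp2: "depends_on A F \<Longrightarrow> depends_on A G \<Longrightarrow> depends_on A (\<lambda>a. g (F a) (G a))" unfolding depends_on_def by metis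
lemma depends_const: "depends_on A (\<lambda>_. c)" unfolding depends_on_def by simp
lemma depends_mono: "depends_on A F \<Longrightarrow> A \<subseteq> B \<Longrightarrow> depends_on B F" unfolding depends_on_def by blast

lemma digit_wt_pos: "d \<ge> 1 \<Longrightarrow> 0 < digit_wt d r h k"
  unfolding digit_wt_def by (intro divide_pos_pos sum_pos) (auto simp: lessThan_empty_iff)

lemma digit_wt_nonneg: "0 \<le> digit_wt d r h k"
  unfolding digit_wt_def by (intro divide_nonneg_nonneg sum_nonneg) auto

lemma sum_digit_wt: assumes "d \<ge> 1" shows "(\<Sum>k<d. digit_wt d r h k) = 1"
proof -
  have "0 < (\<Sum>j<d. exp (- r * real j * real h))"
    using assms by (intro sum_pos) (auto simp: lessThan_empty_iff)
  thus ?thesis unfolding digit_wt_def sum_divide_distrib[symmetric] by simp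
qed

lemma finite_cfgs: "finite A \<Longrightarrow> finite (cfgs d A)" by auto

lemma digit_exp_cong: "(\<And>a. a \<in> cfgs d A \<Longrightarrow> F a = G a) \<Longrightarrow> digit_exp d r A F = digit_exp d r A G"
  unfolding digit_exp_def by (intro sum.cong) auto

lemma digit_exp_add: "digit_exp d r A (\<lambda>a. F a + G a) = digit_exp d r A F + digit_exp d r A G"
  by (simp add: digit_exp_def scaleR_add_right sum.distrib)

lemma digit_exp_diff: "digit_exp d r A (\<lambda>a. F a - G a) = digit_exp d r A F - digit_exp d r A G"
  by (simp add: digit_exp_def scaleR_diff_right sum_subtractf)

lemma digit_exp_cmult: "digit_exp d r A (\<lambda>a. c * F a) = c * digit_exp d r A F"
  by (simp add: digit_exp_def sum_distrib_left mult_scaleR_right)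

lemma digit_exp_multc: "digit_exp d r A (\<lambda>a. F a * c) = digit_exp d r A F * c"
  by (simp add: digit_exp_def sum_distrib_right)

lemma digit_exp_sum: "digit_exp d r A (\<lambda>a. \<Sum>i\<in>I. F i a) = (\<Sum>i\<in>I. digit_exp d r A (F i))"
  unfolding digit_exp_def scaleR_sum_right by (rule sum.swap)

lemma digit_exp_of_real: "digit_exp d r A (\<lambda>a. of_real (F a)) = of_real (digit_exp d r A F)"
  by (simp add: digit_exp_def scaleR_conv_of_real)

lemma digit_exp_mono: "(\<And>a. a \<in> cfgs d A \<Longrightarrow> F a \<le> G a) \<Longrightarrow> digit_exp d r A F \<le> (digit_exp d r A G :: real)"
  unfolding digit_exp_def by (intro sum_mono) (auto intro!: mult_left_mono prod_nonneg digit_wt_nonneg)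

lemma norm_digit_exp_le: "norm (digit_exp d r A F) \<le> digit_exp d r A (\<lambda>a. norm (F a))"
  unfolding digit_exp_def
  by (rule sum_norm_le) (simp add: abs_prod prod_nonneg digit_wt_nonneg abs_of_nonneg)

lemma digit_exp_union:
  assumes "finite A" "finite B" "A \<inter> B = {}"
  shows "digit_exp d r (A \<union> B) F = digit_exp d r A (\<lambda>f. digit_exp d r B (\<lambda>g. F (\<lambda>x. f x + g x)))"
proof -
  have "digit_exp d r A (\<lambda>f. digit_exp d r B (\<lambda>g. F (\<lambda>x. f x + g x))) =
     (\<Sum>(f,g)\<in>cfgs d A \<times> cfgs d B. ((\<Prod>h\<in>A. digit_wt d r h (f h)) * (\<Prod>h\<in>B. digit_wt d r h (g h))) *\<^sub>R F (\<lambda>x. f x + g x))"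
    unfolding digit_exp_def scaleR_sum_right by (simp add: sum.cartesian_product)
  also have "\<dots> = (\<Sum>a\<in>cfgs d (A \<union> B). (\<Prod>h\<in>A \<union> B. digit_wt d r h (a h)) *\<^sub>R F a)"
  proof (rule sum.reindex_bij_witness[of _ "\<lambda>a. (\<lambda>x. if x \<in> A then a x else 0, \<lambda>x. if x \<in> B then a x else 0)"
        "\<lambda>(f,g). (\<lambda>x. f x + g x)"])
    fix fg assume fg: "fg \<in> cfgs d A \<times> cfgs d B"
    obtain f g where [simp]: "fg = (f,g)" by (cases fg)
    have f: "f x = 0" if "x \<notin> A" for x using fg that by (auto simp: PiE_dflt_def)
    have g: "g x = 0" if "x \<notin> B" for x using fg that by (auto simp: PiE_dflt_def)
    show "(\<lambda>a. (\<lambda>x. if x \<in> A then a x else 0, \<lambda>x. if x \<in> B then a x else 0)) ((\<lambda>(f, g). (\<lambda>x. f x + g x)) fg) = fg"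
    proof -
      have "(if x \<in> A then f x + g x else 0) = f x" "(if x \<in> B then f x + g x else 0) = g x" for x
        using f[of x] g[of x] assms(3) by auto
      thus ?thesis unfolding \<open>fg = (f,g)\<close> prod.case by simp
    qed
    show "(\<lambda>(f, g). (\<lambda>x. f x + g x)) fg \<in> cfgs d (A \<union> B)"
    proof -
      have "(x \<in> A \<union> B \<longrightarrow> f x + g x < d) \<and> (x \<notin> A \<union> B \<longrightarrow> f x + g x = 0)" for x
        using f[of x] g[of x] fg assms(3) by (cases "x \<in> A"; cases "x \<in> B") (auto simp: PiE_dflt_def)
      thus ?thesis by (auto simp: PiE_dflt_def)
    qed
    have "(\<Prod>h\<in>A \<union> B. digit_wt d r h (f h + g h)) = (\<Prod>h\<in>A. digit_wt d r h (f h + g h)) * (\<Prod>h\<in>B. digit_wt d r h (f h + g h))"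
      by (rule prod.union_disjoint) fact+
    also have "(\<Prod>h\<in>A. digit_wt d r h (f h + g h)) = (\<Prod>h\<in>A. digit_wt d r h (f h))"
      using g assms(3) by (intro prod.cong refl) (metis Int_iff add.right_neutral empty_iff)
    also have "(\<Prod>h\<in>B. digit_wt d r h (f h + g h)) = (\<Prod>h\<in>B. digit_wt d r h (g h))"
      using f assms(3) by (intro prod.cong refl) (metis Int_iff add.left_neutral empty_iff)
    finally show "(\<Prod>h\<in>A \<union> B. digit_wt d r h ((case fg of (f, g) \<Rightarrow> \<lambda>x. f x + g x) h)) *\<^sub>R F (case fg of (f, g) \<Rightarrow> \<lambda>x. f x + g x) =
        (case fg of (f, g) \<Rightarrow> ((\<Prod>h\<in>A. digit_wt d r h (f h)) * (\<Prod>h\<in>B. digit_wt d r h (g h))) *\<^sub>R F (\<lambda>x. f x + g x))"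
      by simp
  next
    fix a assume a: "a \<in> cfgs d (A \<union> B)"
    show "(\<lambda>(f, g). (\<lambda>x. f x + g x)) (\<lambda>x. if x \<in> A then a x else 0, \<lambda>x. if x \<in> B then a x else 0) = a"
      using a assms(3) by (auto simp: PiE_dflt_def fun_eq_iff)
    show "(\<lambda>x. if x \<in> A then a x else 0, \<lambda>x. if x \<in> B then a x else 0) \<in> cfgs d A \<times> cfgs d B"
      using a by (auto simp: PiE_dflt_def)
  qed
  finally show ?thesis by (simp add: digit_exp_def)
qed

lemma digit_exp_singleton: "digit_exp d r {h} F = (\<Sum>k<d. digit_wt d r h k *\<^sub>R F (\<lambda>x. if x = h then k else 0))"
  unfolding digit_exp_def
  by (rule sum.reindex_bij_witness[of _ "\<lambda>k x. if x = h then k else 0" "\<lambda>a. a h"])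
     (auto simp: PiE_dflt_def fun_eq_iff intro!: arg_cong[where f = F])

lemma digit_exp_empty: "digit_exp d r {} F = F (\<lambda>_. 0)"
proof -
  have "cfgs d {} = {\<lambda>_. 0}" by (auto simp: PiE_dflt_def)
  thus ?thesis by (simp add: digit_exp_def)
qed

lemma digit_exp_const:
  assumes "finite A" "d \<ge> 1" shows "digit_exp d r A (\<lambda>_. c) = c"
  using assms(1)
proof induction
  case (insert h A)
  have "digit_exp d r ({h} \<union> A) (\<lambda>_. c) = digit_exp d r {h} (\<lambda>_. digit_exp d r A (\<lambda>_. c))"
    using insert by (intro digit_exp_union) auto
  thus ?case using insert sum_digit_wt[OF assms(2), of r h] by (simp add: digit_exp_singleton scaleR_left.sum[symmetric])
qed (simp add: digit_exp_empty)

lemma digit_exp_mult: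
  assumes "finite A" "finite B" "A \<inter> B = {}" "depends_on A F" "depends_on B G"
  shows "digit_exp d r (A \<union> B) (\<lambda>a. F a * G a) = digit_exp d r A F * digit_exp d r B G"
proof -
  have "digit_exp d r (A \<union> B) (\<lambda>a. F a * G a) = digit_exp d r A (\<lambda>f. digit_exp d r B (\<lambda>g. F f * G g))"
    unfolding digit_exp_union[OF assms(1-3)]
  proof (intro digit_exp_cong)
    fix f g assume fg: "f \<in> cfgs d A" "g \<in> cfgs d B"
    have "F (\<lambda>x. f x + g x) = F f" using fg assms(3) by (intro depends_onD[OF assms(4)]) (auto simp: PiE_dflt_def)
    moreover have "G (\<lambda>x. f x + g x) = G g" using fg assms(3) by (intro depends_onD[OF assms(5)]) (auto simp: PiE_dflt_def)
    ultimately show "F (\<lambda>x. f x + g x) * G (\<lambda>x. f x + g x) = F f * G g" by simp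
  qed
  thus ?thesis by (simp add: digit_exp_cmult digit_exp_multc)
qed

lemma digit_exp_superset:
  assumes "finite B" "A \<subseteq> B" "depends_on A F" "d \<ge> 1"
  shows "digit_exp d r B F = digit_exp d r A F"
proof -
  have "digit_exp d r (A \<union> (B - A)) (\<lambda>a. F a * 1) = digit_exp d r A F * digit_exp d r (B - A) (\<lambda>_. 1)"
    using assms by (intro digit_exp_mult depends_const) (auto intro: finite_subset)
  thus ?thesis using assms by (simp add: digit_exp_const Un_absorb1)
qed

lemma digit_exp_prod:
  assumes "finite A"
  shows "digit_exp d r A (\<lambda>a. \<Prod>h\<in>A. f h (a h)) = (\<Prod>h\<in>A. \<Sum>k<d. digit_wt d r h k *\<^sub>R f h k)"
  using assms
proof induction
  case (insert h A)
  have "digit_exp d r ({h} \<union> A) (\<lambda>a. f h (a h) * (\<Prod>h\<in>A. f h (a h))) =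
      digit_exp d r {h} (\<lambda>a. f h (a h)) * digit_exp d r A (\<lambda>a. \<Prod>h\<in>A. f h (a h))"
    using insert by (intro digit_exp_mult) (auto intro!: depends_onI prod.cong)
  thus ?case using insert by (simp add: digit_exp_singleton)
qed (simp add: digit_exp_empty)

lemma cis_digit_sum: "finite A \<Longrightarrow> cis (2 * pi * x * real (digit_sum A a)) = (\<Prod>h\<in>A. cis (2 * pi * (x * real h) * real (a h)))"
  unfolding digit_sum_def
proof (induction A rule: finite_induct)
  case (insert h A)
  have "cis (2 * pi * x * real (\<Sum>h\<in>insert h A. a h * h)) =
      cis (2 * pi * (x * real h) * real (a h)) * cis (2 * pi * x * real (\<Sum>h\<in>A. a h * h))"
    unfolding cis_mult using insert by (intro arg_cong[where f = cis]) (simp add: algebra_simps)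
  thus ?case using insert by simp
qed simp

lemma digit_char_prod:
  assumes "finite A"
  shows "digit_char d r A x = (\<Prod>h\<in>A. \<Sum>k<d. digit_wt d r h k *\<^sub>R cis (2 * pi * (x * real h) * real k))"
  unfolding digit_char_def cis_digit_sum[OF assms] by (rule digit_exp_prod[OF assms])

lemma norm_digit_char_le_1: assumes "finite A" "d \<ge> 1" shows "norm (digit_char d r A x) \<le> 1"
  unfolding digit_char_def using digit_exp_const[OF assms, of r "1::real"]
  by (intro order.trans[OF norm_digit_exp_le]) simp

lemma digit_char_union:
  assumes "finite A" "finite B" "A \<inter> B = {}"
  shows "digit_char d r (A \<union> B) x = digit_char d r A x * digit_char d r B x"
  using assms by (simp add: digit_char_prod prod.union_disjoint)

lemma norm_digit_char_antimono:
  assumes "finite B" "A \<subseteq> B" "d \<ge> 1"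
  shows "norm (digit_char d r B x) \<le> norm (digit_char d r A x)"
proof -
  have "digit_char d r (A \<union> (B - A)) x = digit_char d r A x * digit_char d r (B - A) x"
    using assms by (intro digit_char_union) (auto intro: finite_subset)
  hence "norm (digit_char d r B x) = norm (digit_char d r A x) * norm (digit_char d r (B - A) x)"
    using assms by (simp add: Un_absorb1 norm_mult)
  also have "\<dots> \<le> norm (digit_char d r A x) * 1"
    using assms by (intro mult_left_mono norm_digit_char_le_1) auto
  finally show ?thesis by simp
qed

lemma continuous_on_digit_exp [continuous_intros]:
  assumes "\<And>a. continuous_on T (\<lambda>x. F x a)"
  shows "continuous_on T (\<lambda>x. digit_exp d r A (F x))"
  unfolding digit_exp_def by (intro continuous_intros assms)

lemma continuous_on_cis_real [continuous_intros]:
  "continuous_on T f \<Longrightarrow> continuous_on T (\<lambda>x. cis (f x))"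
  unfolding cis_conv_exp by (intro continuous_intros)

lemma continuous_on_digit_char [continuous_intros]: "continuous_on T (digit_char d r A)"
proof -
  have "digit_char d r A = (\<lambda>x. digit_exp d r A (\<lambda>a. cis (2 * pi * x * real (digit_sum A a))))" by (simp add: digit_char_def fun_eq_iff)
  thus ?thesis by (simp, intro continuous_intros)
qed

lemma integral_cis_int:
  fixes k :: int
  shows "integral {-1/2..1/2} (\<lambda>x. cis (2 * pi * x * real_of_int k)) = of_bool (k = 0)"
proof (cases "k = 0")
  case False
  define F where "F = (\<lambda>x::real. cis (2 * pi * x * real_of_int k) / (2 * pi * real_of_int k * \<i>))"
  have "((\<lambda>x. cis (2 * pi * x * real_of_int k)) has_integral (F (1/2) - F (-1/2))) {-1/2..1/2}"
  proof (rule fundamental_theorem_of_calculus)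
    fix x :: real
    show "(F has_vector_derivative cis (2 * pi * x * real_of_int k)) (at x within {-1/2..1/2})"
      unfolding F_def cis_conv_exp using False
      by (auto intro!: derivative_eq_intros has_vector_derivative_real_field simp: field_simps)
  qed auto
  moreover have "F (1/2) = F (-1/2)"
  proof -
    have "cis (pi * real_of_int k) = cis (- pi * real_of_int k) * cis (2 * pi * real_of_int k)"
      by (simp add: cis_mult algebra_simps)
    also have "cis (2 * pi * real_of_int k) = 1" by (simp add: cis_multiple_2pi)
    finally show ?thesis by (simp add: F_def)
  qed
  ultimately show ?thesis using False by (simp add: integral_unique)
qed simp

lemma digit_exp_at_eq_integral:
  fixes F :: "(nat \<Rightarrow> nat) \<Rightarrow> complex"
  assumes H: "finite H"
  shows "digit_exp d r H (\<lambda>a. of_bool (digit_sum H a = n) * F a) =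
     integral {-1/2..1/2} (\<lambda>x. cis (- (2 * pi * x * real n)) * digit_exp d r H (\<lambda>a. F a * cis (2 * pi * x * real (digit_sum H a))))"
proof -
  have "digit_exp d r H (\<lambda>a. of_bool (digit_sum H a = n) * F a) =
      digit_exp d r H (\<lambda>a. integral {-1/2..1/2} (\<lambda>x. cis (2 * pi * x * real_of_int (int (digit_sum H a) - int n))) * F a)"
    unfolding integral_cis_int by (intro digit_exp_cong) simp
  also have "\<dots> = (\<Sum>a\<in>cfgs d H. integral {-1/2..1/2} (\<lambda>x. (\<Prod>h\<in>H. digit_wt d r h (a h)) *\<^sub>R
      (cis (2 * pi * x * real_of_int (int (digit_sum H a) - int n)) * F a)))"
    unfolding digit_exp_def by simp
  also have "\<dots> = integral {-1/2..1/2} (\<lambda>x. \<Sum>a\<in>cfgs d H. (\<Prod>h\<in>H. digit_wt d r h (a h)) *\<^sub>R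
      (cis (2 * pi * x * real_of_int (int (digit_sum H a) - int n)) * F a))"
    using finite_cfgs[OF H] by (intro integral_sum[symmetric] integrable_continuous_interval continuous_intros)
  also have "\<dots> = integral {-1/2..1/2} (\<lambda>x. cis (- (2 * pi * x * real n)) * digit_exp d r H (\<lambda>a. F a * cis (2 * pi * x * real (digit_sum H a))))"
    unfolding digit_exp_cmult[symmetric] unfolding digit_exp_def
    by (intro integral_cong sum.cong refl arg_cong[where f = "\<lambda>x. _ *\<^sub>R x"])
       (simp add: cis_mult mult.assoc mult.left_commute[of "F _"] algebra_simps)
  finally show ?thesis .
qed

lemma digit_sum_union: "finite A \<Longrightarrow> finite B \<Longrightarrow> A \<inter> B = {} \<Longrightarrow> digit_sum (A \<union> B) a = digit_sum A a + digit_sum B a"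
  unfolding digit_sum_def by (rule sum.union_disjoint)

text \<open>After inversion at n the integrand factors over three independent blocks: the digits
  seen by F, those seen by G, and the remaining ones, which enter only through their characteristic
  function.\<close>

lemma digit_exp_at_split:
  fixes F G :: "(nat \<Rightarrow> nat) \<Rightarrow> complex"
  assumes H: "finite H" "U \<subseteq> H" "V \<subseteq> H" "U \<inter> V = {}" and F: "depends_on U F" and G: "depends_on V G"
  shows "digit_exp d r H (\<lambda>a. of_bool (digit_sum H a = n) * (F a * G a)) =
     integral {-1/2..1/2} (\<lambda>x. cis (- (2 * pi * x * real n)) *
        (digit_exp d r U (\<lambda>a. F a * cis (2 * pi * x * real (digit_sum U a))) *
         digit_exp d r V (\<lambda>a. G a * cis (2 * pi * x * real (digit_sum V a))) * digit_char d r (H - U - V) x))"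
proof -
  define R where "R = H - U - V"
  have fin: "finite U" "finite V" "finite R" using H by (auto simp: R_def intro: finite_subset)
  have dis: "U \<inter> (V \<union> R) = {}" "V \<inter> R = {}" using H by (auto simp: R_def)
  have HU: "H = U \<union> (V \<union> R)" using H by (auto simp: R_def)
  have "digit_exp d r H (\<lambda>a. F a * G a * cis (2 * pi * x * real (digit_sum H a))) =
      digit_exp d r U (\<lambda>a. F a * cis (2 * pi * x * real (digit_sum U a))) *
         digit_exp d r V (\<lambda>a. G a * cis (2 * pi * x * real (digit_sum V a))) * digit_char d r R x" for x
  proof -
    have "digit_exp d r H (\<lambda>a. F a * G a * cis (2 * pi * x * real (digit_sum H a))) =
      digit_exp d r (U \<union> (V \<union> R)) (\<lambda>a. (F a * cis (2 * pi * x * real (digit_sum U a))) *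
       ((G a * cis (2 * pi * x * real (digit_sum V a))) * cis (2 * pi * x * real (digit_sum R a))))"
      unfolding HU using fin dis
      by (intro digit_exp_cong) (simp add: digit_sum_union cis_mult[symmetric] distrib_left mult_ac)
    also have "\<dots> = digit_exp d r U (\<lambda>a. F a * cis (2 * pi * x * real (digit_sum U a))) *
       digit_exp d r (V \<union> R) (\<lambda>a. (G a * cis (2 * pi * x * real (digit_sum V a))) * cis (2 * pi * x * real (digit_sum R a)))"
    proof (rule digit_exp_mult)
      show "depends_on (V \<union> R) (\<lambda>a. G a * cis (2 * pi * x * real (digit_sum V a)) * cis (2 * pi * x * real (digit_sum R a)))"
        by (intro depends_comp2[where g = "(*)"] depends_comp[of _ _ "\<lambda>y. cis (2 * pi * x * real y)"]
             depends_mono[OF G] depends_mono[OF depends_digit_sum]) auto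
    qed (use fin dis in \<open>auto intro!: depends_comp2[where g = "(*)"] depends_comp[of _ _ "\<lambda>y. cis (2 * pi * x * real y)"] depends_digit_sum F\<close>)
    also have "digit_exp d r (V \<union> R) (\<lambda>a. (G a * cis (2 * pi * x * real (digit_sum V a))) * cis (2 * pi * x * real (digit_sum R a)))
       = digit_exp d r V (\<lambda>a. G a * cis (2 * pi * x * real (digit_sum V a))) * digit_char d r R x"
      unfolding digit_char_def
      by (rule digit_exp_mult) (use fin dis in \<open>auto intro!: depends_comp2[where g = "(*)"] depends_comp[of _ _ "\<lambda>y. cis (2 * pi * x * real y)"] depends_digit_sum G\<close>)
    finally show ?thesis by (simp add: mult.assoc)
  qed
  thus ?thesis unfolding digit_exp_at_eq_integral[OF H(1)] R_def by simp
qed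

lemma norm_digit_exp_le_const:
  assumes "finite A" "d \<ge> 1" "\<And>a. a \<in> cfgs d A \<Longrightarrow> norm (F a) \<le> B"
  shows "norm (digit_exp d r A F) \<le> B"
proof -
  have "norm (digit_exp d r A F) \<le> digit_exp d r A (\<lambda>a. norm (F a))" by (rule norm_digit_exp_le)
  also have "\<dots> \<le> digit_exp d r A (\<lambda>_. B)" by (rule digit_exp_mono) (rule assms)
  finally show ?thesis using assms by (simp add: digit_exp_const)
qed

lemma norm_cis_minus_1_le: "norm (cis t - 1) \<le> \<bar>t\<bar>"
  using iexp_approx1[of t 0] by (simp add: cis_conv_exp)

text \<open>The digits in U barely notice the value of digit_sum, as long as the characteristic function of a
  disjoint block T decays.\<close>
lemma digit_exp_at_decouple:
  fixes F G :: "(nat \<Rightarrow> nat) \<Rightarrow> complex"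
  assumes H: "finite H" "U \<subseteq> H" "V \<subseteq> H" "U \<inter> V = {}" "T \<subseteq> H - U - V" and d: "d \<ge> 1"
    and F: "depends_on U F" and G: "depends_on V G"
    and FB: "\<And>a. norm (F a) \<le> B" and GC: "\<And>a. norm (G a) \<le> C"
    and M: "\<And>a. a \<in> cfgs d U \<Longrightarrow> real (digit_sum U a) \<le> M"
  shows "norm (digit_exp d r H (\<lambda>a. of_bool (digit_sum H a = n) * (F a * G a)) -
           digit_exp d r U F * digit_exp d r H (\<lambda>a. of_bool (digit_sum H a = n) * G a))
      \<le> B * C * integral {-1/2..1/2} (\<lambda>x. min 2 (4 * pi * \<bar>x\<bar> * M) * norm (digit_char d r T x))"
proof -
  define e where "e = (\<lambda>x a. cis (2 * pi * x * real (digit_sum U a)))"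
  define K where "K = (\<lambda>x. digit_exp d r V (\<lambda>a. G a * cis (2 * pi * x * real (digit_sum V a))))"
  define R where "R = H - U - V"
  have fin: "finite U" "finite V" "finite R" using H by (auto simp: R_def intro: finite_subset)
  have B0: "0 \<le> B" using FB[of undefined] norm_ge_zero order.trans by blast
  have C0: "0 \<le> C" using GC[of undefined] norm_ge_zero order.trans by blast
  have "digit_exp d r H (\<lambda>a. of_bool (digit_sum H a = n) * (F a * G a)) =
      integral {-1/2..1/2} (\<lambda>x. cis (- (2 * pi * x * real n)) * (digit_exp d r U (\<lambda>a. F a * e x a) * K x * digit_char d r R x))"
    unfolding e_def K_def R_def by (rule digit_exp_at_split) fact+
  moreover have "digit_exp d r H (\<lambda>a. of_bool (digit_sum H a = n) * G a) =
      integral {-1/2..1/2} (\<lambda>x. cis (- (2 * pi * x * real n)) * (digit_exp d r U (e x) * K x * digit_char d r R x))"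
    using digit_exp_at_split[OF H(1-4) depends_const[of U 1] G, of d r n] unfolding e_def K_def R_def by simp
  moreover have ce: "continuous_on T' (\<lambda>x. e x a)" for T' a unfolding e_def by (intro continuous_intros)
  have cK: "continuous_on T' K" for T' unfolding K_def by (intro continuous_intros)
  ultimately have eq: "digit_exp d r H (\<lambda>a. of_bool (digit_sum H a = n) * (F a * G a)) -
           digit_exp d r U F * digit_exp d r H (\<lambda>a. of_bool (digit_sum H a = n) * G a) =
      integral {-1/2..1/2} (\<lambda>x. cis (- (2 * pi * x * real n)) * ((digit_exp d r U (\<lambda>a. F a * e x a) - digit_exp d r U F * digit_exp d r U (e x)) * K x * digit_char d r R x))"
  proof -
    have "integral {-1/2..1/2} (\<lambda>x. cis (- (2 * pi * x * real n)) * ((digit_exp d r U (\<lambda>a. F a * e x a) - digit_exp d r U F * digit_exp d r U (e x)) * K x * digit_char d r R x))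
      = integral {-1/2..1/2} (\<lambda>x. cis (- (2 * pi * x * real n)) * (digit_exp d r U (\<lambda>a. F a * e x a) * K x * digit_char d r R x) -
          digit_exp d r U F * (cis (- (2 * pi * x * real n)) * (digit_exp d r U (e x) * K x * digit_char d r R x)))"
      by (intro integral_cong) (simp add: algebra_simps)
    also have "\<dots> = integral {-1/2..1/2} (\<lambda>x. cis (- (2 * pi * x * real n)) * (digit_exp d r U (\<lambda>a. F a * e x a) * K x * digit_char d r R x)) -
       integral {-1/2..1/2} (\<lambda>x. digit_exp d r U F * (cis (- (2 * pi * x * real n)) * (digit_exp d r U (e x) * K x * digit_char d r R x)))"
      by (intro integral_diff integrable_continuous_interval continuous_intros ce cK)
    finally show ?thesis
      using \<open>digit_exp d r H (\<lambda>a. of_bool (digit_sum H a = n) * (F a * G a)) = _\<close>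
       \<open>digit_exp d r H (\<lambda>a. of_bool (digit_sum H a = n) * G a) = _\<close> by simp
  qed
  have ptw: "norm (cis (- (2 * pi * x * real n)) * ((digit_exp d r U (\<lambda>a. F a * e x a) - digit_exp d r U F * digit_exp d r U (e x)) * K x * digit_char d r R x))
      \<le> B * C * (min 2 (4 * pi * \<bar>x\<bar> * M) * norm (digit_char d r T x))" for x
  proof -
    have e1: "norm (e x a - 1) \<le> 2 * pi * \<bar>x\<bar> * M" if "a \<in> cfgs d U" for a
    proof -
      have "norm (e x a - 1) \<le> \<bar>2 * pi * x * real (digit_sum U a)\<bar>" unfolding e_def by (rule norm_cis_minus_1_le)
      also have "\<dots> = 2 * pi * \<bar>x\<bar> * real (digit_sum U a)" by (simp add: abs_mult)
      also have "\<dots> \<le> 2 * pi * \<bar>x\<bar> * M" using M[OF that] by (intro mult_left_mono) auto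
      finally show ?thesis .
    qed
    have e2: "norm (digit_exp d r U (e x) - 1) \<le> 2 * pi * \<bar>x\<bar> * M"
    proof -
      have "digit_exp d r U (e x) - 1 = digit_exp d r U (\<lambda>a. e x a - 1)" using fin d by (simp add: digit_exp_diff digit_exp_const)
      also have "norm \<dots> \<le> 2 * pi * \<bar>x\<bar> * M" by (rule norm_digit_exp_le_const[OF fin(1) d e1])
      finally show ?thesis .
    qed
    have e3: "norm (digit_exp d r U (e x)) \<le> 1" by (rule norm_digit_exp_le_const[OF fin(1) d]) (simp add: e_def)
    \<comment> \<open>The difference to be estimated is the expectation of F times the centred phase
      of U. The centred phase is trivially at most 2, and of order |x| M because the digit sum on U
      is at most M.\<close>
    have e4: "norm (e x a - digit_exp d r U (e x)) \<le> min 2 (4 * pi * \<bar>x\<bar> * M)" if "a \<in> cfgs d U" for a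
    proof -
      have "norm (e x a - digit_exp d r U (e x)) \<le> norm (e x a) + norm (digit_exp d r U (e x))" by (rule norm_triangle_ineq4)
      also have "\<dots> \<le> 2" using e3 by (simp add: e_def)
      finally have 1: "norm (e x a - digit_exp d r U (e x)) \<le> 2" .
      have "norm (e x a - digit_exp d r U (e x)) = norm ((e x a - 1) - (digit_exp d r U (e x) - 1))" by simp
      also have "\<dots> \<le> 2 * pi * \<bar>x\<bar> * M + 2 * pi * \<bar>x\<bar> * M"
        by (rule order.trans[OF norm_triangle_ineq4]) (intro add_mono e1 e2 that)
      also have "\<dots> = 4 * pi * \<bar>x\<bar> * M" by simp
      finally show ?thesis using 1 by (intro min.boundedI)
    qed
    have "digit_exp d r U (\<lambda>a. F a * e x a) - digit_exp d r U F * digit_exp d r U (e x) = digit_exp d r U (\<lambda>a. F a * (e x a - digit_exp d r U (e x)))"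
      by (simp add: right_diff_distrib digit_exp_diff digit_exp_multc)
    also have "norm \<dots> \<le> B * min 2 (4 * pi * \<bar>x\<bar> * M)"
      by (rule norm_digit_exp_le_const[OF fin(1) d]) (auto simp: norm_mult intro!: mult_mono FB B0 e4)
    finally have 1: "norm (digit_exp d r U (\<lambda>a. F a * e x a) - digit_exp d r U F * digit_exp d r U (e x)) \<le> B * min 2 (4 * pi * \<bar>x\<bar> * M)" .
    have 2: "norm (K x) \<le> C" unfolding K_def
      by (rule norm_digit_exp_le_const[OF fin(2) d]) (simp add: norm_mult GC)
    have 3: "norm (digit_char d r R x) \<le> norm (digit_char d r T x)"
      using H d fin by (intro norm_digit_char_antimono) (auto simp: R_def)
    have "norm (cis (- (2 * pi * x * real n)) * ((digit_exp d r U (\<lambda>a. F a * e x a) - digit_exp d r U F * digit_exp d r U (e x)) * K x * digit_char d r R x))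
      = norm (digit_exp d r U (\<lambda>a. F a * e x a) - digit_exp d r U F * digit_exp d r U (e x)) * norm (K x) * norm (digit_char d r R x)"
      by (simp add: norm_mult)
    also have "\<dots> \<le> (B * min 2 (4 * pi * \<bar>x\<bar> * M)) * C * norm (digit_char d r T x)"
      using order.trans[OF norm_ge_zero 1] C0 by (intro mult_mono 1 2 3) auto
    finally show ?thesis by (simp add: mult_ac)
  qed
  show ?thesis unfolding eq integral_mult_right[symmetric]
    by (rule integral_norm_bound_integral)
       (use ptw in \<open>auto intro!: integrable_continuous_interval continuous_intros ce cK\<close>)
qed

text \<open>All characteristic function factors outside V and T are bounded by 1. Once the integral
  is comparable to the probability of digit sum n, conditioning raises expectations of functions of
  V by at most a constant factor.\<close>

lemma digit_exp_at_le:
  fixes F :: "(nat \<Rightarrow> nat) \<Rightarrow> real"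
  assumes H: "finite H" "V \<subseteq> H" "T \<subseteq> H - V" and d: "d \<ge> 1"
    and F: "depends_on V F" and F0: "\<And>a. 0 \<le> F a"
  shows "digit_exp d r H (\<lambda>a. of_bool (digit_sum H a = n) * F a) \<le> digit_exp d r V F * integral {-1/2..1/2} (\<lambda>x. norm (digit_char d r T x))"
proof -
  have fin: "finite V" "finite (H - V)" using H by (auto intro: finite_subset)
  have depF: "depends_on V (\<lambda>a. complex_of_real (F a))" using F by (rule depends_comp)
  let ?I = "\<lambda>x. cis (- (2 * pi * x * real n)) *
        (digit_exp d r {} (\<lambda>a. 1 * cis (2 * pi * x * real (digit_sum {} a))) *
         digit_exp d r V (\<lambda>a. complex_of_real (F a) * cis (2 * pi * x * real (digit_sum V a))) * digit_char d r (H - {} - V) x)"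
  have "complex_of_real (digit_exp d r H (\<lambda>a. of_bool (digit_sum H a = n) * F a)) =
      digit_exp d r H (\<lambda>a. of_bool (digit_sum H a = n) * (1 * complex_of_real (F a)))"
    by (subst digit_exp_of_real[symmetric]) (intro digit_exp_cong, simp)
  also have "\<dots> = integral {-1/2..1/2} (\<lambda>x. cis (- (2 * pi * x * real n)) *
        (digit_exp d r {} (\<lambda>a. 1 * cis (2 * pi * x * real (digit_sum {} a))) *
         digit_exp d r V (\<lambda>a. complex_of_real (F a) * cis (2 * pi * x * real (digit_sum V a))) * digit_char d r (H - {} - V) x))"
    using H by (intro digit_exp_at_split depends_const depF) auto
  finally have eq: "complex_of_real (digit_exp d r H (\<lambda>a. of_bool (digit_sum H a = n) * F a)) = integral {-1/2..1/2} ?I" .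
  have "norm (integral {-1/2..1/2} ?I) \<le> integral {-1/2..1/2} (\<lambda>x. digit_exp d r V F * norm (digit_char d r T x))"
  proof (rule integral_norm_bound_integral)
    fix x
    have "norm (digit_exp d r V (\<lambda>a. complex_of_real (F a) * cis (2 * pi * x * real (digit_sum V a)))) \<le> digit_exp d r V F"
      by (rule order.trans[OF norm_digit_exp_le]) (simp add: norm_mult F0)
    moreover have "norm (digit_char d r (H - V) x) \<le> norm (digit_char d r T x)"
      using H fin d by (intro norm_digit_char_antimono) auto
    moreover have "0 \<le> digit_exp d r V F" unfolding digit_exp_def
      by (auto intro!: sum_nonneg mult_nonneg_nonneg prod_nonneg digit_wt_nonneg F0)
    ultimately show "norm (cis (- (2 * pi * x * real n)) *
        (digit_exp d r {} (\<lambda>a. 1 * cis (2 * pi * x * real (digit_sum {} a))) *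
         digit_exp d r V (\<lambda>a. complex_of_real (F a) * cis (2 * pi * x * real (digit_sum V a))) * digit_char d r (H - {} - V) x))
        \<le> digit_exp d r V F * norm (digit_char d r T x)"
      by (simp add: norm_mult digit_exp_empty mult_mono digit_sum_def)
  qed (auto intro!: integrable_continuous_interval continuous_intros)
  hence "norm (complex_of_real (digit_exp d r H (\<lambda>a. of_bool (digit_sum H a = n) * F a))) \<le>
      integral {-1/2..1/2} (\<lambda>x. digit_exp d r V F * norm (digit_char d r T x))" unfolding eq .
  thus ?thesis by simp
qed

lemma digit_exp_at_eq_integral_digit_char:
  assumes "finite H"
  shows "complex_of_real (digit_exp d r H (\<lambda>a. of_bool (digit_sum H a = n))) =
    integral {-1/2..1/2} (\<lambda>x. cis (- (2 * pi * x * real n)) * digit_char d r H x)"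
proof -
  have "complex_of_real (digit_exp d r H (\<lambda>a. of_bool (digit_sum H a = n))) = digit_exp d r H (\<lambda>a. of_bool (digit_sum H a = n) * 1)"
    by (subst digit_exp_of_real[symmetric]) (intro digit_exp_cong, simp)
  also have "\<dots> = integral {-1/2..1/2} (\<lambda>x. cis (- (2 * pi * x * real n)) * digit_char d r H x)"
    unfolding digit_exp_at_eq_integral[OF assms] digit_char_def by simp
  finally show ?thesis .
qed

section \<open>Size of the characteristic function of single digits\<close>

lemma digit_wt_0_ge: assumes "d \<ge> 1" "r \<ge> 0" shows "1 / real d \<le> digit_wt d r h 0"
proof -
  have "0 < (\<Sum>j<d. exp (- r * real j * real h))"
    using assms by (intro sum_pos) (auto simp: lessThan_empty_iff)
  moreover have "(\<Sum>j<d. exp (- r * real j * real h)) \<le> (\<Sum>j<d. 1)"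
    using assms by (intro sum_mono) (auto simp: mult_nonneg_nonneg)
  ultimately show ?thesis using assms unfolding digit_wt_def by (simp add: field_simps)
qed

lemma digit_wt_eq: "digit_wt d r h k = digit_wt d r h 0 * exp (- r * real k * real h)"
  unfolding digit_wt_def by simp

lemma digit_wt_le: assumes "d \<ge> 1" shows "digit_wt d r h k \<le> exp (- r * real k * real h)"
proof -
  have "(\<Sum>j<d. exp (- r * real j * real h)) \<ge> exp (- r * real 0 * real h)"
    using assms by (intro member_le_sum) auto
  hence "(\<Sum>j<d. exp (- r * real j * real h)) \<ge> 1" by simp
  thus ?thesis unfolding digit_wt_def by (simp add: divide_le_eq mult_ge1_I)
qed

text \<open>Only the digits 0 and 1 are exploited: r h <= 1 gives them probabilities at least 1/d
  and exp (-1) / d, and their two-point sum loses p0 p1 (1 - cos theta). The other digits are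
  bounded trivially.\<close>

lemma norm_digit_char_le:
  fixes \<theta> :: real
  assumes d: "d \<ge> 2" and r: "r \<ge> 0" "r * real h \<le> 1"
  shows "norm (\<Sum>k<d. digit_wt d r h k *\<^sub>R cis (\<theta> * real k)) \<le> exp (- (exp (-1) / (real d)\<^sup>2) * (1 - cos \<theta>))"
proof -
  define p0 where "p0 = digit_wt d r h 0"
  define p1 where "p1 = digit_wt d r h 1"
  have p0: "1 / real d \<le> p0" unfolding p0_def using d r by (intro digit_wt_0_ge) auto
  have "exp (-1) \<le> exp (- r * real 1 * real h)" using r by simp
  hence "1 / real d * exp (-1) \<le> digit_wt d r h 0 * exp (- r * real 1 * real h)"
    using p0 unfolding p0_def by (intro mult_mono) (auto simp: digit_wt_nonneg)
  hence p1: "exp (-1) / real d \<le> p1" unfolding p1_def digit_wt_eq[of d r h 1] by simp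
  have split: "(\<Sum>k<d. f k) = f 0 + f 1 + (\<Sum>k=2..<d. f k)" for f :: "nat \<Rightarrow> 'b::real_normed_vector"
  proof -
    have "{..<d} = insert 0 (insert 1 {2..<d})" using d by auto
    thus ?thesis by (simp add: add.assoc)
  qed
  have rest: "(\<Sum>k=2..<d. digit_wt d r h k) = 1 - p0 - p1"
    using sum_digit_wt[of d r h] d split[of "digit_wt d r h"] unfolding p0_def p1_def by simp
  have rest0: "(\<Sum>k=2..<d. digit_wt d r h k) \<ge> 0" by (intro sum_nonneg digit_wt_nonneg)
  have pp: "0 < p0" "0 < p1" unfolding p0_def p1_def using d by (auto intro!: digit_wt_pos)
  have s1: "p0 + p1 \<le> 1" using rest rest0 by linarith
  have "norm (complex_of_real p0 + complex_of_real p1 * cis \<theta>) \<le> p0 + p1 - p0 * p1 * (1 - cos \<theta>)"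
  proof (rule power2_le_imp_le)
    have "(norm (complex_of_real p0 + complex_of_real p1 * cis \<theta>))\<^sup>2 = (p0 + p1 * cos \<theta>)\<^sup>2 + (p1 * sin \<theta>)\<^sup>2"
      by (simp add: cmod_power2)
    also have "\<dots> = (p0 + p1)\<^sup>2 - 2 * p0 * p1 * (1 - cos \<theta>)"
    proof -
      have "(p1 * cos \<theta>)\<^sup>2 + (p1 * sin \<theta>)\<^sup>2 = p1\<^sup>2"
        by (simp add: power_mult_distrib flip: distrib_left)
      thus ?thesis unfolding power2_sum by (simp add: algebra_simps)
    qed
    \<comment> \<open>Since p0 + p1 <= 1, this factor can be inserted into the subtracted term,
      which then is the cross term of a square.\<close>
    also have "\<dots> \<le> (p0 + p1)\<^sup>2 - 2 * (p0 + p1) * (p0 * p1 * (1 - cos \<theta>))"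
    proof -
      have "(p0 + p1) * (p0 * p1 * (1 - cos \<theta>)) \<le> 1 * (p0 * p1 * (1 - cos \<theta>))"
        using s1 pp by (intro mult_right_mono mult_nonneg_nonneg) auto
      thus ?thesis by (simp add: algebra_simps)
    qed
    also have "\<dots> \<le> (p0 + p1 - p0 * p1 * (1 - cos \<theta>))\<^sup>2"
      by (simp add: power2_diff)
    finally show "(norm (complex_of_real p0 + complex_of_real p1 * cis \<theta>))\<^sup>2 \<le> (p0 + p1 - p0 * p1 * (1 - cos \<theta>))\<^sup>2" .
    have "p0 * p1 * (1 - cos \<theta>) \<le> p0 * p1 * 2" using pp by (intro mult_left_mono) (auto simp: algebra_simps, smt (verit) cos_ge_minus_one)
    moreover have "p0 * p1 \<le> p0 * 1" "p0 * p1 \<le> 1 * p1" using pp s1 by (intro mult_left_mono mult_right_mono; simp)+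
    ultimately show "0 \<le> p0 + p1 - p0 * p1 * (1 - cos \<theta>)" by linarith
  qed
  hence "norm (\<Sum>k<d. digit_wt d r h k *\<^sub>R cis (\<theta> * real k)) \<le> (p0 + p1 - p0 * p1 * (1 - cos \<theta>)) + (\<Sum>k=2..<d. digit_wt d r h k)"
  proof -
    assume *: "norm (complex_of_real p0 + complex_of_real p1 * cis \<theta>) \<le> p0 + p1 - p0 * p1 * (1 - cos \<theta>)"
    have "norm (\<Sum>k=2..<d. digit_wt d r h k *\<^sub>R cis (\<theta> * real k)) \<le> (\<Sum>k=2..<d. digit_wt d r h k)"
      by (rule sum_norm_le) (simp add: digit_wt_nonneg)
    moreover have "(\<Sum>k<d. digit_wt d r h k *\<^sub>R cis (\<theta> * real k)) =
       (complex_of_real p0 + complex_of_real p1 * cis \<theta>) + (\<Sum>k=2..<d. digit_wt d r h k *\<^sub>R cis (\<theta> * real k))"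
      unfolding split p0_def p1_def by (simp add: scaleR_conv_of_real)
    ultimately show ?thesis using * by (metis (no_types, lifting) add_mono norm_triangle_le)
  qed
  also have "\<dots> = 1 + - (p0 * p1) * (1 - cos \<theta>)" using rest by simp
  also have "\<dots> \<le> 1 + - (exp (-1) / (real d)\<^sup>2) * (1 - cos \<theta>)"
  proof -
    have "1 / real d * (exp (-1) / real d) \<le> p0 * p1" using p0 p1 pp by (intro mult_mono) auto
    hence "(exp (-1) / (real d)\<^sup>2) * (1 - cos \<theta>) \<le> (p0 * p1) * (1 - cos \<theta>)"
      by (intro mult_right_mono) (auto simp: power2_eq_square)
    thus ?thesis by simp
  qed
  also have "\<dots> \<le> exp (- (exp (-1) / (real d)\<^sup>2) * (1 - cos \<theta>))" by (rule exp_ge_add_one_self)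
  finally show ?thesis .
qed

lemma norm_digit_char_le_exp:
  assumes d: "d \<ge> 2" and r: "r \<ge> 0" and A: "finite A" "B \<subseteq> A" "\<And>h. h \<in> B \<Longrightarrow> r * real h \<le> 1"
  shows "norm (digit_char d r A x) \<le> exp (- (exp (-1) / (real d)\<^sup>2) * (\<Sum>h\<in>B. 1 - cos (2 * pi * (x * real h))))"
proof -
  have finB: "finite B" using A by (auto intro: finite_subset)
  have "norm (digit_char d r A x) \<le> norm (digit_char d r B x)" using d A by (intro norm_digit_char_antimono) auto
  also have "\<dots> = (\<Prod>h\<in>B. norm (\<Sum>k<d. digit_wt d r h k *\<^sub>R cis (2 * pi * (x * real h) * real k)))"
    by (simp add: digit_char_prod[OF finB] prod_norm)
  also have "\<dots> \<le> (\<Prod>h\<in>B. exp (- (exp (-1) / (real d)\<^sup>2) * (1 - cos (2 * pi * (x * real h)))))"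
    using d r A by (intro prod_mono conjI norm_ge_zero norm_digit_char_le) auto
  also have "\<dots> = exp (- (exp (-1) / (real d)\<^sup>2) * (\<Sum>h\<in>B. 1 - cos (2 * pi * (x * real h))))"
    by (simp add: exp_sum[OF finB, symmetric] sum_distrib_left sum_negf)
  finally show ?thesis .
qed

subsection \<open>The elements of S and their colour classes\<close>

lemma mb_S_I: "(\<Prod>i<m. p i ^ \<alpha> i) \<in> mb_S m p" unfolding mb_S_def by blast

lemma mb_S_mult: assumes "g \<in> mb_S m p" "h \<in> mb_S m p" shows "g * h \<in> mb_S m p"
proof -
  obtain \<alpha> \<beta> where "g = (\<Prod>i<m. p i ^ \<alpha> i)" "h = (\<Prod>i<m. p i ^ \<beta> i)" using assms by (auto simp: mb_S_def)
  hence "g * h = (\<Prod>i<m. p i ^ (\<alpha> i + \<beta> i))" by (simp add: power_add prod.distrib)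
  thus ?thesis using mb_S_I[of p "\<lambda>i. \<alpha> i + \<beta> i" m] by simp
qed

lemma mb_S_base_power: assumes "i < m" shows "p i ^ a \<in> mb_S m p"
proof -
  have "(\<Prod>j<m. p j ^ (if j = i then a else 0)) = (\<Prod>j<m. if j = i then p j ^ a else 1)"
    by (intro prod.cong) auto
  also have "\<dots> = p i ^ a" using assms by simp
  finally show ?thesis using mb_S_I[of p "\<lambda>j. if j = i then a else 0" m] by simp
qed

lemma sum_exp_minus_abs_le:
  fixes I :: "int set"
  assumes "finite I"
  shows "(\<Sum>k\<in>I. exp (- real_of_int \<bar>k\<bar>)) \<le> 4"
proof -
  obtain N :: nat where N: "I \<subseteq> {-int N..int N}"
  proof -
    obtain N where "\<And>k. k \<in> I \<Longrightarrow> \<bar>k\<bar> \<le> N" using assms finite_nat_set_iff_bounded_le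
      by (metis finite_imageI Max_ge image_eqI)
    thus ?thesis using that[of "nat N"] by fastforce
  qed
  have geo: "(\<Sum>j\<le>N. exp (- real j)) \<le> 2"
  proof -
    have "exp (1::real) \<ge> 2" using exp_ge_add_one_self[of 1] by simp
    hence e: "exp (-1::real) \<le> 1/2" by (simp add: exp_minus field_simps)
    have "(\<Sum>j\<le>N. exp (- real j)) = (\<Sum>j\<le>N. exp (-1) ^ j)"
      by (simp add: exp_of_nat_mult[symmetric])
    also have "\<dots> \<le> (\<Sum>j\<le>N. (1/2) ^ j)" using e by (intro sum_mono power_mono) auto
    also have "\<dots> = 2 - (1/2) ^ N" by (induction N) auto
    also have "\<dots> \<le> 2" by simp
    finally show ?thesis .
  qed
  have "(\<Sum>k\<in>I. exp (- real_of_int \<bar>k\<bar>)) \<le> (\<Sum>k\<in>int ` {..N} \<union> (\<lambda>j. - int j) ` {..N}. exp (- real_of_int \<bar>k\<bar>))"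
  proof (rule sum_mono2)
    show "I \<subseteq> int ` {..N} \<union> (\<lambda>j. - int j) ` {..N}"
    proof
      fix k assume "k \<in> I"
      hence k: "-int N \<le> k" "k \<le> int N" using N by auto
      show "k \<in> int ` {..N} \<union> (\<lambda>j. - int j) ` {..N}"
      proof (cases "k \<ge> 0")
        case True
        thus ?thesis using k by (intro UnI1 image_eqI[of _ _ "nat k"]) auto
      next
        case False
        thus ?thesis using k by (intro UnI2 image_eqI[of _ _ "nat (-k)"]) auto
      qed
    qed
  qed auto
  also have "\<dots> \<le> (\<Sum>k\<in>int ` {..N}. exp (- real_of_int \<bar>k\<bar>)) + (\<Sum>k\<in>(\<lambda>j. - int j) ` {..N}. exp (- real_of_int \<bar>k\<bar>))"
    by (subst sum.union_inter[symmetric]) (auto intro!: sum_nonneg)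
  also have "\<dots> = (\<Sum>j\<le>N. exp (- real j)) + (\<Sum>j\<le>N. exp (- real j))"
    by (subst (1 2) sum.reindex) (auto simp: inj_on_def)
  finally show ?thesis using geo by linarith
qed

locale multibase =
  fixes d m :: nat and p :: "nat \<Rightarrow> nat"
  assumes d2: "d \<ge> 2" and m2: "m \<ge> 2" and p0: "1 < p 0"
    and p_mono: "\<And>i j. i < j \<Longrightarrow> j < m \<Longrightarrow> p i < p j"
    and p_cop: "\<And>i j. i < m \<Longrightarrow> j < m \<Longrightarrow> i \<noteq> j \<Longrightarrow> coprime (p i) (p j)"
begin

abbreviation S :: "nat set" where "S \<equiv> mb_S m p"
text \<open>The constant kappa of the theorem without its factor ln d: the leading coefficient in
  the count of S.\<close>

definition kap :: real where "kap = 1 / (fact m * (\<Prod>i<m. ln (real (p i))))"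
text \<open>The shift in the upper bound of \<open>mb_cnt_bounds\<close>, and hence the loss of
  logarithmic length in every window count.\<close>

definition Om :: real where "Om = (\<Sum>i<m. ln (real (p i)))"
definition Hs :: "nat \<Rightarrow> nat set" where "Hs n = {h \<in> S. h \<le> n}"
text \<open>Using the exponents of two bases ensures that no colour class has a common factor.\<close>
definition colour :: "nat \<Rightarrow> nat \<Rightarrow> nat" where
  "colour K h = (multiplicity (p 0) h + multiplicity (p 1) h) mod K"
definition cls :: "nat \<Rightarrow> nat \<Rightarrow> nat \<Rightarrow> nat set" where
  "cls K c n = {h \<in> Hs n. colour K h = c}"

lemma p_gt1: "i < m \<Longrightarrow> 1 < p i"
  using p0 p_mono[of 0 i] by (cases "i = 0") auto

lemma S_pos: "h \<in> S \<Longrightarrow> 0 < h" using mb_S_pos[of m p h] p_gt1 by (meson less_trans zero_less_one)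

lemma finite_Hs: "finite (Hs n)" unfolding Hs_def by auto
lemma finite_cls: "finite (cls K c n)" unfolding cls_def using finite_Hs by auto
lemma cls_subset: "cls K c n \<subseteq> Hs n" unfolding cls_def by auto

lemma ln_p_pos: "i < m \<Longrightarrow> 0 < ln (real (p i))" using p_gt1[of i] by simp

lemma kap_pos: "kap > 0" unfolding kap_def using ln_p_pos by (intro divide_pos_pos mult_pos_pos prod_pos) auto

lemma Om_nonneg: "Om \<ge> 0" unfolding Om_def using ln_p_pos by (intro sum_nonneg) (auto intro: less_imp_le)

lemma cnt_ge: "t \<ge> 0 \<Longrightarrow> kap * t ^ m \<le> real (mb_cnt m p t)"
  and cnt_le: "t \<ge> 0 \<Longrightarrow> real (mb_cnt m p t) \<le> kap * (t + Om) ^ m"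
proof -
  have F: "0 < fact m * (\<Prod>i<m. ln (real (p i)))" using ln_p_pos by (intro mult_pos_pos prod_pos) auto
  assume t: "t \<ge> 0"
  note b = mb_cnt_bounds[of m p t, OF p_gt1 p_cop t]
  show "kap * t ^ m \<le> real (mb_cnt m p t)"
    using b(1) F unfolding kap_def by (simp add: field_simps)
  show "real (mb_cnt m p t) \<le> kap * (t + Om) ^ m"
    using b(2) F unfolding kap_def Om_def by (simp add: field_simps)
qed

lemma window_card:
  assumes "s \<le> t"
  shows "real (card {h \<in> S. exp s < real h \<and> real h \<le> exp t}) = real (mb_cnt m p t) - real (mb_cnt m p s)"
proof -
  have "{h \<in> S. exp s < real h \<and> real h \<le> exp t} = {h \<in> S. real h \<le> exp t} - {h \<in> S. real h \<le> exp s}"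
    by auto
  moreover have "{h \<in> S. real h \<le> exp s} \<subseteq> {h \<in> S. real h \<le> exp t}"
    using assms by (auto intro: order.trans)
  ultimately show ?thesis unfolding mb_cnt_def
    using card_mono[OF finite_mb_S_le, of "{h \<in> S. real h \<le> exp s}" m p "exp t"]
    by (simp add: card_Diff_subset finite_mb_S_le of_nat_diff)
qed

lemma window_card_le:
  assumes "0 \<le> t" "s \<le> t"
  shows "real (card {h \<in> S. exp s < real h \<and> real h \<le> exp t}) \<le> kap * real m * (t + Om) ^ (m - 1) * (t + Om - s)"
proof -
  obtain k where k: "m = Suc k" using m2 by (cases m) auto
  define s' where "s' = max s 0"
  have c: "kap * s' ^ m \<le> real (mb_cnt m p s) \<or> s < 0" using cnt_ge[of s] by (auto simp: s'_def max_def)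
  show ?thesis
  \<comment> \<open>A negative s lies outside the range of \<open>cnt_ge\<close>; there the whole
    count up to t is taken, and t + Om <= t + Om - s.\<close>
  proof (cases "s < 0")
    case True
    have "real (mb_cnt m p t) - real (mb_cnt m p s) \<le> kap * (t + Om) ^ m" using cnt_le[OF assms(1)] by simp
    also have "\<dots> = kap * 1 * (t + Om) ^ (m - 1) * (t + Om)" by (simp add: k)
    also have "\<dots> \<le> kap * real m * (t + Om) ^ (m - 1) * (t + Om - s)"
      using True assms Om_nonneg kap_pos m2 by (intro mult_mono mult_nonneg_nonneg zero_le_power) auto
    finally show ?thesis using window_card[OF assms(2)] by simp
  next
    case False
    have "real (mb_cnt m p t) - real (mb_cnt m p s) \<le> kap * (t + Om) ^ m - kap * s ^ m"
      using cnt_le[OF assms(1)] cnt_ge[of s] False by simp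
    also have "\<dots> = kap * ((t + Om) ^ Suc k - s ^ Suc k)" by (simp add: k algebra_simps)
    also have "\<dots> \<le> kap * (real (Suc k) * (t + Om) ^ k * (t + Om - s))"
      using False assms Om_nonneg kap_pos by (intro mult_left_mono power_Suc_diff_le) auto
    finally show ?thesis using window_card[OF assms(2)] by (simp add: k mult_ac)
  qed
qed

lemma window_card_ge:
  assumes "0 \<le> s" "s + Om \<le> t"
  shows "kap * real m * s ^ (m - 1) * (t - s - Om) \<le> real (card {h \<in> S. exp s < real h \<and> real h \<le> exp t})"
proof -
  obtain k where k: "m = Suc k" using m2 by (cases m) auto
  have "kap * real m * s ^ (m - 1) * (t - s - Om) \<le> kap * (real (Suc k) * (s + Om) ^ k * (t - (s + Om)))"
    using assms Om_nonneg kap_pos unfolding k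
    by (simp add: mult.assoc diff_diff_eq) (intro mult_left_mono mult_right_mono power_mono; simp)
  also have "\<dots> \<le> kap * (t ^ Suc k - (s + Om) ^ Suc k)"
    using assms Om_nonneg kap_pos by (intro mult_left_mono power_Suc_diff_le) auto
  also have "\<dots> \<le> real (mb_cnt m p t) - real (mb_cnt m p s)"
    using cnt_ge[of t] cnt_le[of s] assms Om_nonneg by (simp add: k algebra_simps)
  finally show ?thesis using window_card[of s t] assms Om_nonneg by simp
qed

text \<open>In u = ln (h / Y) the summand is exp (- |u|), and every unit interval of u holds O((log
  n)^(m-1)) elements of S. A two-sided geometric series then gives a bound that is uniform in
  Y.\<close>

lemma sum_min_ratio_le:
  "\<exists>C>0. \<forall>n Y. n \<ge> 3 \<longrightarrow> Y > 0 \<longrightarrow> (\<Sum>h\<in>Hs n. min (real h / Y) (Y / real h)) \<le> C * ln (real n) ^ (m - 1)"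
proof -
  define C where "C = kap * real m * (1 + Om) ^ (m - 1) * (2 + Om) * (exp 1 * 4)"
  have C: "C > 0" using kap_pos Om_nonneg m2 unfolding C_def by (auto intro!: mult_pos_pos add_pos_nonneg)
  have "(\<Sum>h\<in>Hs n. min (real h / Y) (Y / real h)) \<le> C * ln (real n) ^ (m - 1)" if n: "n \<ge> 3" and Y: "Y > 0" for n Y
  proof -
    have "exp 1 \<le> (3::real)" by (rule exp_le)
    hence "exp 1 \<le> real n" using n by (meson numeral_le_real_of_nat_iff order.trans)
    hence L1: "ln (real n) \<ge> 1" using n by (subst ln_ge_iff) auto
    define f where "f = (\<lambda>h. \<lfloor>ln (real h / Y)\<rfloor>)"
    define B where "B = kap * real m * (ln (real n) + Om) ^ (m - 1) * (2 + Om)"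
    have B0: "B \<ge> 0" unfolding B_def using kap_pos Om_nonneg L1 by (intro mult_nonneg_nonneg zero_le_power) auto
    have val: "min (real h / Y) (Y / real h) \<le> exp 1 * exp (- real_of_int \<bar>f h\<bar>)" if "h \<in> Hs n" for h
    proof -
      have h: "real h > 0" using that S_pos by (auto simp: Hs_def)
      define u where "u = ln (real h / Y)"
      have e: "real h / Y = exp u" "Y / real h = exp (- u)" using h Y by (simp_all add: u_def exp_minus)
      have fl: "real_of_int (f h) \<le> u" "u < real_of_int (f h) + 1" by (simp_all add: f_def u_def)
      have "min (exp u) (exp (-u)) = exp (- \<bar>u\<bar>)" by (auto simp: min_def)
      also have "\<dots> \<le> exp (1 - real_of_int \<bar>f h\<bar>)" using fl by simp
      also have "\<dots> = exp 1 * exp (- real_of_int \<bar>f h\<bar>)" by (simp add: exp_diff exp_minus divide_inverse)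
      finally show ?thesis unfolding e .
    qed
    have grp: "real (card {h \<in> Hs n. f h = k}) \<le> B" for k
    proof (cases "{h \<in> Hs n. f h = k} = {}")
      case False
      define s where "s = ln Y + real_of_int k - 1"
      \<comment> \<open>Capping at ln n keeps the bound free of Y even when Y exceeds n.\<close>
      define t where "t = min (ln (real n)) (ln Y + real_of_int k + 1)"
      have lnh: "ln (real h) = ln (real h / Y) + ln Y" if "h \<in> Hs n" for h
        using Y S_pos that by (subst ln_div) (auto simp: Hs_def)
      have inc: "s < ln (real h) \<and> ln (real h) \<le> t \<and> 0 \<le> ln (real h)" if "h \<in> Hs n" "f h = k" for h
      proof -
        have h1: "real h \<ge> 1" using that(1) S_pos[of h] by (auto simp: Hs_def)
        have "real_of_int k \<le> ln (real h / Y)" "ln (real h / Y) < real_of_int k + 1"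
          using that(2) unfolding f_def by linarith+
        moreover have "ln (real h) \<le> ln (real n)" using that(1) h1 by (subst ln_le_cancel_iff) (auto simp: Hs_def)
        moreover have "0 \<le> ln (real h)" using h1 by simp
        ultimately show ?thesis using lnh[OF that(1)] unfolding s_def t_def by auto
      qed
      obtain h where h: "h \<in> Hs n" "f h = k" using False by auto
      have t0: "0 \<le> t" "s \<le> t" using inc[OF h] by auto
      have "{h \<in> Hs n. f h = k} \<subseteq> {h \<in> S. exp s < real h \<and> real h \<le> exp t}"
      proof
        fix h assume h: "h \<in> {h \<in> Hs n. f h = k}"
        hence "h > 0" using S_pos by (auto simp: Hs_def)
        hence "real h = exp (ln (real h))" by simp
        moreover have "s < ln (real h)" "ln (real h) \<le> t" using inc h by auto
        ultimately have "exp s < real h" "real h \<le> exp t" by (metis exp_less_mono) (metis \<open>real h = exp (ln (real h))\<close> \<open>ln (real h) \<le> t\<close> exp_le_cancel_iff)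
        thus "h \<in> {h \<in> S. exp s < real h \<and> real h \<le> exp t}" using h by (auto simp: Hs_def)
      qed
      moreover have "finite {h \<in> S. exp s < real h \<and> real h \<le> exp t}"
        by (rule finite_subset[OF _ finite_mb_S_le[of m p "exp t"]]) auto
      ultimately have "real (card {h \<in> Hs n. f h = k}) \<le> real (card {h \<in> S. exp s < real h \<and> real h \<le> exp t})"
        by (simp add: card_mono)
      also have "\<dots> \<le> kap * real m * (t + Om) ^ (m - 1) * (t + Om - s)" by (rule window_card_le[OF t0])
      also have "\<dots> \<le> B" unfolding B_def using t0 kap_pos Om_nonneg
        by (intro mult_mono power_mono mult_nonneg_nonneg zero_le_power) (auto simp: t_def s_def)
      finally show ?thesis .
    next
      case True
      show ?thesis unfolding True using B0 by simp
    qed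
    have "(\<Sum>h\<in>Hs n. min (real h / Y) (Y / real h)) \<le> (\<Sum>h\<in>Hs n. exp 1 * exp (- real_of_int \<bar>f h\<bar>))"
      by (intro sum_mono val)
    also have "\<dots> = (\<Sum>k\<in>f ` Hs n. \<Sum>h\<in>{h \<in> Hs n. f h = k}. exp 1 * exp (- real_of_int \<bar>f h\<bar>))"
      by (rule sum.image_gen[OF finite_Hs])
    also have "\<dots> = (\<Sum>k\<in>f ` Hs n. real (card {h \<in> Hs n. f h = k}) * (exp 1 * exp (- real_of_int \<bar>k\<bar>)))"
      by (intro sum.cong refl) simp
    also have "\<dots> \<le> (\<Sum>k\<in>f ` Hs n. B * (exp 1 * exp (- real_of_int \<bar>k\<bar>)))"
      by (intro sum_mono mult_right_mono grp) auto
    also have "\<dots> = B * (exp 1 * (\<Sum>k\<in>f ` Hs n. exp (- real_of_int \<bar>k\<bar>)))"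
      by (simp add: sum_distrib_left)
    also have "\<dots> \<le> B * (exp 1 * 4)" using finite_Hs B0
      by (intro mult_left_mono sum_exp_minus_abs_le) auto
    also have "B \<le> kap * real m * ((1 + Om) * ln (real n)) ^ (m - 1) * (2 + Om)"
      unfolding B_def
    proof (intro mult_right_mono mult_left_mono power_mono)
      have "Om * 1 \<le> Om * ln (real n)" using L1 Om_nonneg by (intro mult_left_mono) auto
      thus "ln (real n) + Om \<le> (1 + Om) * ln (real n)" by (simp add: algebra_simps)
    qed (use kap_pos Om_nonneg L1 in auto)
    hence "B * (exp 1 * 4) \<le> kap * real m * ((1 + Om) * ln (real n)) ^ (m - 1) * (2 + Om) * (exp 1 * 4)"
      by (intro mult_right_mono) auto
    also have "\<dots> = C * ln (real n) ^ (m - 1)" by (simp add: C_def power_mult_distrib mult_ac)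
    finally show ?thesis .
  qed
  thus ?thesis using C by blast
qed

section \<open>Colour classes: their density and the minor arcs\<close>

lemma cop01: "coprime (p 0) (p 1)" using p_cop[of 0 1] m2 by auto
lemma p1: "1 < p 1" using p_gt1[of 1] m2 by auto

lemma multiplicity_base:
  assumes "g > 0" "coprime q r" "1 < (q::nat)"
  shows "multiplicity q (g * q ^ j) = multiplicity q g + j" "multiplicity q (g * r ^ j) = multiplicity q g"
proof -
  show "multiplicity q (g * q ^ j) = multiplicity q g + j"
  proof (induction j)
    case (Suc j)
    have "multiplicity q (q * (g * q ^ j)) = Suc (multiplicity q (g * q ^ j))"
      using assms by (intro multiplicity_times_same) auto
    thus ?case using Suc by (simp add: mult_ac)
  qed simp
  show "multiplicity q (g * r ^ j) = multiplicity q g"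
    using assms(2) by (intro multiplicity_cong) (simp add: coprime_dvd_mult_left_iff)
qed

lemma colour_mult_p0: "g > 0 \<Longrightarrow> colour K (g * p 0 ^ j) = (colour K g + j) mod K"
  unfolding colour_def
  using multiplicity_base(1)[of g "p 0" "p 1" j] multiplicity_base(2)[of g "p 1" "p 0" j] cop01 p0 p1
  by (simp add: coprime_commute mod_simps add_ac)

lemma multiplicity_base_powers:
  "multiplicity (p 0) (p 0 ^ a * p 1 ^ b) = a" "multiplicity (p 1) (p 0 ^ a * p 1 ^ b) = b"
  using multiplicity_base(1)[of 1 "p 0" "p 1" a] multiplicity_base(2)[of "p 0 ^ a" "p 0" "p 1" b]
    multiplicity_base(1)[of "p 0 ^ a" "p 1" "p 0" b] multiplicity_base(2)[of 1 "p 1" "p 0" a] cop01 p0 p1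
  by (auto simp: coprime_commute)

lemma colour_base_powers: "colour K (p 0 ^ a * p 1 ^ b) = (a + b) mod K"
  unfolding colour_def by (simp only: multiplicity_base_powers)

lemma base_powers_in_S: "p 0 ^ a * p 1 ^ b \<in> S"
  using m2 by (intro mb_S_mult mb_S_base_power) auto

text \<open>An element of any colour reaches colour c after multiplication by p_0^j with some j < K,
  and the pair of product and j determines it. A class therefore has at least 1/K of the elements of
  a window shortened by K ln p_0.\<close>

lemma class_window_card_ge:
  assumes K: "K \<ge> 1" and c: "c < K"
  shows "real (card {h \<in> S. exp s < real h \<and> real h \<le> exp (t - real K * ln (real (p 0)))})
    \<le> real K * real (card {h \<in> S. colour K h = c \<and> exp s < real h \<and> real h \<le> exp t})" (is "real (card ?A) \<le> real K * real (card ?B)")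
proof -
  \<comment> \<open>The exponent that moves the colour of g to c; adding K first keeps the
    subtraction of natural numbers exact.\<close>
  define j where "j = (\<lambda>g. (c + K - colour K g) mod K)"
  have jK: "j g < K" for g using K by (simp add: j_def)
  have finB: "finite ?B" by (rule finite_subset[OF _ finite_mb_S_le[of m p "exp t"]]) auto
  have "card ?A \<le> card (?B \<times> {..<K})"
  proof (rule card_inj_on_le)
    show "inj_on (\<lambda>g. (g * p 0 ^ j g, j g)) ?A" using p0 by (auto simp: inj_on_def)
    show "(\<lambda>g. (g * p 0 ^ j g, j g)) ` ?A \<subseteq> ?B \<times> {..<K}"
    proof safe
      fix g assume g: "g \<in> S" "exp s < real g" "real g \<le> exp (t - real K * ln (real (p 0)))"
      have gp: "g > 0" by (rule S_pos[OF g(1)])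
      show "j g < K" by (rule jK)
      show "g * p 0 ^ j g \<in> S" using g m2 by (intro mb_S_mult mb_S_base_power) auto
      have "colour K g < K" using K by (simp add: colour_def)
      hence "(colour K g + (c + K - colour K g) mod K) mod K = (colour K g + (c + K - colour K g)) mod K"
        by (simp add: mod_simps)
      also have "\<dots> = c" using \<open>colour K g < K\<close> c by simp
      finally show "colour K (g * p 0 ^ j g) = c" using colour_mult_p0[OF gp] by (simp add: j_def)
      have "1 \<le> p 0 ^ j g" using p0 by simp
      hence "real g * 1 \<le> real g * real (p 0 ^ j g)" by (intro mult_left_mono) (auto simp del: of_nat_power)
      thus "exp s < real (g * p 0 ^ j g)" using g by simp
      have "real (g * p 0 ^ j g) \<le> exp (t - real K * ln (real (p 0))) * real (p 0) ^ K"
        using g jK[of g] p0 by (simp, intro mult_mono power_increasing) auto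
      also have "real (p 0) ^ K = exp (real K * ln (real (p 0)))" using p0 by (simp add: exp_of_nat_mult)
      finally show "real (g * p 0 ^ j g) \<le> exp t" by (simp flip: exp_add)
    qed
  qed (use finB in auto)
  hence "card ?A \<le> K * card ?B" by (simp add: card_cartesian_product mult.commute)
  hence "real (card ?A) \<le> real (K * card ?B)" by (rule of_nat_mono)
  thus ?thesis by simp
qed

text \<open>All numbers p_i^c P^a Q^b with P = p_i^K and Q = p_j^K have colour c, so the lattice
  argument for the coprime pair P, Q runs inside one class, with x p_i^c in the role of y.\<close>

lemma class_cos_sum_ge:
  fixes K i j :: nat
  assumes K: "K \<ge> 1" and c: "c < K" and Y: "Y \<le> real n"
    and ij: "(i = 0 \<and> j = 1) \<or> (i = 1 \<and> j = 0)"
    and Z: "real (p i ^ c) \<le> Y" and x: "dist_int (x * real (p i ^ c)) \<ge> real (p i ^ c) / Y"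
  shows "4 / (real (p 0 ^ K) + real (p 1 ^ K))\<^sup>2 / ln (real (p 0 ^ K) * real (p 1 ^ K)) * ln (Y / real (p i ^ c))
     \<le> (\<Sum>h\<in>{h \<in> cls K c n. real h \<le> Y}. 1 - cos (2 * pi * (x * real h)))"
proof -
  define P where "P = p i ^ K"
  define Q where "Q = p j ^ K"
  define g where "g = p i ^ c"
  define Z where "Z = Y / real g"
  have pij: "1 < p i" "1 < p j" "coprime (p i) (p j)" using ij p0 p1 cop01 by (auto simp: coprime_commute)
  have g: "g > 0" using pij by (simp add: g_def)
  have PQ: "P \<ge> 2" "Q \<ge> 2" "coprime P Q" unfolding P_def Q_def
    using self_le_power[of "p i" K] self_le_power[of "p j" K] K pij by auto
  have sym: "4 / (real (p 0 ^ K) + real (p 1 ^ K))\<^sup>2 / ln (real (p 0 ^ K) * real (p 1 ^ K)) =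
     4 / (real P + real Q)\<^sup>2 / ln (real P * real Q)" using ij unfolding P_def Q_def by (auto simp: add_ac mult_ac)
  define F where "F = (\<lambda>(a,b). g * (P ^ a * Q ^ b))"
  define I where "I = {(a,b). real P ^ a * real Q ^ b \<le> Z}"
  have Feq: "F (a,b) = (if i = 0 then p 0 ^ (c + K * a) * p 1 ^ (K * b) else p 0 ^ (K * b) * p 1 ^ (c + K * a))" for a b
    using ij unfolding F_def g_def P_def Q_def by (auto simp: power_add power_mult mult_ac)
  have inj: "inj_on F I"
  proof (rule inj_onI, safe)
    fix a b a' b' assume eq: "F (a,b) = F (a',b')"
    have "multiplicity (p 0) (F (a,b)) = (if i = 0 then c + K * a else K * b)"
      "multiplicity (p 1) (F (a,b)) = (if i = 0 then K * b else c + K * a)" for a b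
      unfolding Feq by (simp_all add: multiplicity_base_powers del: One_nat_def)
    with eq have "(if i = 0 then c + K * a else K * b) = (if i = 0 then c + K * a' else K * b')"
      "(if i = 0 then K * b else c + K * a) = (if i = 0 then K * b' else c + K * a')" by metis+
    thus "a = a'" "b = b'" using K by (auto split: if_splits)
  qed
  have sub: "F ` I \<subseteq> {h \<in> cls K c n. real h \<le> Y}"
  proof safe
    fix a b assume ab: "(a,b) \<in> I"
    have "real (F (a,b)) = real g * (real P ^ a * real Q ^ b)" by (simp add: F_def)
    also have "\<dots> \<le> real g * Z" using ab g by (intro mult_left_mono) (auto simp: I_def)
    also have "\<dots> = Y" using g by (simp add: Z_def)
    finally show *: "real (F (a,b)) \<le> Y" .
    hence "F (a,b) \<le> n" using Y by linarith
    moreover have "F (a,b) \<in> S" unfolding Feq by (simp add: base_powers_in_S del: One_nat_def)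
    moreover have "colour K (F (a,b)) = (c + K * (a + b)) mod K"
      unfolding Feq by (simp add: colour_base_powers distrib_left add_ac del: One_nat_def mod_mult_self1 mod_mult_self2 mod_mult_self3 mod_mult_self4)
    hence "colour K (F (a,b)) = c" using c by simp
    ultimately show "F (a,b) \<in> cls K c n" by (simp add: cls_def Hs_def)
  qed
  have "4 / (real P + real Q)\<^sup>2 / ln (real P * real Q) * ln Z
     \<le> (\<Sum>(a,b)\<in>I. 1 - cos (2 * pi * ((x * real g) * (real P ^ a * real Q ^ b))))"
    unfolding I_def
  proof (rule sum_cos_bad_pairs_ge[OF PQ])
    show "1 \<le> Z" using assms(5) g unfolding Z_def g_def[symmetric] by (simp add: field_simps)
    show "1 / Z \<le> dist_int (x * real g)" using x unfolding Z_def g_def[symmetric] by simp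
  qed
  also have "\<dots> = (\<Sum>y\<in>I. 1 - cos (2 * pi * (x * real (F y))))"
    by (intro sum.cong refl) (auto simp: F_def mult_ac)
  also have "\<dots> = (\<Sum>h\<in>F ` I. 1 - cos (2 * pi * (x * real h)))" by (simp add: sum.reindex[OF inj])
  also have "\<dots> \<le> (\<Sum>h\<in>{h \<in> cls K c n. real h \<le> Y}. 1 - cos (2 * pi * (x * real h)))"
    by (rule sum_mono2[OF _ sub]) (use finite_cls in auto)
  finally show ?thesis unfolding sym Z_def g_def .
qed

text \<open>The lattice of a class starts at p_i^c rather than at 1, and x p_i^c may be close to an
  integer although x is not. As p_0^c and p_1^c are coprime, this cannot happen for both starting
  points, and a good one is selected.\<close>

lemma class_minor_arc:
  fixes K :: nat
  assumes K: "K \<ge> 1" and c: "c < K" and Y: "Y \<le> real n"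
    and Y2: "2 * (real (p 0) ^ K * real (p 1) ^ K)\<^sup>2 \<le> Y" and x: "1 / Y \<le> \<bar>x\<bar>" "\<bar>x\<bar> \<le> 1/2"
  shows "2 / (real (p 0 ^ K) + real (p 1 ^ K))\<^sup>2 / ln (real (p 0 ^ K) * real (p 1 ^ K)) * ln Y
     \<le> (\<Sum>h\<in>{h \<in> cls K c n. real h \<le> Y}. 1 - cos (2 * pi * (x * real h)))"
proof -
  define G where "G = real (p 0) ^ K * real (p 1) ^ K"
  have pK: "1 \<le> real (p 0) ^ K" "1 \<le> real (p 1) ^ K" using p0 p1 by (auto intro!: one_le_power)
  have pK2: "2 \<le> real (p 0) ^ K"
  proof -
    have "2 \<le> real (p 0) ^ 1" using p0 by simp
    also have "\<dots> \<le> real (p 0) ^ K" using K p0 by (intro power_increasing) auto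
    finally show ?thesis .
  qed
  have "2 * 1 \<le> G" unfolding G_def using pK pK2 by (intro mult_mono) auto
  hence G2: "2 \<le> G" by simp
  have YG: "2 * G\<^sup>2 \<le> Y" using Y2 by (simp add: G_def)
  have Y0: "Y > 0" using YG G2 by (smt (verit) zero_less_power)
  have gG: "real (p i ^ c) \<le> G" "0 < real (p i ^ c)" if "i = 0 \<or> i = 1" for i
  proof -
    have "real (p 0) ^ c \<le> real (p 0) ^ K" "real (p 1) ^ c \<le> real (p 1) ^ K"
      using c p0 p1 by (auto intro!: power_increasing)
    hence "real (p 0) ^ c * 1 \<le> real (p 0) ^ K * real (p 1) ^ K" "1 * real (p 1) ^ c \<le> real (p 0) ^ K * real (p 1) ^ K"
      using pK by (intro mult_mono; simp)+
    thus "real (p i ^ c) \<le> G" using that by (auto simp: G_def)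
    show "0 < real (p i ^ c)" using that p0 p1 by auto
  qed
  have GY: "G \<le> Y" using YG G2 by (smt (verit) mult_le_cancel_right1 power2_eq_square)
  define B where "B = 4 / (real (p 0 ^ K) + real (p 1 ^ K))\<^sup>2 / ln (real (p 0 ^ K) * real (p 1 ^ K))"
  have "0 < ln (real (p 0 ^ K) * real (p 1 ^ K))" using G2 by (intro ln_gt_zero) (simp add: G_def)
  hence B0: "B \<ge> 0" by (simp add: B_def)
  \<comment> \<open>Y >= 2 G^2 ensures that dividing by the starting point costs at most half of ln
    Y; hence the factor 2 in the statement where \<open>class_cos_sum_ge\<close> has 4.\<close>
  have lnG: "ln Y / 2 \<le> ln (Y / real (p i ^ c))" if "i = 0 \<or> i = 1" for i
  proof -
    have "2 * ln G = ln (G\<^sup>2)" using G2 by (simp add: ln_realpow)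
    also have "\<dots> \<le> ln Y" using YG G2 Y0 zero_less_power[of G 2]
      by (subst ln_le_cancel_iff) linarith+
    finally have "ln G \<le> ln Y / 2" by simp
    moreover have "ln (real (p i ^ c)) \<le> ln G" using gG[OF that] G2 by (subst ln_le_cancel_iff) auto
    moreover have "ln (Y / real (p i ^ c)) = ln Y - ln (real (p i ^ c))" using gG[OF that] Y0 by (subst ln_div) (auto simp del: of_nat_power)
    ultimately show ?thesis by linarith
  qed
  have "\<exists>i. (i = 0 \<or> i = 1) \<and> dist_int (x * real (p i ^ c)) \<ge> real (p i ^ c) / Y"
  proof (rule ccontr)
    assume "\<not> ?thesis"
    hence lt: "dist_int (x * real (p 0 ^ c)) < real (p 0 ^ c) / Y" "dist_int (x * real (p 1 ^ c)) < real (p 1 ^ c) / Y"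
      by (auto simp: not_le)
    have "dist_int (x * real (p 0 ^ c)) * real (p 1 ^ c) + dist_int (x * real (p 1 ^ c)) * real (p 0 ^ c)
      < real (p 0 ^ c) / Y * real (p 1 ^ c) + real (p 1 ^ c) / Y * real (p 0 ^ c)"
      using lt gG by (intro add_strict_mono mult_strict_right_mono) auto
    also have "\<dots> = 2 * (real (p 0 ^ c) * real (p 1 ^ c)) / Y" by (simp add: field_simps)
    also have "\<dots> \<le> 2 * (G * G) / Y" using gG Y0 G2 by (intro divide_right_mono mult_left_mono mult_mono) auto
    also have "\<dots> \<le> 1" using YG Y0 by (simp add: power2_eq_square)
    finally obtain j where j: "round (x * real (p 0 ^ c)) = int (p 0 ^ c) * j"
      using coprime_approx_int[of "p 0 ^ c" "p 1 ^ c" x] cop01 by auto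
    have "dist_int (x * real (p 0 ^ c)) = \<bar>(x - of_int j) * real (p 0 ^ c)\<bar>"
      unfolding dist_int_def j by (simp add: algebra_simps)
    also have "\<dots> = \<bar>x - of_int j\<bar> * real (p 0 ^ c)" by (simp add: abs_mult)
    finally have "\<bar>x - of_int j\<bar> * real (p 0 ^ c) < real (p 0 ^ c) / Y" using lt by simp
    hence "\<bar>x - of_int j\<bar> < 1 / Y" using gG[of 0] Y0 by (simp add: field_simps)
    hence "dist_int x < 1 / Y" using dist_int_le[of x j] by linarith
    thus False using dist_int_eq_abs[OF x(2)] x(1) by simp
  qed
  then obtain i where i: "i = 0 \<or> i = 1" "dist_int (x * real (p i ^ c)) \<ge> real (p i ^ c) / Y" by blast
  have "2 / (real (p 0 ^ K) + real (p 1 ^ K))\<^sup>2 / ln (real (p 0 ^ K) * real (p 1 ^ K)) * ln Y = B * (ln Y / 2)"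
    by (simp add: B_def)
  also have "\<dots> \<le> B * ln (Y / real (p i ^ c))" using B0 lnG[OF i(1)] by (intro mult_left_mono)
  also have "\<dots> \<le> (\<Sum>h\<in>{h \<in> cls K c n. real h \<le> Y}. 1 - cos (2 * pi * (x * real h)))"
    unfolding B_def using gG[OF i(1)] GY i
    by (intro class_cos_sum_ge[where j = "1 - i"] K c Y) auto
  finally show ?thesis .
qed

end

lemma eventually_ln_power_le_powr:
  fixes C e :: real
  assumes "e > 0"
  shows "\<forall>\<^sub>F n in sequentially. C * ln (real n) ^ k \<le> real n powr e"
proof (cases "C \<le> 0")
  case True
  have "C * ln (real n) ^ k \<le> real n powr e" if "n \<ge> 1" for n
  proof -
    have "0 \<le> ln (real n) ^ k" using that by (intro zero_le_power ln_ge_zero) auto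
    hence "C * ln (real n) ^ k \<le> 0" by (rule mult_nonpos_nonneg[OF True])
    also have "0 \<le> real n powr e" by simp
    finally show ?thesis .
  qed
  thus ?thesis by (rule eventually_sequentiallyI)
next
  case False
  have "((\<lambda>n. ln (real n) ^ k / real n powr e) \<longlongrightarrow> 0) sequentially" using assms by real_asymp
  hence "\<forall>\<^sub>F n in sequentially. ln (real n) ^ k / real n powr e < 1 / C"
    by (rule order_tendstoD) (use False in auto)
  thus ?thesis using eventually_gt_at_top[of "0::nat"]
  proof eventually_elim
    case (elim n)
    thus ?case using False by (simp add: field_simps)
  qed
qed

lemma eventually_ln_ge: "\<forall>\<^sub>F n in sequentially. c \<le> ln (real n)"
  by real_asymp

text \<open>Turns Gaussian decay into a rational one whose integrals are elementary; the second
  power leaves room for an additional factor |x|.\<close>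

lemma exp_minus_le_inverse_square:
  fixes a z :: real
  assumes "a > 0" "z \<ge> 0"
  shows "exp (- a * z) \<le> (2 + 4 / a\<^sup>2) / (1 + z)\<^sup>2"
proof -
  have "1 + a * z + (a * z)\<^sup>2 / 2 \<le> exp (a * z)" using assms by (intro exp_lower_Taylor_quadratic) auto
  hence e: "1 + (a * z)\<^sup>2 / 2 \<le> exp (a * z)" using assms by (smt (verit) mult_nonneg_nonneg)
  have "(1 + z)\<^sup>2 \<le> 2 + 2 * z\<^sup>2" using sum_squares_ge_zero[of "1 - z" 0] by (simp add: power2_eq_square algebra_simps)
  also have "\<dots> \<le> (2 + 4 / a\<^sup>2) * (1 + (a * z)\<^sup>2 / 2)"
    using assms by (simp add: power_mult_distrib field_simps)
  also have "\<dots> \<le> (2 + 4 / a\<^sup>2) * exp (a * z)" using e by (intro mult_left_mono) auto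
  finally have "(1 + z)\<^sup>2 * exp (- a * z) \<le> (2 + 4 / a\<^sup>2) * exp (a * z) * exp (- a * z)"
    by (intro mult_right_mono) auto
  also have "\<dots> = 2 + 4 / a\<^sup>2" by (simp add: mult.assoc flip: exp_add)
  finally show ?thesis using assms by (simp add: field_simps)
qed

lemma integral_symmetric_le:
  fixes G :: "real \<Rightarrow> real"
  assumes G: "continuous_on UNIV G" and ev: "\<And>x. G (- x) = G x" and G0: "\<And>x. 0 \<le> G x"
  shows "integral {-1/2..1/2} G \<le> 2 * integral {0..1} G"
proof -
  have int: "G integrable_on {a..b}" for a b
    by (rule integrable_continuous_interval) (rule continuous_on_subset[OF G], auto)
  have "integral {-1/2..1/2} G \<le> integral {-1..1} G"
    by (intro integral_subset_le int) (auto intro: G0)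
  also have "\<dots> = integral {-1..0} G + integral {0..1} G"
    by (intro Henstock_Kurzweil_Integration.integral_combine[symmetric] int) auto
  also have "integral {-1..0} G = integral {0..1} G"
    using Henstock_Kurzweil_Integration.integral_reflect_real[of 1 0 G] ev by simp
  finally show ?thesis by simp
qed

section \<open>Major arc and mean value bounds for a colour class\<close>

context multibase
begin

text \<open>For |x| <= 1/Y and h <= Y/2 the distance of x h to the integers is |x h| itself. A
  window of bounded logarithmic length just below Y/2 holds order (ln Y)^(m-1) elements of the
  class, and each contributes order (x Y)^2.\<close>

lemma class_major_arc:
  assumes K: "K \<ge> 1"
  shows "\<exists>a>0. \<exists>t0. \<forall>n Y c x. c < K \<longrightarrow> Y > 0 \<longrightarrow> Y \<le> real n \<longrightarrow> t0 \<le> ln Y \<longrightarrow> \<bar>x\<bar> \<le> 1 / Y \<longrightarrow>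
     a * ((x * Y)\<^sup>2 * ln Y ^ (m - 1)) \<le> (\<Sum>h\<in>{h \<in> cls K c n. real h \<le> Y}. 1 - cos (2 * pi * (x * real h)))"
proof -
  \<comment> \<open>The window length: K ln p_0 is lost by passing to one colour and
    \<open>Om\<close> by counting, which leaves length 1.\<close>
  define l where "l = real K * ln (real (p 0)) + Om + 1"
  define a where "a = exp (- 2 * l) * (kap * real m / real K / 2 ^ (m - 1))"
  have l: "l \<ge> 1" using Om_nonneg p0 by (simp add: l_def)
  have a: "a > 0" unfolding a_def using kap_pos m2 K by (intro mult_pos_pos divide_pos_pos) auto
  have main: "a * ((x * Y)\<^sup>2 * ln Y ^ (m - 1)) \<le> (\<Sum>h\<in>{h \<in> cls K c n. real h \<le> Y}. 1 - cos (2 * pi * (x * real h)))"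
    if c: "c < K" and Y: "Y > 0" "Y \<le> real n" "2 * (ln 2 + l) \<le> ln Y" and x: "\<bar>x\<bar> \<le> 1 / Y" for n Y c x
  proof -
    define s where "s = ln Y - ln 2 - l"
    define t where "t = ln Y - ln 2"
    have s: "s \<ge> ln Y / 2" "s \<ge> 0" using Y(3) l unfolding s_def by (simp_all add: field_simps) (smt (verit) ln_ge_zero)
    have "0 \<le> ln (2::real)" by simp
    hence "0 \<le> 2 * (ln 2 + l)" using l by (intro mult_nonneg_nonneg add_nonneg_nonneg) auto
    hence lnY0: "0 \<le> ln Y" using Y(3) by (rule order.trans)
    have et: "exp t = Y / 2" using Y by (simp add: t_def exp_diff)
    have es: "exp s = Y / 2 * exp (- l)" 
    proof -
      have "exp s = exp t * exp (- l)" unfolding s_def t_def by (simp flip: exp_add)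
      thus ?thesis by (simp add: et)
    qed
    let ?B = "{h \<in> S. colour K h = c \<and> exp s < real h \<and> real h \<le> exp t}"
    have finB: "finite ?B" by (rule finite_subset[OF _ finite_mb_S_le[of m p "exp t"]]) auto
    have "kap * real m * s ^ (m - 1) * ((t - real K * ln (real (p 0))) - s - Om) \<le>
       real (card {h \<in> S. exp s < real h \<and> real h \<le> exp (t - real K * ln (real (p 0)))})"
      by (rule window_card_ge) (use s in \<open>auto simp: s_def t_def l_def\<close>)
    also have "\<dots> \<le> real K * real (card ?B)" by (rule class_window_card_ge[OF K c])
    also have "(t - real K * ln (real (p 0))) - s - Om = 1" by (simp add: s_def t_def l_def)
    finally have "kap * real m / real K * s ^ (m - 1) \<le> real (card ?B)" using K by (simp add: field_simps)
    moreover have "kap * real m / real K * (ln Y / 2) ^ (m - 1) \<le> kap * real m / real K * s ^ (m - 1)"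
      using s kap_pos lnY0 by (intro mult_left_mono power_mono) auto
    ultimately have card: "kap * real m / real K / 2 ^ (m - 1) * ln Y ^ (m - 1) \<le> real (card ?B)"
      by (simp add: power_divide)
    have each: "(x * Y)\<^sup>2 * exp (- 2 * l) \<le> 1 - cos (2 * pi * (x * real h))" if h: "h \<in> ?B" for h
    proof -
      have "\<bar>x * real h\<bar> \<le> 1 / Y * (Y / 2)" using h x et unfolding abs_mult by (intro mult_mono) auto
      hence "dist_int (x * real h) = \<bar>x * real h\<bar>" using Y by (intro dist_int_eq_abs) auto
      hence "4 * (x * real h)\<^sup>2 \<le> 1 - cos (2 * pi * (x * real h))" using dist_int_sq_le_cos[of "x * real h"] by simp
      moreover have "(exp s)\<^sup>2 \<le> (real h)\<^sup>2" using h by (intro power_mono) auto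
      hence "4 * x\<^sup>2 * (exp s)\<^sup>2 \<le> 4 * x\<^sup>2 * (real h)\<^sup>2" by (intro mult_left_mono) auto
      moreover have "4 * x\<^sup>2 * (exp s)\<^sup>2 = (x * Y)\<^sup>2 * exp (- 2 * l)"
        unfolding es by (simp add: power_mult_distrib power_divide exp_double[symmetric])
      ultimately show ?thesis by (simp add: power_mult_distrib)
    qed
    have sub: "?B \<subseteq> {h \<in> cls K c n. real h \<le> Y}"
      using et Y by (auto simp: cls_def Hs_def)
    have "a * ((x * Y)\<^sup>2 * ln Y ^ (m - 1)) =
       (kap * real m / real K / 2 ^ (m - 1) * ln Y ^ (m - 1)) * ((x * Y)\<^sup>2 * exp (- 2 * l))"
      by (simp add: a_def mult_ac)
    also have "\<dots> \<le> real (card ?B) * ((x * Y)\<^sup>2 * exp (- 2 * l))"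
      using card by (intro mult_right_mono) auto
    also have "\<dots> = (\<Sum>h\<in>?B. (x * Y)\<^sup>2 * exp (- 2 * l))" by simp
    also have "\<dots> \<le> (\<Sum>h\<in>?B. 1 - cos (2 * pi * (x * real h)))" by (intro sum_mono each)
    also have "\<dots> \<le> (\<Sum>h\<in>{h \<in> cls K c n. real h \<le> Y}. 1 - cos (2 * pi * (x * real h)))"
      by (rule sum_mono2[OF _ sub]) (use finite_cls in auto)
    finally show ?thesis .
  qed
  show ?thesis
    by (rule exI[of _ a], rule conjI[OF a], rule exI[of _ "2 * (ln 2 + l)"]) (use main in blast)
qed

lemma class_lines_le:
  assumes c: "c < K" and Y: "Y \<le> real n"
    and le: "\<And>a b. a < A \<Longrightarrow> b < J \<Longrightarrow> real (p 0 ^ c * (p 1 ^ K) ^ b * (p 0 ^ K) ^ a) \<le> Y"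
  shows "(\<Sum>b<J. \<Sum>a<A. 1 - cos (2 * pi * (real ((p 0 ^ K) ^ a) * (real (p 0 ^ c * (p 1 ^ K) ^ b) * x))))
    \<le> (\<Sum>h\<in>{h \<in> cls K c n. real h \<le> Y}. 1 - cos (2 * pi * (x * real h)))"
proof -
  define F where "F = (\<lambda>(b,a). p 0 ^ (c + K * a) * p 1 ^ (K * b))"
  let ?I = "{..<J} \<times> {..<A}"
  have K: "K \<ge> 1" using c by simp
  have Feq: "F (b,a) = p 0 ^ c * (p 1 ^ K) ^ b * (p 0 ^ K) ^ a" for a b
    by (simp add: F_def power_add mult_ac flip: power_mult)
  have inj: "inj_on F ?I"
  proof (rule inj_onI, safe)
    fix a b a' b' assume eq: "F (b,a) = F (b',a')"
    have "multiplicity (p 0) (F (b,a)) = c + K * a" "multiplicity (p 1) (F (b,a)) = K * b" for a b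
      by (simp_all add: F_def multiplicity_base_powers del: One_nat_def)
    with eq have "c + K * a = c + K * a'" "K * b = K * b'" by metis+
    thus "a = a'" "b = b'" using K by auto
  qed
  have sub: "F ` ?I \<subseteq> {h \<in> cls K c n. real h \<le> Y}"
  proof safe
    fix a b assume "b < J" "a < A"
    from le[OF this(2,1)] show *: "real (F (b,a)) \<le> Y" unfolding Feq .
    hence "F (b,a) \<le> n" using Y by linarith
    moreover have "colour K (F (b,a)) = (c + K * (a + b)) mod K"
      unfolding F_def prod.case colour_base_powers by (simp only: distrib_left add_ac)
    hence "colour K (F (b,a)) = c" using c by simp
    ultimately show "F (b,a) \<in> cls K c n" by (simp add: cls_def Hs_def) (simp add: F_def base_powers_in_S del: One_nat_def)
  qed
  have "(\<Sum>b<J. \<Sum>a<A. 1 - cos (2 * pi * (real ((p 0 ^ K) ^ a) * (real (p 0 ^ c * (p 1 ^ K) ^ b) * x))))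
     = (\<Sum>y\<in>?I. 1 - cos (2 * pi * (x * real (F y))))"
    unfolding sum.cartesian_product by (intro sum.cong refl) (auto simp: Feq mult_ac)
  also have "\<dots> = (\<Sum>h\<in>F ` ?I. 1 - cos (2 * pi * (x * real h)))" by (simp add: sum.reindex[OF inj])
  also have "\<dots> \<le> (\<Sum>h\<in>{h \<in> cls K c n. real h \<le> Y}. 1 - cos (2 * pi * (x * real h)))"
    by (rule sum_mono2[OF _ sub]) (use finite_cls in auto)
  finally show ?thesis .
qed

text \<open>For fixed large J each step along a line gains at least a factor P / (1 + e ln P), and
  about ln Y / ln P steps fit below Y, so the integral is O(Y^(e - 1)). The majorant
  \<open>\<Psi>\<close> comes from these J lines alone.\<close>

lemma class_lines_integral:
  assumes K: "K \<ge> 1" and c0: "c0 > 0" and e: "e > 0"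
  shows "\<exists>C>0. \<forall>n Y c. c < K \<longrightarrow> Y \<le> real n \<longrightarrow> C \<le> Y \<longrightarrow>
     (\<exists>\<Psi>. continuous_on UNIV \<Psi> \<and> (\<forall>x. 0 \<le> \<Psi> x) \<and> integral {-1/2..1/2} \<Psi> \<le> C * Y powr (e - 1) \<and>
      (\<forall>x. exp (- c0 * (\<Sum>h\<in>{h \<in> cls K c n. real h \<le> Y}. 1 - cos (2 * pi * (x * real h)))) \<le> \<Psi> x))"
proof -
  define P where "P = p 0 ^ K"
  define Q where "Q = p 1 ^ K"
  have P2: "2 \<le> P" "1 \<le> Q" unfolding P_def Q_def
    using self_le_power[of "p 0" K] self_le_power[of "p 1" K] p0 p1 K by auto
  have lnP: "ln (real P) > 0" using P2 by simp
  have "((\<lambda>J. real P * exp (- (c0 * real J) / (real P)\<^sup>2)) \<longlongrightarrow> 0) sequentially"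
    using c0 P2 by real_asymp
  hence "\<forall>\<^sub>F J in sequentially. real P * exp (- (c0 * real J) / (real P)\<^sup>2) < e * ln (real P)"
    by (rule order_tendstoD) (use e lnP in auto)
  then obtain J where J: "J \<ge> 1" "real P * exp (- (c0 * real J) / (real P)\<^sup>2) < e * ln (real P)"
    using eventually_happens'[OF sequentially_bot eventually_conj[OF _ eventually_ge_at_top[of 1]]] by blast
  \<comment> \<open>The first entry makes the starting points g Q^J fit below Y, the second is the
    constant in the integral bound; g <= P makes both independent of the colour.\<close>
  define C where "C = max (real (P * Q ^ J)) (2 * real J * real (P * Q ^ J * P))"
  have C: "C > 0" unfolding C_def using P2 by (intro less_max_iff_disj[THEN iffD2] disjI1) auto
  show ?thesis
  proof (intro exI[of _ C] conjI C allI impI)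
    fix n Y c assume c: "c < K" and Y: "Y \<le> real n" "C \<le> Y"
    define g where "g = p 0 ^ c"
    have g: "1 \<le> g" "g \<le> P" unfolding g_def P_def using p0 c by (auto intro!: power_increasing)
    \<comment> \<open>The largest A with g Q^J P^A <= Y; by maximality P^A is at least a constant
      times Y.\<close>
    define A where "A = nat \<lfloor>ln (Y / real (g * Q ^ J)) / ln (real P)\<rfloor>"
    have gQ: "0 < real (g * Q ^ J)" using g P2 by simp
    have gQY: "real (g * Q ^ J) \<le> Y"
    proof -
      have "real (g * Q ^ J) \<le> real (P * Q ^ J)" using g by (intro of_nat_mono mult_right_mono) auto
      also have "\<dots> \<le> C" by (simp add: C_def)
      finally show ?thesis using Y by linarith
    qed
    have Y0: "Y > 0" using C Y by linarith
    have q0: "0 \<le> ln (Y / real (g * Q ^ J)) / ln (real P)" using gQ gQY lnP by (intro divide_nonneg_pos ln_ge_zero) (auto simp: field_simps)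
    have A1: "real A \<le> ln (Y / real (g * Q ^ J)) / ln (real P)" "ln (Y / real (g * Q ^ J)) / ln (real P) < real A + 1"
      using q0 unfolding A_def by linarith+
    have PA: "real P ^ A = exp (real A * ln (real P))" for A using P2 by (simp add: exp_of_nat_mult)
    have "real A * ln (real P) \<le> ln (Y / real (g * Q ^ J))" using A1(1) lnP by (simp add: field_simps)
    hence "real P ^ A \<le> Y / real (g * Q ^ J)" unfolding PA using Y0 gQ by (metis divide_pos_pos exp_le_cancel_iff exp_ln)
    hence PAY: "real P ^ A * real (g * Q ^ J) \<le> Y" using gQ by (simp add: field_simps)
    have "ln (Y / real (g * Q ^ J)) \<le> real (Suc A) * ln (real P)" using A1(2) lnP by (simp add: field_simps)
    hence "Y / real (g * Q ^ J) \<le> real P ^ Suc A" unfolding PA using Y0 gQ by (metis divide_pos_pos exp_le_cancel_iff exp_ln)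
    hence PAY2: "Y \<le> real P ^ A * real (g * Q ^ J * P)" using gQ by (simp add: field_simps)
    define E where "E = (\<lambda>x. \<Sum>b<J. \<Sum>a<A. 1 - cos (2 * pi * (real (P ^ a) * (real (g * Q ^ b) * x))))"
    define \<Psi> where "\<Psi> = (\<lambda>x. exp (- c0 * E x))"
    have "continuous_on UNIV \<Psi>" unfolding \<Psi>_def E_def by (intro continuous_intros)
    moreover have "0 \<le> \<Psi> x" for x by (simp add: \<Psi>_def)
    moreover have "exp (- c0 * (\<Sum>h\<in>{h \<in> cls K c n. real h \<le> Y}. 1 - cos (2 * pi * (x * real h)))) \<le> \<Psi> x" for x
    proof -
      have "E x \<le> (\<Sum>h\<in>{h \<in> cls K c n. real h \<le> Y}. 1 - cos (2 * pi * (x * real h)))"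
        unfolding E_def g_def P_def Q_def
      proof (rule class_lines_le[OF c Y(1)], fold g_def P_def Q_def)
        fix a b assume ab: "a < A" "b < J"
        have "real (g * Q ^ b * P ^ a) \<le> real (g * Q ^ J * P ^ A)"
          using ab P2 by (intro of_nat_mono mult_mono power_increasing) auto
        also have "\<dots> \<le> Y" using PAY by (simp add: mult_ac)
        finally show "real (g * Q ^ b * P ^ a) \<le> Y" .
      qed
      thus ?thesis unfolding \<Psi>_def using c0 by simp
    qed
    moreover have "integral {-1/2..1/2} \<Psi> \<le> C * Y powr (e - 1)"
    proof -
      define ep where "ep = real P * exp (- (c0 * real J) / (real P)\<^sup>2)"
      have "integral {-1/2..1/2} \<Psi> \<le> 2 * integral {0..1} \<Psi>"
        by (intro integral_symmetric_le) (auto simp: \<Psi>_def E_def intro!: continuous_intros)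
      also have "integral {0..1} \<Psi> \<le> real J * ((1 + ep) / real P) ^ A"
        unfolding \<Psi>_def E_def ep_def using P2 g J c0 by (intro integral_exp_cos_lines_le) auto
      also have "\<dots> = real J * ((1 + ep) ^ A / real P ^ A)" by (simp add: power_divide)
      also have "\<dots> \<le> real J * (Y powr e * (real (g * Q ^ J * P) / Y))"
      proof -
        have "ep \<ge> 0" by (simp add: ep_def)
        hence "(1 + ep) ^ A \<le> exp ep ^ A" by (intro power_mono exp_ge_add_one_self) auto
        also have "\<dots> = exp (real A * ep)" by (simp add: exp_of_nat_mult)
        also have "\<dots> \<le> exp (e * ln Y)"
        proof -
          have "real A * ep \<le> real A * (e * ln (real P))" using J(2) by (intro mult_left_mono) (auto simp: ep_def)
          also have "\<dots> = e * (real A * ln (real P))" by simp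
          also have "real A * ln (real P) \<le> ln (Y / real (g * Q ^ J))" using A1(1) lnP by (simp add: field_simps)
          also have "\<dots> \<le> ln Y"
          proof -
            have "1 \<le> g * Q ^ J" using g P2 by (simp add: Suc_le_eq)
            hence "1 \<le> real (g * Q ^ J)" by (metis of_nat_1 of_nat_mono)
            hence "Y / real (g * Q ^ J) \<le> Y / 1" using Y0 by (intro divide_left_mono) auto
            thus ?thesis using Y0 gQ by (subst ln_le_cancel_iff) auto
          qed
          finally show ?thesis using e by simp
        qed
        also have "\<dots> = Y powr e" using Y0 by (simp add: powr_def)
        finally have 1: "(1 + ep) ^ A \<le> Y powr e" .
        have 2: "1 / real P ^ A \<le> real (g * Q ^ J * P) / Y"
        proof -
          have "0 < real P ^ A" using P2 by simp
          thus ?thesis using PAY2 Y0 by (simp add: field_simps)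
        qed
        have "(1 + ep) ^ A * (1 / real P ^ A) \<le> Y powr e * (real (g * Q ^ J * P) / Y)"
          using 1 2 by (intro mult_mono) auto
        thus ?thesis by (intro mult_left_mono) auto
      qed
      finally have "integral {-1/2..1/2} \<Psi> \<le> 2 * (real J * (Y powr e * (real (g * Q ^ J * P) / Y)))" by simp
      also have "\<dots> = 2 * real J * real (g * Q ^ J * P) * Y powr (e - 1)"
        using Y0 by (simp add: powr_diff)
      also have "\<dots> \<le> 2 * real J * real (P * Q ^ J * P) * Y powr (e - 1)"
        using g by (intro mult_right_mono mult_left_mono of_nat_mono) auto
      also have "\<dots> \<le> C * Y powr (e - 1)" by (intro mult_right_mono) (auto simp: C_def)
      finally show ?thesis .
    qed
    ultimately show "\<exists>\<Psi>. continuous_on UNIV \<Psi> \<and> (\<forall>x. 0 \<le> \<Psi> x) \<and> integral {-1/2..1/2} \<Psi> \<le> C * Y powr (e - 1) \<and>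
      (\<forall>x. exp (- c0 * (\<Sum>h\<in>{h \<in> cls K c n. real h \<le> Y}. 1 - cos (2 * pi * (x * real h)))) \<le> \<Psi> x)"
      by blast
  qed
qed

end

section \<open>Elementary estimates for moments and Gaussian approximation\<close>

lemma power_times_exp_le:
  fixes u :: real
  assumes "u \<ge> 0" "k \<le> 4"
  shows "u ^ k * exp (- u) \<le> 256"
proof (cases "k = 0")
  case False
  have "u / real k \<le> exp (u / real k)" using exp_ge_add_one_self[of "u / real k"] by linarith
  hence "(u / real k) ^ k \<le> exp (u / real k) ^ k" using assms by (intro power_mono) auto
  also have "\<dots> = exp u" using False by (simp flip: exp_of_nat_mult)
  finally have "u ^ k \<le> real k ^ k * exp u" using False by (simp add: power_divide field_simps)
  hence "u ^ k * exp (- u) \<le> real k ^ k * exp u * exp (- u)" by (intro mult_right_mono) auto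
  also have "\<dots> = real k ^ k" by (simp add: mult.assoc flip: exp_add)
  also have "\<dots> \<le> real 4 ^ k" using assms by (intro power_mono) auto
  also have "\<dots> \<le> real 4 ^ 4" using assms by (intro power_increasing) auto
  finally show ?thesis by simp
next
  case True
  have "exp (- u) \<le> 1" using assms by simp
  hence "exp (- u) \<le> 256" by linarith
  thus ?thesis using True by simp
qed

text \<open>The minimum on the right is the summand of \<open>sum_min_ratio_le\<close>, so the first
  three moments reduce to that one sum. The constant 256 = 4^4 comes from the power j + 1 <=
  4.\<close>

lemma power_times_exp_le_min:
  fixes u :: real
  assumes "u > 0" "1 \<le> j" "j \<le> 3"
  shows "u ^ j * exp (- u) \<le> 256 * min u (1 / u)"
proof -
  have "u ^ (j - 1) * exp (- u) \<le> 256" "u ^ (j + 1) * exp (- u) \<le> 256"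
    using assms by (intro power_times_exp_le; simp)+
  hence "u * (u ^ (j - 1) * exp (- u)) \<le> u * 256" "(u ^ (j + 1) * exp (- u)) / u \<le> 256 / u"
    using assms by (intro mult_left_mono divide_right_mono; simp)+
  moreover have "u * (u ^ (j - 1) * exp (- u)) = u ^ j * exp (- u)" using assms by (cases j) auto
  moreover have "(u ^ (j + 1) * exp (- u)) / u = u ^ j * exp (- u)" using assms by simp
  ultimately have "u ^ j * exp (- u) \<le> 256 * u" "u ^ j * exp (- u) \<le> 256 * (1 / u)" by linarith+
  thus ?thesis unfolding min_def by (simp only: split: if_split) simp
qed

text \<open>The exponent 3/2 instead of 2 makes the bound hold for all w >= 0 and gives an error
  cubic in tau when w = tau^2 v / 2.\<close>

lemma abs_exp_minus_linear_le:
  fixes w :: real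
  assumes "w \<ge> 0"
  shows "\<bar>exp (- w) - (1 - w)\<bar> \<le> w * sqrt w"
proof -
  have lo: "1 - w \<le> exp (- w)" using exp_ge_add_one_self[of "-w"] by simp
  show ?thesis
  proof (cases "w \<ge> 1")
    case True
    have "exp (- w) \<le> 1" using assms by simp
    moreover have "w * 1 \<le> w * sqrt w" using True by (intro mult_left_mono) auto
    ultimately show ?thesis using lo by linarith
  next
    case False
    have "1 + w \<le> exp w" by (rule exp_ge_add_one_self)
    hence "exp (- w) \<le> 1 / (1 + w)" using assms by (simp add: exp_minus field_simps)
    also have "\<dots> \<le> 1 - w + w * w"
      using assms by (simp add: field_simps)
    also have "w * w \<le> w * sqrt w"
    proof (intro mult_left_mono)
      have "sqrt w * sqrt w \<le> 1 * sqrt w" using False assms by (intro mult_right_mono) auto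
      thus "w \<le> sqrt w" using assms by simp
    qed (use assms in auto)
    finally show ?thesis using lo by linarith
  qed
qed

text \<open>Two errors add up: the Taylor expansion of cis to second order, where the third absolute
  moment is at most D v, and exp (- w) against 1 - w, where sqrt v <= D.\<close>

lemma norm_char_minus_gauss_le:
  fixes q y :: "'i \<Rightarrow> real" and \<tau> D :: real
  assumes q: "\<And>k. k \<in> I \<Longrightarrow> q k \<ge> 0" "(\<Sum>k\<in>I. q k) = 1"
    and mu: "\<mu> = (\<Sum>k\<in>I. q k * y k)" and v: "v = (\<Sum>k\<in>I. q k * (y k - \<mu>)\<^sup>2)"
    and D: "\<And>k. k \<in> I \<Longrightarrow> \<bar>y k - \<mu>\<bar> \<le> D"
  shows "norm ((\<Sum>k\<in>I. q k *\<^sub>R cis (\<tau> * (y k - \<mu>))) - complex_of_real (exp (- (\<tau>\<^sup>2 * v / 2)))) \<le> D * \<bar>\<tau>\<bar> ^ 3 * v"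
proof -
  have I: "finite I" "I \<noteq> {}" using q(2) by (auto intro: ccontr)
  have D0: "D \<ge> 0" using D I by fastforce
  have v0: "v \<ge> 0" unfolding v using q by (intro sum_nonneg mult_nonneg_nonneg) auto
  have vD: "v \<le> D\<^sup>2"
  proof -
    have "v \<le> (\<Sum>k\<in>I. q k * D\<^sup>2)" unfolding v
      using q D by (intro sum_mono mult_left_mono) (auto simp: abs_le_square_iff[symmetric] D0)
    also have "\<dots> = D\<^sup>2" by (simp add: sum_distrib_right[symmetric] q)
    finally show ?thesis .
  qed
  define z where "z = (\<lambda>k. \<tau> * (y k - \<mu>))"
  have cen: "(\<Sum>k\<in>I. q k * (y k - \<mu>)) = 0"
    by (simp add: right_diff_distrib sum_subtractf sum_distrib_right[symmetric] q mu)
  have tay: "norm (cis (z k) - (1 + \<i> * complex_of_real (z k) - complex_of_real ((z k)\<^sup>2 / 2))) \<le> \<bar>z k\<bar> ^ 3 / 6" for k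
    using iexp_approx1[of "z k" 2]
    by (simp add: cis_conv_exp eval_nat_numeral fact_numeral algebra_simps power_mult_distrib)
  have main: "(\<Sum>k\<in>I. q k *\<^sub>R (1 + \<i> * complex_of_real (z k) - complex_of_real ((z k)\<^sup>2 / 2))) = complex_of_real (1 - \<tau>\<^sup>2 * v / 2)"
  proof -
    have "(\<Sum>k\<in>I. q k *\<^sub>R (1 + \<i> * complex_of_real (z k) - complex_of_real ((z k)\<^sup>2 / 2))) =
       complex_of_real (\<Sum>k\<in>I. q k) + \<i> * complex_of_real (\<Sum>k\<in>I. q k * z k) - complex_of_real (\<Sum>k\<in>I. q k * ((z k)\<^sup>2 / 2))"
      by (simp add: scaleR_conv_of_real algebra_simps sum.distrib sum_subtractf sum_distrib_left)
    also have "(\<Sum>k\<in>I. q k * z k) = \<tau> * (\<Sum>k\<in>I. q k * (y k - \<mu>))"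
      by (simp add: z_def sum_distrib_left mult_ac)
    also have "\<dots> = 0" by (simp add: cen)
    also have "(\<Sum>k\<in>I. q k * ((z k)\<^sup>2 / 2)) = \<tau>\<^sup>2 * v / 2"
      by (simp add: z_def v sum_distrib_left sum_divide_distrib power_mult_distrib mult_ac)
    finally show ?thesis by (simp add: q)
  qed
  have "norm ((\<Sum>k\<in>I. q k *\<^sub>R cis (z k)) - complex_of_real (1 - \<tau>\<^sup>2 * v / 2))
     = norm (\<Sum>k\<in>I. q k *\<^sub>R (cis (z k) - (1 + \<i> * complex_of_real (z k) - complex_of_real ((z k)\<^sup>2 / 2))))"
    unfolding main[symmetric] by (simp add: scaleR_diff_right sum_subtractf)
  also have "\<dots> \<le> (\<Sum>k\<in>I. q k * (\<bar>z k\<bar> ^ 3 / 6))"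
  proof (rule sum_norm_le)
    fix k assume "k \<in> I"
    thus "norm (q k *\<^sub>R (cis (z k) - (1 + \<i> * complex_of_real (z k) - complex_of_real ((z k)\<^sup>2 / 2)))) \<le> q k * (\<bar>z k\<bar> ^ 3 / 6)"
      unfolding norm_scaleR using q(1)[of k] mult_left_mono[OF tay[of k], of "q k"] by simp
  qed
  also have "\<dots> \<le> (\<Sum>k\<in>I. q k * (\<bar>\<tau>\<bar> ^ 3 * D * (y k - \<mu>)\<^sup>2 / 6))"
  proof (intro sum_mono mult_left_mono divide_right_mono)
    fix k assume k: "k \<in> I"
    have "\<bar>z k\<bar> ^ 3 = \<bar>\<tau>\<bar> ^ 3 * (\<bar>y k - \<mu>\<bar> * (y k - \<mu>)\<^sup>2)"
    proof -
      have "(y k - \<mu>)\<^sup>2 = \<bar>y k - \<mu>\<bar>\<^sup>2" by simp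
      thus ?thesis unfolding z_def abs_mult power_mult_distrib by (simp only: power3_eq_cube power2_eq_square mult.assoc)
    qed
    also have "\<dots> \<le> \<bar>\<tau>\<bar> ^ 3 * (D * (y k - \<mu>)\<^sup>2)" using D[OF k] by (intro mult_left_mono mult_right_mono) auto
    finally show "\<bar>z k\<bar> ^ 3 \<le> \<bar>\<tau>\<bar> ^ 3 * D * (y k - \<mu>)\<^sup>2" by (simp add: mult.assoc)
  qed (use q in auto)
  also have "\<dots> = \<bar>\<tau>\<bar> ^ 3 * D * v / 6" by (simp add: v sum_distrib_left sum_divide_distrib mult_ac)
  finally have 1: "norm ((\<Sum>k\<in>I. q k *\<^sub>R cis (z k)) - complex_of_real (1 - \<tau>\<^sup>2 * v / 2)) \<le> \<bar>\<tau>\<bar> ^ 3 * D * v / 6" .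
  have "norm (complex_of_real (1 - \<tau>\<^sup>2 * v / 2) - complex_of_real (exp (- (\<tau>\<^sup>2 * v / 2)))) = \<bar>exp (- (\<tau>\<^sup>2 * v / 2)) - (1 - \<tau>\<^sup>2 * v / 2)\<bar>"
    by (simp only: of_real_diff[symmetric] norm_of_real abs_minus_commute)
  also have "\<dots> \<le> (\<tau>\<^sup>2 * v / 2) * sqrt (\<tau>\<^sup>2 * v / 2)" using v0 by (intro abs_exp_minus_linear_le) auto
  also have "\<dots> \<le> (\<tau>\<^sup>2 * v / 2) * (\<bar>\<tau>\<bar> * D)"
  proof (intro mult_left_mono)
    have "sqrt (\<tau>\<^sup>2 * v / 2) \<le> sqrt (\<tau>\<^sup>2 * D\<^sup>2)"
    proof (rule real_sqrt_le_mono)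
      have "\<tau>\<^sup>2 * v \<le> \<tau>\<^sup>2 * D\<^sup>2" using vD by (intro mult_left_mono) auto
      moreover have "0 \<le> \<tau>\<^sup>2 * v" using v0 by simp
      ultimately show "\<tau>\<^sup>2 * v / 2 \<le> \<tau>\<^sup>2 * D\<^sup>2" by linarith
    qed
    also have "\<dots> = \<bar>\<tau>\<bar> * D" using D0 by (simp add: real_sqrt_mult)
    finally show "sqrt (\<tau>\<^sup>2 * v / 2) \<le> \<bar>\<tau>\<bar> * D" .
  qed (use v0 in auto)
  also have "\<dots> = \<bar>\<tau>\<bar> ^ 3 * D * v / 2" by (simp add: power3_eq_cube power2_eq_square)
  finally have 2: "norm (complex_of_real (1 - \<tau>\<^sup>2 * v / 2) - complex_of_real (exp (- (\<tau>\<^sup>2 * v / 2)))) \<le> \<bar>\<tau>\<bar> ^ 3 * D * v / 2" .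
  have "norm ((\<Sum>k\<in>I. q k *\<^sub>R cis (z k)) - complex_of_real (exp (- (\<tau>\<^sup>2 * v / 2)))) \<le> \<bar>\<tau>\<bar> ^ 3 * D * v / 6 + \<bar>\<tau>\<bar> ^ 3 * D * v / 2"
    using norm_triangle_le[OF add_mono[OF 1 2]] by simp
  also have "\<dots> \<le> D * \<bar>\<tau>\<bar> ^ 3 * v"
  proof -
    have "0 \<le> \<bar>\<tau>\<bar> ^ 3 * D * v" using D0 v0 by simp
    thus ?thesis by (simp add: mult_ac)
  qed
  finally show ?thesis by (simp add: z_def)
qed

lemma integral_inverse_square_le:
  fixes s :: real assumes "s > 0"
  shows "integral {-1/2..1/2} (\<lambda>x. 1 / (1 + (s * x)\<^sup>2)) \<le> pi / s"
proof -
  have "((\<lambda>x. 1 / (1 + (s * x)\<^sup>2)) has_integral (arctan (s * (1/2)) / s - arctan (s * (-1/2)) / s)) {-1/2..1/2}"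
  proof (rule fundamental_theorem_of_calculus)
    fix x :: real
    have "((\<lambda>x. arctan (s * x) / s) has_real_derivative 1 / (1 + (s * x)\<^sup>2)) (at x within {-1/2..1/2})"
      by (rule derivative_eq_intros refl)+ (use assms in \<open>simp_all add: inverse_eq_divide\<close>)
    thus "((\<lambda>x. arctan (s * x) / s) has_vector_derivative 1 / (1 + (s * x)\<^sup>2)) (at x within {-1/2..1/2})"
      by (simp add: has_real_derivative_iff_has_vector_derivative)
  qed auto
  hence "integral {-1/2..1/2} (\<lambda>x. 1 / (1 + (s * x)\<^sup>2)) = 2 * arctan (s / 2) / s"
    by (simp add: integral_unique arctan_minus)
  also have "\<dots> \<le> pi / s" using assms arctan_ubound[of "s/2"] by (intro divide_right_mono) auto
  finally show ?thesis .
qed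

section \<open>Decay of the characteristic function of a colour class\<close>

context multibase
begin

text \<open>The order of the standard deviation of the digit sum, as read off from
  \<open>Hs_moment\<close> with exponent 2.\<close>

definition scale :: "real \<Rightarrow> nat \<Rightarrow> real" where "scale r n = (1 / r) * sqrt (ln (real n) ^ (m - 1))"

text \<open>The cut Y = 1/r is where r h reaches 1, so that every h <= Y gives the full gain of
  \<open>norm_digit_char_le\<close>. The major arc produces the rational term, the minor arcs
  produce \<open>\<Psi>\<close>, which later enters through its integral.\<close>

lemma class_decay:
  assumes K: "K \<ge> 1" and C0: "C0 > 0"
  shows "\<exists>C>0. \<exists>\<eta>>0. \<forall>\<^sub>F n in sequentially. \<forall>c r. c < K \<longrightarrow> 1 / real n \<le> r \<longrightarrow> r \<le> 1 \<longrightarrow>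
      real n \<le> C0 * (1 / r) * ln (real n) ^ (m - 1) \<longrightarrow>
      (\<exists>\<Psi>. continuous_on UNIV \<Psi> \<and> (\<forall>x. 0 \<le> \<Psi> x) \<and> integral {-1/2..1/2} \<Psi> \<le> real n powr (-1 - \<eta>) \<and>
        (\<forall>x\<in>{-1/2..1/2}. norm (digit_char d r (cls K c n) x) \<le> C / (1 + (scale r n * x)\<^sup>2)\<^sup>2 + \<Psi> x))"
proof -
  obtain a t0 where a: "a > 0" and maj: "\<And>n Y c x. c < K \<Longrightarrow> Y > 0 \<Longrightarrow> Y \<le> real n \<Longrightarrow> t0 \<le> ln Y \<Longrightarrow> \<bar>x\<bar> \<le> 1 / Y \<Longrightarrow>
     a * ((x * Y)\<^sup>2 * ln Y ^ (m - 1)) \<le> (\<Sum>h\<in>{h \<in> cls K c n. real h \<le> Y}. 1 - cos (2 * pi * (x * real h)))"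
    using class_major_arc[OF K] by blast
  define cd where "cd = exp (-1) / (real d)\<^sup>2"
  have cd: "cd > 0" using d2 by (simp add: cd_def)
  define B2 where "B2 = 2 / (real (p 0 ^ K) + real (p 1 ^ K))\<^sup>2 / ln (real (p 0 ^ K) * real (p 1 ^ K))"
  have pK: "2 \<le> p 0 ^ K" "2 \<le> p 1 ^ K" using self_le_power[of "p 0" K] self_le_power[of "p 1" K] p0 p1 K by auto
  have "2 * 2 \<le> real (p 0 ^ K) * real (p 1 ^ K)" using pK by (intro mult_mono) (auto simp del: of_nat_power)
  hence "0 < ln (real (p 0 ^ K) * real (p 1 ^ K))" by (intro ln_gt_zero) linarith
  hence B2: "B2 > 0" unfolding B2_def using pK by (intro divide_pos_pos) (auto simp del: of_nat_power)
  \<comment> \<open>From E >= B2 ln Y and ln Y >= L / 2, half of the exponent cd E is at least (cd /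
    2) B2 (L / 2) = delta L.\<close>
  define \<delta> where "\<delta> = cd * B2 / 4"
  have \<delta>: "\<delta> > 0" using cd B2 by (simp add: \<delta>_def)
  obtain C1 where C1: "C1 > 0" and lines: "\<And>n Y c. c < K \<Longrightarrow> Y \<le> real n \<Longrightarrow> C1 \<le> Y \<Longrightarrow>
     (\<exists>\<Psi>. continuous_on UNIV \<Psi> \<and> (\<forall>x. 0 \<le> \<Psi> x) \<and> integral {-1/2..1/2} \<Psi> \<le> C1 * Y powr (\<delta>/4 - 1) \<and>
      (\<forall>x. exp (- (cd/2) * (\<Sum>h\<in>{h \<in> cls K c n. real h \<le> Y}. 1 - cos (2 * pi * (x * real h)))) \<le> \<Psi> x))"
    using class_lines_integral[OF K, of "cd/2" "\<delta>/4"] cd \<delta> by auto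
  define a' where "a' = cd * a / 2 ^ (m - 1)"
  have a': "a' > 0" using cd a by (simp add: a'_def)
  define C where "C = 2 + 4 / a'\<^sup>2"
  have C: "C > 0" unfolding C_def using a' by (intro add_pos_nonneg) auto
  define G where "G = 2 * (real (p 0) ^ K * real (p 1) ^ K)\<^sup>2"
  show ?thesis
  proof (rule exI[of _ C], rule conjI[OF C], rule exI[of _ "\<delta>/2"], rule conjI)
    show "0 < \<delta> / 2" using \<delta> by simp
    have ev1: "\<forall>\<^sub>F n in sequentially. C0 * ln (real n) ^ (m - 1) \<le> real n powr (1/2)"
      by (rule eventually_ln_power_le_powr) auto
    have ev2: "\<forall>\<^sub>F n in sequentially. (C1 * C0) * ln (real n) ^ (m - 1) \<le> real n powr (\<delta>/4)"
      by (rule eventually_ln_power_le_powr) (use \<delta> in auto)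
    have ev3: "\<forall>\<^sub>F n in sequentially. max 1 (max (2 * t0) (max (2 * ln C1) (2 * ln G))) \<le> ln (real n)"
      by (rule eventually_ln_ge)
    show "\<forall>\<^sub>F n in sequentially. \<forall>c r. c < K \<longrightarrow> 1 / real n \<le> r \<longrightarrow> r \<le> 1 \<longrightarrow>
      real n \<le> C0 * (1 / r) * ln (real n) ^ (m - 1) \<longrightarrow>
      (\<exists>\<Psi>. continuous_on UNIV \<Psi> \<and> (\<forall>x. 0 \<le> \<Psi> x) \<and> integral {-1/2..1/2} \<Psi> \<le> real n powr (-1 - \<delta>/2) \<and>
        (\<forall>x\<in>{-1/2..1/2}. norm (digit_char d r (cls K c n) x) \<le> C / (1 + (scale r n * x)\<^sup>2)\<^sup>2 + \<Psi> x))"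
      using ev1 ev2 ev3 eventually_ge_at_top[of "3::nat"]
    proof (eventually_elim, intro allI impI)
      fix n :: nat and c :: nat and r :: real
      assume e1: "C0 * ln (real n) ^ (m - 1) \<le> real n powr (1/2)"
        and e2: "(C1 * C0) * ln (real n) ^ (m - 1) \<le> real n powr (\<delta>/4)"
        and e3: "max 1 (max (2 * t0) (max (2 * ln C1) (2 * ln G))) \<le> ln (real n)"
        and n3: "n \<ge> 3" and c: "c < K" and r: "1 / real n \<le> r" "r \<le> 1"
        and nY: "real n \<le> C0 * (1 / r) * ln (real n) ^ (m - 1)"
      define Y where "Y = 1 / r"
      define L where "L = ln (real n)"
      have n0: "real n > 0" using n3 by simp
      have r0: "r > 0" using r(1) n0 by (meson divide_pos_pos less_le_trans zero_less_one)
      have Y0: "Y > 0" and Yn: "Y \<le> real n" and rY: "r = 1 / Y" using r r0 n0 by (auto simp: Y_def field_simps)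
      have L1: "L \<ge> 1" using e3 by (simp add: L_def)
      have npow: "real n powr e = exp (e * L)" for e using n0 by (simp add: powr_def L_def)
      \<comment> \<open>The lower bound on 1/r gives Y >= sqrt n, so ln Y has the order of ln
        n.\<close>
      have "real n \<le> Y * (C0 * L ^ (m - 1))" using nY by (simp add: Y_def L_def mult_ac)
      also have "\<dots> \<le> Y * real n powr (1/2)" using e1 Y0 by (intro mult_left_mono) (auto simp: L_def)
      finally have "exp L \<le> exp (ln Y) * exp (L / 2)" using n0 Y0 npow[of "1/2"] by (simp add: L_def)
      hence "exp L \<le> exp (ln Y + L / 2)" by (simp only: exp_add)
      hence lnY: "ln Y \<ge> L / 2" by simp
      have lnYL: "ln Y \<le> L" unfolding L_def using Yn Y0 by (subst ln_le_cancel_iff) auto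
      have G0: "G > 0" unfolding G_def using p0 p1 by auto
      have Ybig: "C1 \<le> Y" "G \<le> Y" "t0 \<le> ln Y"
      proof -
        have "ln C1 \<le> ln Y" "ln G \<le> ln Y" "t0 \<le> ln Y" using e3 lnY by (simp_all add: L_def)
        thus "C1 \<le> Y" "G \<le> Y" "t0 \<le> ln Y" using C1 G0 Y0 by auto
      qed
      obtain \<Psi>1 where P1: "continuous_on UNIV \<Psi>1" "\<And>x. 0 \<le> \<Psi>1 x" "integral {-1/2..1/2} \<Psi>1 \<le> C1 * Y powr (\<delta>/4 - 1)"
        "\<And>x. exp (- (cd/2) * (\<Sum>h\<in>{h \<in> cls K c n. real h \<le> Y}. 1 - cos (2 * pi * (x * real h)))) \<le> \<Psi>1 x"
        using lines[OF c Yn Ybig(1)] by blast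
      define \<Psi> where "\<Psi> = (\<lambda>x. real n powr (- \<delta>) * \<Psi>1 x)"
      have "integral {-1/2..1/2} \<Psi> \<le> real n powr (-1 - \<delta>/2)"
      proof -
        have "integral {-1/2..1/2} \<Psi> = real n powr (- \<delta>) * integral {-1/2..1/2} \<Psi>1" by (simp add: \<Psi>_def)
        also have "\<dots> \<le> real n powr (- \<delta>) * (C1 * Y powr (\<delta>/4 - 1))" using P1(3) by (intro mult_left_mono) auto
        also have "\<dots> = real n powr (- \<delta>) * (C1 * (Y powr (\<delta>/4) * (1 / Y)))" using Y0 by (simp add: powr_diff)
        also have "\<dots> \<le> real n powr (- \<delta>) * (C1 * (real n powr (\<delta>/4) * (C0 * L ^ (m - 1) / real n)))"
        proof (intro mult_left_mono mult_mono)
          show "Y powr (\<delta>/4) \<le> real n powr (\<delta>/4)" using Y0 Yn \<delta> by (intro powr_mono2) auto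
          show "1 / Y \<le> C0 * L ^ (m - 1) / real n" using nY Y0 n0 unfolding L_def[symmetric] rY by (simp add: field_simps)
        qed (use Y0 C1 in auto)
        also have "\<dots> = real n powr (- \<delta>) * real n powr (\<delta>/4) / real n * ((C1 * C0) * L ^ (m - 1))" by simp
        also have "\<dots> \<le> real n powr (- \<delta>) * real n powr (\<delta>/4) / real n * real n powr (\<delta>/4)"
          using e2 by (intro mult_left_mono) (auto simp: L_def)
        also have "\<dots> = exp (- \<delta> * L + \<delta>/4 * L - L + \<delta>/4 * L)"
        proof -
          have "exp L = real n" using n0 by (simp add: L_def)
          thus ?thesis unfolding npow exp_add exp_diff by simp
        qed
        also have "\<dots> = real n powr (-1 - \<delta>/2)" unfolding npow by (simp add: algebra_simps)
        finally show ?thesis .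
      qed
      moreover have "norm (digit_char d r (cls K c n) x) \<le> C / (1 + (scale r n * x)\<^sup>2)\<^sup>2 + \<Psi> x" if x: "x \<in> {-1/2..1/2}" for x
      proof -
        define E where "E = (\<Sum>h\<in>{h \<in> cls K c n. real h \<le> Y}. 1 - cos (2 * pi * (x * real h)))"
        have E0: "E \<ge> 0" unfolding E_def by (intro sum_nonneg) auto
        have b: "norm (digit_char d r (cls K c n) x) \<le> exp (- cd * E)"
          unfolding cd_def E_def
          by (rule norm_digit_char_le_exp) (use d2 r0 finite_cls Y0 in \<open>auto simp: Y_def field_simps\<close>)
        have Psi0: "0 \<le> \<Psi> x" using P1(2) by (simp add: \<Psi>_def)
        show ?thesis
        proof (cases "\<bar>x\<bar> \<le> 1 / Y")
          case True
          have "a' * (scale r n * x)\<^sup>2 = cd * (a * ((x * Y)\<^sup>2 * (L / 2) ^ (m - 1)))"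
            using L1 by (simp add: a'_def scale_def Y_def L_def power_mult_distrib power_divide mult_ac)
          also have "\<dots> \<le> cd * (a * ((x * Y)\<^sup>2 * ln Y ^ (m - 1)))"
            using cd a lnY L1 by (intro mult_left_mono power_mono) auto
          also have "\<dots> \<le> cd * E" unfolding E_def using cd by (intro mult_left_mono maj c Y0 Yn Ybig True) auto
          finally have "norm (digit_char d r (cls K c n) x) \<le> exp (- a' * (scale r n * x)\<^sup>2)" using b by (simp add: order.trans)
          also have "\<dots> \<le> C / (1 + (scale r n * x)\<^sup>2)\<^sup>2" unfolding C_def by (intro exp_minus_le_inverse_square a') auto
          finally show ?thesis using Psi0 by linarith
        next
          case False
          have "B2 * ln Y \<le> E" unfolding B2_def E_def
            by (rule class_minor_arc[OF K c Yn]) (use Ybig(2) False x in \<open>auto simp: G_def\<close>)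
          moreover have "B2 * (L / 2) \<le> B2 * ln Y" using lnY B2 by (intro mult_left_mono) auto
          ultimately have "B2 * (L / 2) \<le> E" by linarith
          hence "cd / 2 * (B2 * (L / 2)) \<le> cd / 2 * E" using cd by (intro mult_left_mono) auto
          hence d': "\<delta> * L \<le> cd / 2 * E" by (simp add: \<delta>_def)
          \<comment> \<open>One half of the exponent goes to the majorant, the other to the
            pointwise saving n^(-delta).\<close>
          have "exp (- cd * E) = exp (- (cd/2) * E) * exp (- (cd / 2 * E))" by (simp flip: exp_add)
          also have "\<dots> \<le> \<Psi>1 x * exp (- (\<delta> * L))" using P1(4)[of x] d' P1(2)[of x] unfolding E_def by (intro mult_mono) auto
          also have "\<dots> = \<Psi> x" by (simp add: \<Psi>_def npow)
          finally have "norm (digit_char d r (cls K c n) x) \<le> \<Psi> x" using b by linarith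
          moreover have "0 \<le> C / (1 + (scale r n * x)\<^sup>2)\<^sup>2" using C by simp
          ultimately show ?thesis by linarith
        qed
      qed
      moreover have "continuous_on UNIV \<Psi>" unfolding \<Psi>_def by (intro continuous_intros P1)
      moreover have "0 \<le> \<Psi> x" for x using P1(2) by (simp add: \<Psi>_def)
      ultimately show "\<exists>\<Psi>. continuous_on UNIV \<Psi> \<and> (\<forall>x. 0 \<le> \<Psi> x) \<and> integral {-1/2..1/2} \<Psi> \<le> real n powr (-1 - \<delta>/2) \<and>
        (\<forall>x\<in>{-1/2..1/2}. norm (digit_char d r (cls K c n) x) \<le> C / (1 + (scale r n * x)\<^sup>2)\<^sup>2 + \<Psi> x)" by blast
    qed
  qed
qed

end

subsection \<open>Choice of the parameter and the local lower bound\<close>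

definition digit_mean :: "nat \<Rightarrow> real \<Rightarrow> nat \<Rightarrow> real" where
  "digit_mean d r h = (\<Sum>k<d. digit_wt d r h k * real k)"

definition digit_var :: "nat \<Rightarrow> real \<Rightarrow> nat \<Rightarrow> real" where
  "digit_var d r h = (\<Sum>k<d. digit_wt d r h k * (real k - digit_mean d r h)\<^sup>2)"

lemma digit_moment_le:
  assumes "d \<ge> 1" "r \<ge> 0" "j \<ge> 1"
  shows "(\<Sum>k<d. digit_wt d r h k * real k ^ j) \<le> real d ^ (j + 1) * exp (- (r * real h))"
proof -
  have "(\<Sum>k<d. digit_wt d r h k * real k ^ j) \<le> (\<Sum>k<d. real d ^ j * exp (- (r * real h)))"
  proof (rule sum_mono)
    fix k assume k: "k \<in> {..<d}"
    show "digit_wt d r h k * real k ^ j \<le> real d ^ j * exp (- (r * real h))"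
    proof (cases "k = 0")
      case False
      have "digit_wt d r h k \<le> exp (- r * real k * real h)" using assms by (intro digit_wt_le) auto
      also have "\<dots> \<le> exp (- (r * real h))"
      proof -
        have "1 * (r * real h) \<le> real k * (r * real h)" using False assms by (intro mult_right_mono) auto
        thus ?thesis by (simp add: mult_ac)
      qed
      finally have "digit_wt d r h k * real k ^ j \<le> exp (- (r * real h)) * real d ^ j"
        using k by (intro mult_mono power_mono) auto
      thus ?thesis by (simp add: mult_ac)
    qed (use assms in \<open>auto simp: power_0_left\<close>)
  qed
  thus ?thesis by simp
qed

lemma digit_mean_nonneg: "0 \<le> digit_mean d r h"
  unfolding digit_mean_def by (intro sum_nonneg mult_nonneg_nonneg digit_wt_nonneg) auto

lemma digit_mean_le: assumes "d \<ge> 1" shows "digit_mean d r h \<le> real d"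
proof -
  have "digit_mean d r h \<le> (\<Sum>k<d. digit_wt d r h k * real d)"
    unfolding digit_mean_def by (intro sum_mono mult_left_mono digit_wt_nonneg) auto
  also have "\<dots> = real d" using sum_digit_wt[OF assms, of r h] by (simp flip: sum_distrib_right)
  finally show ?thesis .
qed

lemma digit_var_nonneg: "0 \<le> digit_var d r h"
  unfolding digit_var_def by (intro sum_nonneg mult_nonneg_nonneg digit_wt_nonneg) auto

lemma digit_var_le: assumes "d \<ge> 1" "r \<ge> 0" shows "digit_var d r h \<le> real d ^ 3 * exp (- (r * real h))"
proof -
  have "digit_var d r h = (\<Sum>k<d. digit_wt d r h k * real k ^ 2) - 2 * digit_mean d r h * (\<Sum>k<d. digit_wt d r h k * real k) + (digit_mean d r h)\<^sup>2 * (\<Sum>k<d. digit_wt d r h k)"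
    unfolding digit_var_def sum_distrib_left sum_subtractf[symmetric] sum.distrib[symmetric]
    by (intro sum.cong refl) (simp add: power2_eq_square algebra_simps)
  also have "\<dots> = (\<Sum>k<d. digit_wt d r h k * real k ^ 2) - (digit_mean d r h)\<^sup>2"
    using sum_digit_wt[OF assms(1), of r h] by (simp add: digit_mean_def[symmetric] power2_eq_square)
  also have "\<dots> \<le> real d ^ (2 + 1) * exp (- (r * real h))" using digit_moment_le[OF assms, of 2 h] zero_le_power2[of "digit_mean d r h"] by linarith
  finally show ?thesis by (simp add: eval_nat_numeral)
qed

lemma continuous_on_digit_mean [continuous_intros]:
  assumes "d \<ge> 1" shows "continuous_on T (\<lambda>r. digit_mean d r h)"
proof -
  have "(\<Sum>j<d. exp (- r * real j * real h)) \<noteq> 0" for r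
    using assms sum_pos[of "{..<d}" "\<lambda>j. exp (- r * real j * real h)"] by (auto simp: lessThan_empty_iff)
  thus ?thesis unfolding digit_mean_def digit_wt_def by (intro continuous_intros) auto
qed

text \<open>When the mean of the digit sum is exactly n, the inversion phase at n is the product of
  the centring phases of the single digits.\<close>

lemma digit_char_centred:
  assumes "finite H" "(\<Sum>h\<in>H. real h * digit_mean d r h) = real n"
  shows "cis (- (2 * pi * x * real n)) * digit_char d r H x =
    (\<Prod>h\<in>H. \<Sum>k<d. digit_wt d r h k *\<^sub>R cis (2 * pi * x * real h * (real k - digit_mean d r h)))"
proof -
  have cis_sum: "cis (\<Sum>h\<in>H. f h) = (\<Prod>h\<in>H. cis (f h))" for f :: "nat \<Rightarrow> real"
    using assms(1) by induction (auto simp: cis_mult[symmetric])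
  have "cis (- (2 * pi * x * real n)) = (\<Prod>h\<in>H. cis (- (2 * pi * x * real h * digit_mean d r h)))"
    unfolding cis_sum[symmetric] assms(2)[symmetric]
    by (intro arg_cong[where f = cis]) (simp add: sum_distrib_left sum_negf mult_ac)
  hence "cis (- (2 * pi * x * real n)) * digit_char d r H x =
     (\<Prod>h\<in>H. cis (- (2 * pi * x * real h * digit_mean d r h)) * (\<Sum>k<d. digit_wt d r h k *\<^sub>R cis (2 * pi * (x * real h) * real k)))"
    by (simp only: digit_char_prod[OF assms(1)] prod.distrib)
  also have "\<dots> = (\<Prod>h\<in>H. \<Sum>k<d. digit_wt d r h k *\<^sub>R cis (2 * pi * x * real h * (real k - digit_mean d r h)))"
  proof (intro prod.cong refl)
    fix h
    show "cis (- (2 * pi * x * real h * digit_mean d r h)) * (\<Sum>k<d. digit_wt d r h k *\<^sub>R cis (2 * pi * (x * real h) * real k))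
      = (\<Sum>k<d. digit_wt d r h k *\<^sub>R cis (2 * pi * x * real h * (real k - digit_mean d r h)))"
      unfolding sum_distrib_left
      by (intro sum.cong refl) (simp add: cis_mult algebra_simps)
  qed
  finally show ?thesis .
qed

text \<open>Products of factors of norm at most 1 differ by at most the sum of the differences of
  the factors, so the Gaussian errors of the single digits add up to a third moment.\<close>

lemma norm_prod_char_minus_gauss_le:
  assumes d: "d \<ge> 1" and r: "r \<ge> 0" and H: "finite H" "(\<Sum>h\<in>H. real h * digit_mean d r h) = real n"
  shows "norm (cis (- (2 * pi * x * real n)) * digit_char d r H x -
      complex_of_real (exp (- (2 * pi\<^sup>2 * x\<^sup>2 * (\<Sum>h\<in>H. (real h)\<^sup>2 * digit_var d r h)))))
    \<le> real d ^ 4 * (2 * pi * \<bar>x\<bar>) ^ 3 * (\<Sum>h\<in>H. real h ^ 3 * exp (- (r * real h)))"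
proof -
  let ?u = "\<lambda>h. \<Sum>k<d. digit_wt d r h k *\<^sub>R cis (2 * pi * x * real h * (real k - digit_mean d r h))"
  let ?g = "\<lambda>h. complex_of_real (exp (- ((2 * pi * x * real h)\<^sup>2 * digit_var d r h / 2)))"
  have g: "complex_of_real (exp (- (2 * pi\<^sup>2 * x\<^sup>2 * (\<Sum>h\<in>H. (real h)\<^sup>2 * digit_var d r h)))) = (\<Prod>h\<in>H. ?g h)"
    unfolding of_real_prod[symmetric] exp_sum[OF H(1), symmetric]
    by (intro arg_cong[where f = "\<lambda>x. complex_of_real (exp x)"])
       (simp add: sum_negf sum_distrib_left power_mult_distrib mult_ac)
  have "norm ((\<Prod>h\<in>H. ?u h) - (\<Prod>h\<in>H. ?g h)) \<le> (\<Sum>h\<in>H. norm (?u h - ?g h))"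
  proof (rule norm_prod_diff)
    fix h
    have "norm (?u h) \<le> (\<Sum>k<d. digit_wt d r h k)" by (rule sum_norm_le) (simp add: digit_wt_nonneg)
    thus "norm (?u h) \<le> 1" using sum_digit_wt[OF d] by simp
    show "norm (?g h) \<le> 1" using digit_var_nonneg by (simp add: mult_nonneg_nonneg)
  qed
  also have "\<dots> \<le> (\<Sum>h\<in>H. real d ^ 4 * (2 * pi * \<bar>x\<bar>) ^ 3 * (real h ^ 3 * exp (- (r * real h))))"
  proof (rule sum_mono)
    fix h
    have "norm (?u h - ?g h) \<le> real d * \<bar>2 * pi * x * real h\<bar> ^ 3 * digit_var d r h"
    proof (rule norm_char_minus_gauss_le[where I = "{..<d}" and q = "digit_wt d r h" and y = real])
      fix k assume "k \<in> {..<d}"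
      thus "\<bar>real k - digit_mean d r h\<bar> \<le> real d" using digit_mean_nonneg[of d r h] digit_mean_le[OF d, of r h] by auto
    qed (use sum_digit_wt[OF d] in \<open>auto simp: digit_wt_nonneg digit_mean_def digit_var_def\<close>)
    also have "\<dots> \<le> real d * \<bar>2 * pi * x * real h\<bar> ^ 3 * (real d ^ 3 * exp (- (r * real h)))"
      using digit_var_le[OF d r] by (intro mult_left_mono) auto
    also have "\<dots> = real d ^ 4 * (2 * pi * \<bar>x\<bar>) ^ 3 * (real h ^ 3 * exp (- (r * real h)))"
      by (simp add: abs_mult power_mult_distrib eval_nat_numeral mult_ac)
    finally show "norm (?u h - ?g h) \<le> real d ^ 4 * (2 * pi * \<bar>x\<bar>) ^ 3 * (real h ^ 3 * exp (- (r * real h)))" .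
  qed
  finally show ?thesis unfolding digit_char_centred[OF H] g by (simp add: sum_distrib_left)
qed

lemma digit_wt_0_approx:
  assumes d: "d \<ge> 1" and r: "r \<ge> 0"
  shows "\<bar>digit_wt d r h 0 - 1 / real d\<bar> \<le> real d * (r * real h)"
proof -
  define Z where "Z = (\<Sum>j<d. exp (- r * real j * real h))"
  have w: "digit_wt d r h 0 = 1 / Z" by (simp add: digit_wt_def Z_def)
  have Z1: "Z \<ge> 1" unfolding Z_def using d member_le_sum[of 0 "{..<d}" "\<lambda>j. exp (- r * real j * real h)"] by simp
  have Zd: "Z \<le> real d" using sum_mono[of "{..<d}" "\<lambda>j. exp (- r * real j * real h)" "\<lambda>_. 1"] r by (simp add: Z_def)
  have "real d - Z = (\<Sum>j<d. 1 - exp (- r * real j * real h))" by (simp add: Z_def sum_subtractf)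
  also have "\<dots> \<le> (\<Sum>j<d. real d * (r * real h))"
  proof (rule sum_mono)
    fix j assume j: "j \<in> {..<d}"
    have "1 - exp (- r * real j * real h) \<le> real j * (r * real h)"
      using exp_ge_add_one_self[of "- r * real j * real h"] by (simp add: algebra_simps)
    also have "\<dots> \<le> real d * (r * real h)" using j r by (intro mult_right_mono) auto
    finally show "1 - exp (- r * real j * real h) \<le> real d * (r * real h)" .
  qed
  finally have dZ: "real d - Z \<le> real d * (real d * (r * real h))" by simp
  have "\<bar>digit_wt d r h 0 - 1 / real d\<bar> = (real d - Z) / (real d * Z)"
    unfolding w using Z1 Zd d by (simp add: field_simps abs_of_nonneg)
  also have "\<dots> \<le> (real d * (real d * (r * real h))) / (real d * 1)"
    using dZ Z1 Zd d r by (intro frac_le mult_mono) auto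
  also have "\<dots> = real d * (r * real h)" using d by simp
  finally show ?thesis .
qed

section \<open>The mean equation and the probability of digit sum n\<close>

context multibase
begin

text \<open>Rescaling h by 1/r reduces every moment to \<open>sum_min_ratio_le\<close> with Y = 1/r,
  whose constant does not depend on Y.\<close>

lemma Hs_moment:
  "\<exists>C>0. \<forall>n r j. n \<ge> 3 \<longrightarrow> r > 0 \<longrightarrow> 1 \<le> j \<longrightarrow> j \<le> 3 \<longrightarrow>
     (\<Sum>h\<in>Hs n. real h ^ j * exp (- (r * real h))) \<le> C * (1 / r) ^ j * ln (real n) ^ (m - 1)"
proof -
  obtain C where C: "C > 0" "\<And>n Y. n \<ge> 3 \<Longrightarrow> Y > 0 \<Longrightarrow> (\<Sum>h\<in>Hs n. min (real h / Y) (Y / real h)) \<le> C * ln (real n) ^ (m - 1)"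
    using sum_min_ratio_le by blast
  have "(\<Sum>h\<in>Hs n. real h ^ j * exp (- (r * real h))) \<le> (256 * C) * (1 / r) ^ j * ln (real n) ^ (m - 1)"
    if n: "n \<ge> 3" and r: "r > 0" and j: "1 \<le> j" "j \<le> 3" for n r j
  proof -
    have "(\<Sum>h\<in>Hs n. real h ^ j * exp (- (r * real h))) \<le>
      (\<Sum>h\<in>Hs n. (1 / r) ^ j * (256 * min (real h / (1 / r)) ((1 / r) / real h)))"
    proof (rule sum_mono)
      fix h assume "h \<in> Hs n"
      hence h: "real h > 0" using S_pos by (auto simp: Hs_def)
      have "(r * real h) ^ j * exp (- (r * real h)) \<le> 256 * min (r * real h) (1 / (r * real h))"
        using h r j by (intro power_times_exp_le_min) auto
      hence "(1 / r) ^ j * ((r * real h) ^ j * exp (- (r * real h))) \<le> (1 / r) ^ j * (256 * min (r * real h) (1 / (r * real h)))"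
        using r by (intro mult_left_mono) auto
      thus "real h ^ j * exp (- (r * real h)) \<le> (1 / r) ^ j * (256 * min (real h / (1 / r)) ((1 / r) / real h))"
        using r by (simp add: power_mult_distrib power_divide mult_ac)
    qed
    also have "\<dots> = (1 / r) ^ j * (256 * (\<Sum>h\<in>Hs n. min (real h / (1 / r)) ((1 / r) / real h)))"
      by (simp add: sum_distrib_left)
    also have "\<dots> \<le> (1 / r) ^ j * (256 * (C * ln (real n) ^ (m - 1)))"
      using r n by (intro mult_left_mono C(2)) auto
    finally show ?thesis by (simp add: mult_ac)
  qed
  thus ?thesis using C(1) by (intro exI[of _ "256 * C"]) auto
qed

text \<open>The mean of the digit sum is continuous in r. At r = 1/n the order (log n)^(m-1)
  elements just below n already push it above n, while at r = 1 it is O((log n)^(m-1)); the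
  intermediate value theorem gives r. The last bound says that 1/r is at least n / (log n)^(m-1) up
  to a constant.\<close>

lemma saddle:
  "\<exists>C0>0. \<forall>\<^sub>F n in sequentially. \<exists>r. 1 / real n \<le> r \<and> r \<le> 1 \<and>
     (\<Sum>h\<in>Hs n. real h * digit_mean d r h) = real n \<and> real n \<le> C0 * (1 / r) * ln (real n) ^ (m - 1)"
proof -
  obtain C where C: "C > 0" "\<And>n r j. n \<ge> 3 \<Longrightarrow> r > 0 \<Longrightarrow> 1 \<le> j \<Longrightarrow> j \<le> 3 \<Longrightarrow>
     (\<Sum>h\<in>Hs n. real h ^ j * exp (- (r * real h))) \<le> C * (1 / r) ^ j * ln (real n) ^ (m - 1)"
    using Hs_moment by blast
  define C0 where "C0 = (real d)\<^sup>2 * C"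
  have C0: "C0 > 0" using C d2 by (simp add: C0_def)
  have up: "(\<Sum>h\<in>Hs n. real h * digit_mean d r h) \<le> C0 * (1 / r) * ln (real n) ^ (m - 1)" if "n \<ge> 3" "r > 0" for n r
  proof -
    have "(\<Sum>h\<in>Hs n. real h * digit_mean d r h) \<le> (\<Sum>h\<in>Hs n. (real d)\<^sup>2 * (real h ^ 1 * exp (- (r * real h))))"
    proof (rule sum_mono)
      fix h
      have "digit_mean d r h \<le> (real d)\<^sup>2 * exp (- (r * real h))"
        using digit_moment_le[of d r 1 h] d2 that by (simp add: digit_mean_def power2_eq_square)
      hence "real h * digit_mean d r h \<le> real h * ((real d)\<^sup>2 * exp (- (r * real h)))" by (intro mult_left_mono) auto
      thus "real h * digit_mean d r h \<le> (real d)\<^sup>2 * (real h ^ 1 * exp (- (r * real h)))" by (simp add: mult_ac)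
    qed
    also have "\<dots> = (real d)\<^sup>2 * (\<Sum>h\<in>Hs n. real h ^ 1 * exp (- (r * real h)))" by (simp add: sum_distrib_left)
    also have "\<dots> \<le> (real d)\<^sup>2 * (C * (1 / r) ^ 1 * ln (real n) ^ (m - 1))" using that by (intro mult_left_mono C(2)) auto
    finally show ?thesis by (simp add: C0_def mult_ac)
  qed
  define l where "l = Om + 1"
  have l: "l \<ge> 1" using Om_nonneg by (simp add: l_def)
  have lo: "(exp (-1) / real d) * (exp (- l) * (kap * real m * (ln (real n) / 2) ^ (m - 1))) * real n \<le> (\<Sum>h\<in>Hs n. real h * digit_mean d (1 / real n) h)"
    if n: "n \<ge> 3" "2 * l \<le> ln (real n)" for n
  proof -
    define s where "s = ln (real n) - l"
    have n0: "real n > 0" using n by simp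
    have s: "s \<ge> ln (real n) / 2" "s \<ge> 0" "ln (real n) \<ge> 0" using n l by (auto simp: s_def)
    let ?B = "{h \<in> S. exp s < real h \<and> real h \<le> exp (ln (real n))}"
    have "kap * real m * (ln (real n) / 2) ^ (m - 1) \<le> kap * real m * s ^ (m - 1) * (ln (real n) - s - Om)"
    proof -
      have "ln (real n) - s - Om = 1" by (simp add: s_def l_def)
      moreover have "kap * real m * (ln (real n) / 2) ^ (m - 1) \<le> kap * real m * s ^ (m - 1)"
        using s kap_pos by (intro mult_left_mono power_mono) auto
      ultimately show ?thesis by simp
    qed
    also have "\<dots> \<le> real (card ?B)" by (rule window_card_ge) (use s in \<open>auto simp: s_def l_def\<close>)
    finally have card: "kap * real m * (ln (real n) / 2) ^ (m - 1) \<le> real (card ?B)" .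
    have sub: "?B \<subseteq> Hs n" using n0 by (auto simp: Hs_def)
    have each: "(exp (-1) / real d) * (exp (- l) * real n) \<le> real h * digit_mean d (1 / real n) h" if h: "h \<in> ?B" for h
    proof -
      have hn: "real h \<le> real n" using h n0 by simp
      have "exp (- l) * real n = exp s" using n0 by (simp add: s_def exp_diff exp_minus field_simps)
      hence h1: "exp (- l) * real n \<le> real h" using h by simp
      have "1 / real d * exp (-1) \<le> digit_wt d (1 / real n) h 0 * exp (- (1 / real n) * real 1 * real h)"
        using d2 n0 hn by (intro mult_mono digit_wt_0_ge) (auto simp: digit_wt_nonneg)
      also have "\<dots> = digit_wt d (1 / real n) h 1" by (rule digit_wt_eq[symmetric])
      also have "\<dots> = digit_wt d (1 / real n) h 1 * real 1" by simp
      also have "\<dots> \<le> digit_mean d (1 / real n) h" unfolding digit_mean_def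
        by (rule member_le_sum) (use d2 in \<open>auto simp: digit_wt_nonneg\<close>)
      finally have "exp (-1) / real d \<le> digit_mean d (1 / real n) h" by simp
      hence "(exp (- l) * real n) * (exp (-1) / real d) \<le> real h * digit_mean d (1 / real n) h"
        using h1 by (intro mult_mono) auto
      thus ?thesis by (simp only: mult.commute)
    qed
    have "(exp (-1) / real d) * (exp (- l) * (kap * real m * (ln (real n) / 2) ^ (m - 1))) * real n =
      (kap * real m * (ln (real n) / 2) ^ (m - 1)) * ((exp (-1) / real d) * (exp (- l) * real n))" by (simp only: mult_ac)
    also have "\<dots> \<le> real (card ?B) * ((exp (-1) / real d) * (exp (- l) * real n))"
      using card by (intro mult_right_mono) auto
    also have "\<dots> = (\<Sum>h\<in>?B. (exp (-1) / real d) * (exp (- l) * real n))" by simp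
    also have "\<dots> \<le> (\<Sum>h\<in>?B. real h * digit_mean d (1 / real n) h)" by (intro sum_mono each)
    also have "\<dots> \<le> (\<Sum>h\<in>Hs n. real h * digit_mean d (1 / real n) h)"
      by (rule sum_mono2[OF finite_Hs sub]) (auto intro!: mult_nonneg_nonneg digit_mean_nonneg)
    finally show ?thesis .
  qed
  define c1 where "c1 = (exp (-1) / real d) * (exp (- l) * (kap * real m / 2 ^ (m - 1)))"
  have c1: "c1 > 0" unfolding c1_def using d2 kap_pos m2 by (intro mult_pos_pos divide_pos_pos) auto
  have ev1: "\<forall>\<^sub>F n in sequentially. max (2 * l) (max 1 (1 / c1)) \<le> ln (real n)" by (rule eventually_ln_ge)
  have ev2: "\<forall>\<^sub>F n in sequentially. C0 * ln (real n) ^ (m - 1) \<le> real n powr 1"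
    by (rule eventually_ln_power_le_powr) auto
  have "\<forall>\<^sub>F n in sequentially. \<exists>r. 1 / real n \<le> r \<and> r \<le> 1 \<and>
     (\<Sum>h\<in>Hs n. real h * digit_mean d r h) = real n \<and> real n \<le> C0 * (1 / r) * ln (real n) ^ (m - 1)"
    using ev1 ev2 eventually_ge_at_top[of "3::nat"]
  proof eventually_elim
    case (elim n)
    have n0: "real n > 0" using elim by simp
    have "1 \<le> c1 * ln (real n) ^ 1" using elim(1) c1 by (simp add: field_simps)
    also have "c1 * ln (real n) ^ 1 \<le> c1 * ln (real n) ^ (m - 1)"
      using elim(1) c1 m2 by (intro mult_left_mono power_increasing) auto
    finally have "1 * real n \<le> c1 * ln (real n) ^ (m - 1) * real n" using n0 by (intro mult_right_mono) auto
    also have "\<dots> = (exp (-1) / real d) * (exp (- l) * (kap * real m * (ln (real n) / 2) ^ (m - 1))) * real n"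
      by (simp add: c1_def power_divide)
    also have "\<dots> \<le> (\<Sum>h\<in>Hs n. real h * digit_mean d (1 / real n) h)" using elim by (intro lo) auto
    finally have a: "real n \<le> (\<Sum>h\<in>Hs n. real h * digit_mean d (1 / real n) h)" by simp
    have b: "(\<Sum>h\<in>Hs n. real h * digit_mean d 1 h) \<le> real n" 
      using up[of n 1] elim(2,3) n0 by simp
    have "\<exists>r\<ge>1 / real n. r \<le> 1 \<and> (\<Sum>h\<in>Hs n. real h * digit_mean d r h) = real n"
      using a b n0 elim(3) d2 by (intro IVT2') (auto intro!: continuous_intros)
    then obtain r where r: "1 / real n \<le> r" "r \<le> 1" "(\<Sum>h\<in>Hs n. real h * digit_mean d r h) = real n" by blast
    have "r > 0" using r(1) n0 by (meson divide_pos_pos less_le_trans zero_less_one)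
    thus ?case using r up[of n r] elim(3) by auto
  qed
  thus ?thesis using C0 by blast
qed

lemma cls_1: "cls 1 0 n = Hs n" by (auto simp: cls_def colour_def)

lemma scale_bounds:
  assumes "1 / real n \<le> r" "r \<le> 1" "n \<ge> 1" "ln (real n) \<ge> 1"
  shows "sqrt (ln (real n)) \<le> scale r n" "1 / r \<le> scale r n" "scale r n \<le> real n * ln (real n) ^ m" "scale r n > 0"
proof -
  define L where "L = ln (real n)"
  have L: "L \<ge> 1" using assms by (simp add: L_def)
  have n0: "real n > 0" using assms by simp
  have r0: "r > 0" using assms(1) n0 by (meson divide_pos_pos less_le_trans zero_less_one)
  have Y: "1 / r \<ge> 1" "1 / r \<le> real n" using assms r0 n0 by (auto simp: field_simps)
  have "L ^ 1 \<le> L ^ (m - 1)" using L m2 by (intro power_increasing) auto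
  hence LL: "L \<le> L ^ (m - 1)" by simp
  hence s1: "sqrt L \<le> sqrt (L ^ (m - 1))" "1 \<le> sqrt (L ^ (m - 1))" using L by auto
  have "1 * sqrt L \<le> (1 / r) * sqrt (L ^ (m - 1))" using Y s1 L r0 by (intro mult_mono) auto
  thus "sqrt (ln (real n)) \<le> scale r n" by (simp add: scale_def L_def)
  have "(1 / r) * 1 \<le> (1 / r) * sqrt (L ^ (m - 1))" using Y s1 r0 by (intro mult_left_mono) auto
  thus sY: "1 / r \<le> scale r n" by (simp add: scale_def L_def)
  show "scale r n > 0" using sY Y by linarith
  have "sqrt (L ^ (m - 1)) * 1 \<le> sqrt (L ^ (m - 1)) * sqrt (L ^ (m - 1))" using s1 by (intro mult_left_mono) auto
  hence "sqrt (L ^ (m - 1)) \<le> L ^ (m - 1)" using L by simp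
  also have "\<dots> \<le> L ^ m" using L by (intro power_increasing) auto
  finally have "(1 / r) * sqrt (L ^ (m - 1)) \<le> real n * L ^ m" using Y L r0 by (intro mult_mono) auto
  thus "scale r n \<le> real n * ln (real n) ^ m" by (simp add: scale_def L_def)
qed

text \<open>Let f be the real part of the inversion integrand. A majorant g of all errors makes f +
  g nonnegative everywhere and at least c for |scale x| <= 1. Hence the integral of f is at least 2
  c / scale minus the integral of g, and the latter is at most c / scale.\<close>

lemma local_lower:
  assumes C0: "C0 > 0"
  shows "\<exists>c>0. \<forall>\<^sub>F n in sequentially. \<forall>r. 1 / real n \<le> r \<longrightarrow> r \<le> 1 \<longrightarrow>
     (\<Sum>h\<in>Hs n. real h * digit_mean d r h) = real n \<longrightarrow> real n \<le> C0 * (1 / r) * ln (real n) ^ (m - 1) \<longrightarrow>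
     c / scale r n \<le> digit_exp d r (Hs n) (\<lambda>a. of_bool (digit_sum (Hs n) a = n))"
proof -
  obtain C \<eta> where C: "C > 0" "\<eta> > 0" and ev0: "\<forall>\<^sub>F n in sequentially. \<forall>c r. c < 1 \<longrightarrow> 1 / real n \<le> r \<longrightarrow> r \<le> 1 \<longrightarrow>
      real n \<le> C0 * (1 / r) * ln (real n) ^ (m - 1) \<longrightarrow>
      (\<exists>\<Psi>. continuous_on UNIV \<Psi> \<and> (\<forall>x. 0 \<le> \<Psi> x) \<and> integral {-1/2..1/2} \<Psi> \<le> real n powr (-1 - \<eta>) \<and>
        (\<forall>x\<in>{-1/2..1/2}. norm (digit_char d r (cls 1 c n) x) \<le> C / (1 + (scale r n * x)\<^sup>2)\<^sup>2 + \<Psi> x))"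
    using class_decay[OF order.refl C0] by blast
  obtain CM where CM: "CM > 0" "\<And>n r j. n \<ge> 3 \<Longrightarrow> r > 0 \<Longrightarrow> 1 \<le> j \<Longrightarrow> j \<le> 3 \<Longrightarrow>
     (\<Sum>h\<in>Hs n. real h ^ j * exp (- (r * real h))) \<le> CM * (1 / r) ^ j * ln (real n) ^ (m - 1)"
    using Hs_moment by blast
  define b where "b = 2 * pi\<^sup>2 * (real d ^ 3 * CM)"
  define c where "c = exp (- b)"
  define C3 where "C3 = real d ^ 4 * (2 * pi) ^ 3 * CM"
  \<comment> \<open>M separates the range of the Gaussian approximation from that of the decay
    bound; its size makes C pi / (1 + M^2) at most c / 4.\<close>
  define M where "M = 1 + 4 * C * pi / c"
  have c: "c > 0" by (simp add: c_def)
  have b0: "b \<ge> 0" using CM by (simp add: b_def)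
  have C3: "C3 \<ge> 0" using CM by (simp add: C3_def)
  have M1: "M \<ge> 1" using C c by (simp add: M_def)
  define R where "R = C3 * M ^ 3 * (1 + M\<^sup>2)"
  have R0: "R \<ge> 0" unfolding R_def using C3 M1 by (intro mult_nonneg_nonneg) auto
  show ?thesis
  proof (rule exI[of _ c], rule conjI[OF c])
    have ev1: "\<forall>\<^sub>F n in sequentially. max 4 ((4 * R * pi / c)\<^sup>2) \<le> ln (real n)" by (rule eventually_ln_ge)
    have ev2: "\<forall>\<^sub>F n in sequentially. (2 / c) * ln (real n) ^ m \<le> real n powr \<eta>"
      by (rule eventually_ln_power_le_powr) (use C in auto)
    show "\<forall>\<^sub>F n in sequentially. \<forall>r. 1 / real n \<le> r \<longrightarrow> r \<le> 1 \<longrightarrow>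
     (\<Sum>h\<in>Hs n. real h * digit_mean d r h) = real n \<longrightarrow> real n \<le> C0 * (1 / r) * ln (real n) ^ (m - 1) \<longrightarrow>
     c / scale r n \<le> digit_exp d r (Hs n) (\<lambda>a. of_bool (digit_sum (Hs n) a = n))"
      using ev0 ev1 ev2 eventually_ge_at_top[of "3::nat"]
    proof (eventually_elim, intro allI impI)
      fix n :: nat and r :: real
      assume e0: "\<forall>c r. c < 1 \<longrightarrow> 1 / real n \<le> r \<longrightarrow> r \<le> 1 \<longrightarrow>
        real n \<le> C0 * (1 / r) * ln (real n) ^ (m - 1) \<longrightarrow>
        (\<exists>\<Psi>. continuous_on UNIV \<Psi> \<and> (\<forall>x. 0 \<le> \<Psi> x) \<and> integral {-1/2..1/2} \<Psi> \<le> real n powr (-1 - \<eta>) \<and>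
          (\<forall>x\<in>{-1/2..1/2}. norm (digit_char d r (cls 1 c n) x) \<le> C / (1 + (scale r n * x)\<^sup>2)\<^sup>2 + \<Psi> x))"
      and e1: "max 4 ((4 * R * pi / c)\<^sup>2) \<le> ln (real n)" and e2: "(2 / c) * ln (real n) ^ m \<le> real n powr \<eta>"
      and n3: "n \<ge> 3" and r: "1 / real n \<le> r" "r \<le> 1" and mean: "(\<Sum>h\<in>Hs n. real h * digit_mean d r h) = real n"
      and nY: "real n \<le> C0 * (1 / r) * ln (real n) ^ (m - 1)"
      define L where "L = ln (real n)"
      define \<sigma> where "\<sigma> = scale r n"
      have L4: "L \<ge> 4" using e1 by (simp add: L_def)
      have n0: "real n > 0" using n3 by simp
      have r0: "r > 0" using r(1) n0 by (meson divide_pos_pos less_le_trans zero_less_one)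
      note sb = scale_bounds[OF r, folded L_def \<sigma>_def]
      have sb': "sqrt L \<le> \<sigma>" "1 / r \<le> \<sigma>" "\<sigma> \<le> real n * L ^ m" "\<sigma> > 0" using sb n3 L4 by auto
      have "sqrt 4 \<le> sqrt L" using L4 by (intro real_sqrt_le_mono) auto
      hence s2: "\<sigma> \<ge> 2" using sb'(1) by simp
      obtain \<Psi> where Psi: "continuous_on UNIV \<Psi>" "\<And>x. 0 \<le> \<Psi> x" "integral {-1/2..1/2} \<Psi> \<le> real n powr (-1 - \<eta>)"
          "\<And>x. x \<in> {-1/2..1/2} \<Longrightarrow> norm (digit_char d r (Hs n) x) \<le> C / (1 + (\<sigma> * x)\<^sup>2)\<^sup>2 + \<Psi> x"
        using e0[rule_format, of 0 r] r nY unfolding cls_1 \<sigma>_def by auto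
      \<comment> \<open>The Lyapunov ratio: the third moments of the summands add up to O(sigma^3
        e).\<close>
      define e where "e = 1 / sqrt (L ^ (m - 1))"
      have L1: "L ^ (m - 1) > 0" using L4 by simp
      have e00: "e > 0" using L1 by (simp add: e_def)
      \<comment> \<open>Both errors are put over the denominator 1 + (sigma x)^2: R e serves |sigma
        x| <= M, the other term serves the decay range beyond M.\<close>
      define Q where "Q = R * e + C / (1 + M\<^sup>2)"
      define f where "f = (\<lambda>x. Re (cis (- (2 * pi * x * real n)) * digit_char d r (Hs n) x))"
      define g where "g = (\<lambda>x. Q / (1 + (\<sigma> * x)\<^sup>2) + \<Psi> x)"
      have M0: "1 + M\<^sup>2 > 0" by (smt (verit) zero_le_power2)
      have Q0: "Q \<ge> 0" unfolding Q_def using R0 e00 C M0 by auto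
      have den: "1 + (\<sigma> * x)\<^sup>2 > 0" for x by (smt (verit) zero_le_power2)
      have cf: "continuous_on T f" for T unfolding f_def by (intro continuous_intros)
      have cPsi: "continuous_on T \<Psi>" for T using Psi(1) continuous_on_subset by blast
      have cden: "continuous_on T (\<lambda>x. q / (1 + (\<sigma> * x)\<^sup>2))" for T q
        using den by (intro continuous_intros) (metis less_irrefl)
      have cg: "continuous_on T g" for T unfolding g_def by (intro continuous_intros cPsi cden)
      have V: "(\<Sum>h\<in>Hs n. (real h)\<^sup>2 * digit_var d r h) \<le> real d ^ 3 * CM * (1 / r)\<^sup>2 * L ^ (m - 1)"
      proof -
        have "(\<Sum>h\<in>Hs n. (real h)\<^sup>2 * digit_var d r h) \<le> (\<Sum>h\<in>Hs n. real d ^ 3 * ((real h)\<^sup>2 * exp (- (r * real h))))"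
        proof (rule sum_mono)
          fix h
          have "(real h)\<^sup>2 * digit_var d r h \<le> (real h)\<^sup>2 * (real d ^ 3 * exp (- (r * real h)))"
            using d2 r0 by (intro mult_left_mono digit_var_le) auto
          thus "(real h)\<^sup>2 * digit_var d r h \<le> real d ^ 3 * ((real h)\<^sup>2 * exp (- (r * real h)))" by (simp add: mult_ac)
        qed
        also have "\<dots> = real d ^ 3 * (\<Sum>h\<in>Hs n. (real h)\<^sup>2 * exp (- (r * real h)))" by (simp add: sum_distrib_left)
        also have "\<dots> \<le> real d ^ 3 * (CM * (1 / r)\<^sup>2 * L ^ (m - 1))"
          unfolding L_def using n3 r0 by (intro mult_left_mono CM(2)) auto
        finally show ?thesis by (simp add: mult_ac)
      qed
      have sq: "\<sigma>\<^sup>2 = (1 / r)\<^sup>2 * L ^ (m - 1)" using L1 by (simp add: \<sigma>_def scale_def L_def power_mult_distrib power_divide)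
      have cu: "(1 / r) ^ 3 * L ^ (m - 1) = \<sigma> ^ 3 * e"
      proof -
        define w where "w = sqrt (L ^ (m - 1))"
        have w: "w > 0" "L ^ (m - 1) = w * w" using L1 by (auto simp: w_def)
        have "\<sigma> = (1 / r) * w" by (simp add: \<sigma>_def scale_def w_def L_def)
        thus ?thesis using w unfolding e_def w_def[symmetric] w(2) by (simp add: power_mult_distrib power3_eq_cube)
      qed
      have fg: "0 \<le> f x + g x" "\<bar>\<sigma> * x\<bar> \<le> 1 \<Longrightarrow> c \<le> f x + g x" if x: "x \<in> {-1/2..1/2}" for x
      proof -
        define u where "u = \<sigma> * x"
        define D where "D = 1 + u\<^sup>2"
        have D: "D > 0" "D \<ge> 1" unfolding D_def by (auto intro: add_pos_nonneg)
        have "0 \<le> f x + g x \<and> (\<bar>u\<bar> \<le> 1 \<longrightarrow> c \<le> f x + g x)"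
        proof (cases "\<bar>u\<bar> \<le> M")
          case True
          let ?G = "exp (- (2 * pi\<^sup>2 * x\<^sup>2 * (\<Sum>h\<in>Hs n. (real h)\<^sup>2 * digit_var d r h)))"
          have "norm (cis (- (2 * pi * x * real n)) * digit_char d r (Hs n) x - complex_of_real ?G)
            \<le> real d ^ 4 * (2 * pi * \<bar>x\<bar>) ^ 3 * (\<Sum>h\<in>Hs n. real h ^ 3 * exp (- (r * real h)))"
            by (rule norm_prod_char_minus_gauss_le) (use d2 r0 finite_Hs mean in auto)
          also have "\<dots> \<le> real d ^ 4 * (2 * pi * \<bar>x\<bar>) ^ 3 * (CM * (1 / r) ^ 3 * L ^ (m - 1))"
            unfolding L_def using n3 r0 by (intro mult_left_mono CM(2)) auto
          also have "\<dots> = real d ^ 4 * (2 * pi) ^ 3 * CM * \<bar>x\<bar> ^ 3 * ((1 / r) ^ 3 * L ^ (m - 1))"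
            by (simp add: power_mult_distrib mult_ac)
          also have "\<dots> = C3 * \<bar>u\<bar> ^ 3 * e"
            unfolding cu u_def C3_def using sb'(4) by (simp add: abs_mult power_mult_distrib mult_ac)
          also have "\<dots> \<le> C3 * M ^ 3 * e" using True C3 e00 by (intro mult_right_mono mult_left_mono power_mono) auto
          finally have nrm: "norm (cis (- (2 * pi * x * real n)) * digit_char d r (Hs n) x - complex_of_real ?G) \<le> C3 * M ^ 3 * e" .
          have "\<bar>f x - ?G\<bar> \<le> norm (cis (- (2 * pi * x * real n)) * digit_char d r (Hs n) x - complex_of_real ?G)"
            unfolding f_def using abs_Re_le_cmod[of "cis (- (2 * pi * x * real n)) * digit_char d r (Hs n) x - complex_of_real ?G"] by simp
          hence "f x \<ge> ?G - C3 * M ^ 3 * e" using nrm by linarith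
          moreover have "C3 * M ^ 3 * e \<le> g x"
          proof -
            have "u\<^sup>2 \<le> M\<^sup>2" using True M1 by (simp add: abs_le_square_iff[symmetric])
            hence DM: "D \<le> 1 + M\<^sup>2" by (simp add: D_def)
            have "C3 * M ^ 3 * e * D \<le> C3 * M ^ 3 * e * (1 + M\<^sup>2)"
              using C3 M1 e00 DM by (intro mult_left_mono) auto
            also have "\<dots> \<le> Q" unfolding Q_def R_def using C M0 by (simp add: mult_ac)
            finally have "C3 * M ^ 3 * e \<le> Q / D" using D by (simp add: field_simps)
            thus ?thesis unfolding g_def using Psi(2)[of x] by (simp add: D_def u_def)
          qed
          moreover have "exp (- b * u\<^sup>2) \<le> ?G"
          proof -
            have "2 * pi\<^sup>2 * x\<^sup>2 * (\<Sum>h\<in>Hs n. (real h)\<^sup>2 * digit_var d r h) \<le> 2 * pi\<^sup>2 * x\<^sup>2 * (real d ^ 3 * CM * (1 / r)\<^sup>2 * L ^ (m - 1))"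
              using V by (intro mult_left_mono) auto
            also have "\<dots> = b * u\<^sup>2" unfolding u_def power_mult_distrib sq b_def by (simp add: mult_ac)
            finally show ?thesis by simp
          qed
          moreover have "0 < exp (- b * u\<^sup>2)" by simp
          moreover have "c \<le> exp (- b * u\<^sup>2)" if "\<bar>u\<bar> \<le> 1"
          proof -
            have "u\<^sup>2 \<le> 1" using that by (simp add: abs_square_le_1)
            hence "b * u\<^sup>2 \<le> b * 1" using b0 by (intro mult_left_mono) auto
            thus ?thesis by (simp add: c_def)
          qed
          ultimately show ?thesis by linarith
        next
          case False
          have "- norm (digit_char d r (Hs n) x) \<le> f x"
            unfolding f_def using abs_Re_le_cmod[of "cis (- (2 * pi * x * real n)) * digit_char d r (Hs n) x"]
            by (simp add: norm_mult)
          moreover have "norm (digit_char d r (Hs n) x) \<le> C / D\<^sup>2 + \<Psi> x" using Psi(4)[OF x] by (simp add: D_def u_def)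
          moreover have "C / D\<^sup>2 \<le> Q / D"
          proof -
            have "M\<^sup>2 \<le> u\<^sup>2" using False M1 by (simp add: abs_le_square_iff[symmetric])
            hence "1 + M\<^sup>2 \<le> D" by (simp add: D_def)
            hence "C / D \<le> C / (1 + M\<^sup>2)" using C M0 by (intro divide_left_mono) auto
            also have "\<dots> \<le> Q" unfolding Q_def using R0 e00 by simp
            finally have "C / D / D \<le> Q / D" using D by (intro divide_right_mono) auto
            thus ?thesis by (simp add: power2_eq_square)
          qed
          ultimately have "0 \<le> f x + g x" unfolding g_def by (simp add: D_def u_def)
          thus ?thesis using False M1 by auto
        qed
        thus "0 \<le> f x + g x" "\<bar>\<sigma> * x\<bar> \<le> 1 \<Longrightarrow> c \<le> f x + g x" by (auto simp: u_def)
      qed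
      have int: "(\<lambda>x. f x + g x) integrable_on {a..b}" "f integrable_on {a..b}" "g integrable_on {a..b}" for a b :: real
        by (intro integrable_continuous_interval continuous_intros cf cg)+
      have "2 * c / \<sigma> = integral {- (1 / \<sigma>)..1 / \<sigma>} (\<lambda>x. c)" using s2 by simp
      also have "\<dots> \<le> integral {- (1 / \<sigma>)..1 / \<sigma>} (\<lambda>x. f x + g x)"
      proof (rule integral_le)
        fix x assume x: "x \<in> {- (1 / \<sigma>)..1 / \<sigma>}"
        have s12: "1 / \<sigma> \<le> 1 / 2" using s2 by (intro divide_left_mono) auto
        have "\<bar>x\<bar> \<le> 1 / \<sigma>" using x by auto
        hence "\<sigma> * \<bar>x\<bar> \<le> \<sigma> * (1 / \<sigma>)" using sb'(4) by (intro mult_left_mono) auto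
        hence "\<bar>\<sigma> * x\<bar> \<le> 1" using sb'(4) by (simp add: abs_mult)
        thus "c \<le> f x + g x" using x s12 by (intro fg) auto
      qed (use int in auto)
      also have "\<dots> \<le> integral {-1/2..1/2} (\<lambda>x. f x + g x)"
      proof (rule integral_subset_le)
        have "1 / \<sigma> \<le> 1 / 2" using s2 by (intro divide_left_mono) auto
        thus "{- (1 / \<sigma>)..1 / \<sigma>} \<subseteq> {-1/2..1/2}" by auto
      qed (use int fg in auto)
      also have "\<dots> = integral {-1/2..1/2} f + integral {-1/2..1/2} g"
        using int by (intro integral_add)
      also have "integral {-1/2..1/2} g \<le> Q * (pi / \<sigma>) + real n powr (-1 - \<eta>)"
      proof -
        have "integral {-1/2..1/2} g = integral {-1/2..1/2} (\<lambda>x. Q * (1 / (1 + (\<sigma> * x)\<^sup>2))) + integral {-1/2..1/2} \<Psi>"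
          unfolding g_def using cden[of "{-1/2..1/2}" Q] cPsi
          by (subst integral_add[symmetric]) (auto intro!: integrable_continuous_interval)
        also have "integral {-1/2..1/2} (\<lambda>x. Q * (1 / (1 + (\<sigma> * x)\<^sup>2))) = Q * integral {-1/2..1/2} (\<lambda>x. 1 / (1 + (\<sigma> * x)\<^sup>2))"
          by (rule integral_mult_right)
        also have "\<dots> \<le> Q * (pi / \<sigma>)" using Q0 integral_inverse_square_le[OF sb'(4)] by (intro mult_left_mono) auto
        finally show ?thesis using Psi(3) by linarith
      qed
      finally have low: "2 * c / \<sigma> \<le> integral {-1/2..1/2} f + (Q * (pi / \<sigma>) + real n powr (-1 - \<eta>))" by simp
      have "integral {-1/2..1/2} f = digit_exp d r (Hs n) (\<lambda>a. of_bool (digit_sum (Hs n) a = n))"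
      proof -
        have "integral {-1/2..1/2} (Re \<circ> (\<lambda>x. cis (- (2 * pi * x * real n)) * digit_char d r (Hs n) x)) =
           Re (integral {-1/2..1/2} (\<lambda>x. cis (- (2 * pi * x * real n)) * digit_char d r (Hs n) x))"
          by (rule integral_linear) (auto intro!: integrable_continuous_interval continuous_intros bounded_linear_Re)
        thus ?thesis unfolding digit_exp_at_eq_integral_digit_char[OF finite_Hs, symmetric] f_def by (simp add: o_def)
      qed
      moreover have "Q * pi \<le> c / 2"
      proof -
        have "C / (1 + M\<^sup>2) * pi \<le> c / 4"
        proof -
          have "M * 1 \<le> M * M" using M1 by (intro mult_left_mono) auto
          hence "4 * C * pi / c \<le> 1 + M\<^sup>2" unfolding power2_eq_square using M_def by linarith
          hence "4 * C * pi \<le> c * (1 + M\<^sup>2)" using c by (simp add: field_simps)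
          thus ?thesis using M0 by (simp add: field_simps)
        qed
        moreover have "R * e * pi \<le> c / 4"
        proof -
          have "L ^ 1 \<le> L ^ (m - 1)" using L4 m2 by (intro power_increasing) auto
          hence "(4 * R * pi / c)\<^sup>2 \<le> L ^ (m - 1)" using e1 unfolding L_def[symmetric] by (auto intro: order.trans)
          hence "sqrt ((4 * R * pi / c)\<^sup>2) \<le> sqrt (L ^ (m - 1))" by (rule real_sqrt_le_mono)
          hence "4 * R * pi / c \<le> sqrt (L ^ (m - 1))" using R0 c by simp
          hence "4 * R * pi \<le> c * sqrt (L ^ (m - 1))" using c by (simp add: field_simps)
          thus ?thesis using L1 unfolding e_def by (simp add: field_simps)
        qed
        moreover have "Q * pi = R * e * pi + C / (1 + M\<^sup>2) * pi" unfolding Q_def by (rule distrib_right)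
        ultimately show ?thesis by linarith
      qed
      hence "Q * (pi / \<sigma>) \<le> c / 2 / \<sigma>" using sb'(4) by (simp add: field_simps)
      moreover have "real n powr (-1 - \<eta>) \<le> c / 2 / \<sigma>"
      proof -
        have "real n powr (-1 - \<eta>) * \<sigma> \<le> real n powr (-1 - \<eta>) * (real n * L ^ m)" using sb' by (intro mult_left_mono) auto
        also have "\<dots> = real n powr (- \<eta>) * L ^ m" using n0 by (simp add: powr_diff powr_minus field_simps)
        also have "\<dots> \<le> real n powr (- \<eta>) * (c / 2 * real n powr \<eta>)"
          using e2 c unfolding L_def[symmetric] by (intro mult_left_mono) (auto simp: field_simps)
        also have "\<dots> = c / 2" using n0 by (simp add: powr_minus field_simps)
        finally show ?thesis using sb'(4) by (simp add: field_simps)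
      qed
      moreover have "2 * c / \<sigma> - c / 2 / \<sigma> - c / 2 / \<sigma> = c / \<sigma>" by (simp add: field_simps)
      ultimately show "c / scale r n \<le> digit_exp d r (Hs n) (\<lambda>a. of_bool (digit_sum (Hs n) a = n))"
        using low unfolding \<sigma>_def[symmetric] by linarith
    qed
  qed
qed

text \<open>With L = log n, a digit sum over small h is O(L^m n / L^(6 m)), while
  \<open>scale\<close> is at least n / L^(m-1) up to a constant. Their ratio has to be below L^(-3
  m), which needs an exponent larger than 5 m - 1.\<close>

definition small_bound :: "nat \<Rightarrow> real" where "small_bound n = real n / ln (real n) ^ (6 * m)"

definition CH :: real where "CH = kap * (1 + Om) ^ m"

lemma CH_pos: "CH > 0" using kap_pos Om_nonneg by (auto simp: CH_def intro!: mult_pos_pos add_pos_nonneg)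

lemma card_Hs: assumes "n \<ge> 1" shows "card (Hs n) = mb_cnt m p (ln (real n))"
  unfolding mb_cnt_def Hs_def using assms by (intro arg_cong[where f = card]) auto

lemma card_Hs_le: assumes "n \<ge> 1" "ln (real n) \<ge> 1" shows "real (card (Hs n)) \<le> CH * ln (real n) ^ m"
proof -
  have "real (card (Hs n)) \<le> kap * (ln (real n) + Om) ^ m"
    unfolding card_Hs[OF assms(1)] using assms by (intro cnt_le) auto
  also have "\<dots> \<le> kap * ((1 + Om) * ln (real n)) ^ m"
  proof (intro mult_left_mono power_mono)
    have "Om * 1 \<le> Om * ln (real n)" using assms Om_nonneg by (intro mult_left_mono) auto
    thus "ln (real n) + Om \<le> (1 + Om) * ln (real n)" by (simp add: algebra_simps)
  qed (use assms Om_nonneg kap_pos in auto)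
  finally show ?thesis by (simp add: CH_def power_mult_distrib mult_ac)
qed

end

subsection \<open>Decoupling of small digits\<close>

lemma digit_exp_nonzeros:
  assumes "finite A" "d \<ge> 1"
  shows "digit_exp d r A (\<lambda>a. real (nonzeros A a)) = (\<Sum>h\<in>A. 1 - digit_wt d r h 0)"
    and "digit_exp d r A (\<lambda>a. (real (nonzeros A a) - (\<Sum>h\<in>A. 1 - digit_wt d r h 0))\<^sup>2) = (\<Sum>h\<in>A. (1 - digit_wt d r h 0) * digit_wt d r h 0)"
proof -
  have one: "digit_exp d r {h} (\<lambda>a. of_bool (a h \<noteq> 0) :: real) = 1 - digit_wt d r h 0" for h
  proof -
    have "digit_exp d r {h} (\<lambda>a. of_bool (a h \<noteq> 0) :: real) = (\<Sum>k<d. digit_wt d r h k * of_bool (k \<noteq> 0))" by (simp add: digit_exp_singleton)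
    also have "\<dots> = (\<Sum>k<d. digit_wt d r h k - (if k = 0 then digit_wt d r h 0 else 0))" by (intro sum.cong) auto
    also have "\<dots> = 1 - digit_wt d r h 0" using assms(2) sum_digit_wt[OF assms(2), of r h] by (simp add: sum_subtractf)
    finally show ?thesis .
  qed
  have eq: "real (nonzeros A a) - (\<Sum>h\<in>A. 1 - digit_wt d r h 0) = (\<Sum>h\<in>A. of_bool (a h \<noteq> 0) - (1 - digit_wt d r h 0))" for A a
    by (simp add: nonzeros_def sum_subtractf)
  define z where "z = (\<lambda>h (a::nat \<Rightarrow> nat). of_bool (a h \<noteq> 0) - (1 - digit_wt d r h 0) :: real)"
  have depz: "depends_on {h} (z h)" for h by (rule depends_onI) (simp add: z_def)
  have depZ: "depends_on B (\<lambda>a. \<Sum>h\<in>B. z h a)" for B by (rule depends_onI) (auto simp: z_def intro!: sum.cong)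
  have z1: "digit_exp d r {h} (z h) = 0" for h
    unfolding z_def digit_exp_diff using one[of h] assms by (simp add: digit_exp_const)
  have z2: "digit_exp d r {h} (\<lambda>a. (z h a)\<^sup>2) = (1 - digit_wt d r h 0) * digit_wt d r h 0" for h
  proof -
    have "(z h a)\<^sup>2 = of_bool (a h \<noteq> 0) * (1 - 2 * (1 - digit_wt d r h 0)) + (1 - digit_wt d r h 0)\<^sup>2" for a
      by (cases "a h = 0") (simp_all add: z_def power2_eq_square algebra_simps)
    hence "digit_exp d r {h} (\<lambda>a. (z h a)\<^sup>2) = digit_exp d r {h} (\<lambda>a. of_bool (a h \<noteq> 0) * (1 - 2 * (1 - digit_wt d r h 0)) + (1 - digit_wt d r h 0)\<^sup>2)"
      by simp
    also have "\<dots> = (1 - digit_wt d r h 0) * (1 - 2 * (1 - digit_wt d r h 0)) + (1 - digit_wt d r h 0)\<^sup>2"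
      unfolding digit_exp_add digit_exp_multc one using assms by (simp add: digit_exp_const)
    finally show ?thesis by (simp add: power2_eq_square algebra_simps)
  qed
  have Z1: "digit_exp d r A (\<lambda>a. \<Sum>h\<in>A. z h a) = 0"
  proof -
    have "digit_exp d r A (z h) = 0" if "h \<in> A" for h
      using digit_exp_superset[OF assms(1) _ depz assms(2), of h] that z1 by simp
    thus ?thesis unfolding digit_exp_sum by simp
  qed
  show "digit_exp d r A (\<lambda>a. real (nonzeros A a)) = (\<Sum>h\<in>A. 1 - digit_wt d r h 0)"
  proof -
    have "digit_exp d r A (\<lambda>a. real (nonzeros A a) - (\<Sum>h\<in>A. 1 - digit_wt d r h 0)) = 0" unfolding eq using Z1 by (simp add: z_def)
    thus ?thesis unfolding digit_exp_diff using assms by (simp add: digit_exp_const)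
  qed
  have "digit_exp d r B (\<lambda>a. (\<Sum>h\<in>B. z h a)\<^sup>2) = (\<Sum>h\<in>B. (1 - digit_wt d r h 0) * digit_wt d r h 0)" if "finite B" for B
    using that
  proof induction
    case (insert h B)
    have dis: "{h} \<inter> B = {}" using insert by auto
    have ZB: "digit_exp d r B (\<lambda>a. \<Sum>h\<in>B. z h a) = 0"
    proof -
      have "digit_exp d r B (z h) = 0" if "h \<in> B" for h
        using digit_exp_superset[OF insert(1) _ depz assms(2), of h] that z1 by simp
      thus ?thesis unfolding digit_exp_sum by simp
    qed
    have "digit_exp d r ({h} \<union> B) (\<lambda>a. (\<Sum>h\<in>insert h B. z h a)\<^sup>2) =
       digit_exp d r ({h} \<union> B) (\<lambda>a. (z h a)\<^sup>2 + 2 * (z h a * (\<Sum>h\<in>B. z h a)) + (\<Sum>h\<in>B. z h a)\<^sup>2)"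
      using insert by (intro digit_exp_cong) (simp add: power2_sum)
    also have "\<dots> = digit_exp d r ({h} \<union> B) (\<lambda>a. (z h a)\<^sup>2) + 2 * digit_exp d r ({h} \<union> B) (\<lambda>a. z h a * (\<Sum>h\<in>B. z h a)) + digit_exp d r ({h} \<union> B) (\<lambda>a. (\<Sum>h\<in>B. z h a)\<^sup>2)"
      by (simp add: digit_exp_add digit_exp_cmult)
    also have "digit_exp d r ({h} \<union> B) (\<lambda>a. z h a * (\<Sum>h\<in>B. z h a)) = digit_exp d r {h} (z h) * digit_exp d r B (\<lambda>a. \<Sum>h\<in>B. z h a)"
      using insert dis by (intro digit_exp_mult depz depZ) auto
    also have "digit_exp d r ({h} \<union> B) (\<lambda>a. (z h a)\<^sup>2) = digit_exp d r {h} (\<lambda>a. (z h a)\<^sup>2)"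
      using insert assms by (intro digit_exp_superset depends_comp[OF depz]) auto
    also have "digit_exp d r ({h} \<union> B) (\<lambda>a. (\<Sum>h\<in>B. z h a)\<^sup>2) = digit_exp d r B (\<lambda>a. (\<Sum>h\<in>B. z h a)\<^sup>2)"
      using insert assms by (intro digit_exp_superset depends_comp[OF depZ]) auto
    finally show ?case using insert z1 z2 by simp
  qed (simp add: digit_exp_empty)
  thus "digit_exp d r A (\<lambda>a. (real (nonzeros A a) - (\<Sum>h\<in>A. 1 - digit_wt d r h 0))\<^sup>2) = (\<Sum>h\<in>A. (1 - digit_wt d r h 0) * digit_wt d r h 0)"
    unfolding eq using assms by (simp add: z_def)
qed

lemma digit_wt_le_1: "d \<ge> 1 \<Longrightarrow> digit_wt d r h 0 \<le> 1"
  using digit_wt_le[of d r h 0] by simp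

text \<open>\<open>norm_char_minus_gauss_le\<close> with D = 1 for the indicator of each non-zero
  digit, the products being compared factor by factor.\<close>

lemma norm_digit_exp_nonzeros_gauss:
  fixes \<tau> :: real
  assumes A: "finite A" and d: "d \<ge> 1"
  shows "norm (digit_exp d r A (\<lambda>a. cis (\<tau> * (real (nonzeros A a) - (\<Sum>h\<in>A. 1 - digit_wt d r h 0)))) -
      complex_of_real (exp (- (\<tau>\<^sup>2 * (\<Sum>h\<in>A. (1 - digit_wt d r h 0) * digit_wt d r h 0) / 2)))) \<le> \<bar>\<tau>\<bar> ^ 3 * real (card A)"
proof -
  let ?s = "\<lambda>h. 1 - digit_wt d r h 0"
  let ?v = "\<lambda>h. (1 - digit_wt d r h 0) * digit_wt d r h 0"
  let ?u = "\<lambda>h. \<Sum>k<d. digit_wt d r h k *\<^sub>R cis (\<tau> * (of_bool (k \<noteq> 0) - ?s h))"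
  let ?g = "\<lambda>h. complex_of_real (exp (- (\<tau>\<^sup>2 * ?v h / 2)))"
  have cis_sum: "cis (\<Sum>h\<in>A. f h) = (\<Prod>h\<in>A. cis (f h))" for f :: "nat \<Rightarrow> real"
    using A by induction (auto simp: cis_mult[symmetric])
  have "cis (\<tau> * (real (nonzeros A a) - (\<Sum>h\<in>A. ?s h))) = (\<Prod>h\<in>A. cis (\<tau> * (of_bool (a h \<noteq> 0) - ?s h)))" for a
    unfolding cis_sum[symmetric]
    by (intro arg_cong[where f = cis]) (simp add: nonzeros_def sum_subtractf[symmetric] sum_distrib_left)
  hence 1: "digit_exp d r A (\<lambda>a. cis (\<tau> * (real (nonzeros A a) - (\<Sum>h\<in>A. ?s h)))) = (\<Prod>h\<in>A. ?u h)"
    using digit_exp_prod[OF A, of d r "\<lambda>h k. cis (\<tau> * (of_bool (k \<noteq> 0) - ?s h))"] by simp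
  have 2: "complex_of_real (exp (- (\<tau>\<^sup>2 * (\<Sum>h\<in>A. ?v h) / 2))) = (\<Prod>h\<in>A. ?g h)"
    unfolding of_real_prod[symmetric] exp_sum[OF A, symmetric]
    by (intro arg_cong[where f = "\<lambda>x. complex_of_real (exp x)"]) (simp add: sum_negf sum_distrib_left sum_divide_distrib)
  have v0: "0 \<le> ?v h" "?v h \<le> 1" for h using digit_wt_le_1[OF d, of r h] digit_wt_nonneg[of d r h 0] by (auto intro!: mult_nonneg_nonneg mult_le_one)
  have "norm ((\<Prod>h\<in>A. ?u h) - (\<Prod>h\<in>A. ?g h)) \<le> (\<Sum>h\<in>A. norm (?u h - ?g h))"
  proof (rule norm_prod_diff)
    fix h
    have "norm (?u h) \<le> (\<Sum>k<d. digit_wt d r h k)" by (rule sum_norm_le) (simp add: digit_wt_nonneg)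
    thus "norm (?u h) \<le> 1" using sum_digit_wt[OF d] by simp
    show "norm (?g h) \<le> 1" using v0(1)[of h] by simp
  qed
  also have "\<dots> \<le> (\<Sum>h\<in>A. \<bar>\<tau>\<bar> ^ 3)"
  proof (rule sum_mono)
    fix h
    have s: "(\<Sum>k<d. digit_wt d r h k * of_bool (k \<noteq> 0)) = ?s h"
    proof -
      have "(\<Sum>k<d. digit_wt d r h k * of_bool (k \<noteq> 0)) = (\<Sum>k<d. digit_wt d r h k - (if k = 0 then digit_wt d r h 0 else 0))" by (intro sum.cong) auto
      thus ?thesis using d sum_digit_wt[OF d, of r h] by (simp add: sum_subtractf)
    qed
    have nz_var: "(\<Sum>k<d. digit_wt d r h k * (of_bool (k \<noteq> 0) - ?s h)\<^sup>2) = ?v h"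
    proof -
      have "(\<Sum>k<d. digit_wt d r h k * (of_bool (k \<noteq> 0) - ?s h)\<^sup>2) =
        (\<Sum>k<d. digit_wt d r h k * of_bool (k \<noteq> 0) * (1 - 2 * ?s h) + digit_wt d r h k * (?s h)\<^sup>2)"
        by (intro sum.cong refl) (auto simp: power2_eq_square algebra_simps)
      also have "\<dots> = ?s h * (1 - 2 * ?s h) + 1 * (?s h)\<^sup>2"
        unfolding sum.distrib sum_distrib_right[symmetric] s sum_digit_wt[OF d] ..
      finally show ?thesis by (simp add: power2_eq_square algebra_simps)
    qed
    have "norm (?u h - ?g h) \<le> 1 * \<bar>\<tau>\<bar> ^ 3 * ?v h"
    proof (rule norm_char_minus_gauss_le[where I = "{..<d}" and q = "digit_wt d r h" and y = "\<lambda>k. of_bool (k \<noteq> 0)"])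
      fix k assume "k \<in> {..<d}"
      show "\<bar>of_bool (k \<noteq> 0) - ?s h\<bar> \<le> 1" using digit_wt_le_1[OF d, of r h] digit_wt_nonneg[of d r h 0] by auto
    qed (use sum_digit_wt[OF d] s nz_var in \<open>auto simp: digit_wt_nonneg\<close>)
    also have "\<dots> \<le> 1 * \<bar>\<tau>\<bar> ^ 3 * 1" using v0[of h] by (intro mult_left_mono) auto
    finally show "norm (?u h - ?g h) \<le> \<bar>\<tau>\<bar> ^ 3" by simp
  qed
  also have "\<dots> = \<bar>\<tau>\<bar> ^ 3 * real (card A)" by simp
  finally show ?thesis unfolding 1 2 .
qed

section \<open>Uniform representations as a conditioned product measure\<close>

context multibase
begin

abbreviation reps :: "nat \<Rightarrow> (nat \<Rightarrow> nat) set" where "reps n \<equiv> mb_reps d m p n"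

definition rep_exp :: "nat \<Rightarrow> ((nat \<Rightarrow> nat) \<Rightarrow> 'a::real_normed_field) \<Rightarrow> 'a" where
  "rep_exp n F = (\<Sum>a\<in>reps n. F a) / of_nat (card (reps n))"

lemma reps_eq: "reps n = {a \<in> cfgs d (Hs n). digit_sum (Hs n) a = n}"
proof (intro set_eqI iffI)
  fix a assume a: "a \<in> reps n"
  hence a': "\<And>h. a h < d" "\<And>h. h \<notin> S \<Longrightarrow> a h = 0" "finite {h. a h \<noteq> 0}" "(\<Sum>h\<in>{h. a h \<noteq> 0}. a h * h) = n"
    by (auto simp: mb_reps_def)
  have sub: "{h. a h \<noteq> 0} \<subseteq> Hs n"
  proof safe
    fix h assume h: "a h > 0"
    have "h \<in> S" using a'(2)[of h] h by auto
    have "a h * h \<le> (\<Sum>h\<in>{h. a h \<noteq> 0}. a h * h)" using a'(3) h by (intro member_le_sum) auto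
    hence "a h * h \<le> n" using a'(4) by simp
    moreover have "1 * h \<le> a h * h" using h by (intro mult_right_mono) auto
    ultimately have "h \<le> n" by linarith
    with \<open>h \<in> S\<close> show "h \<in> Hs n" by (simp add: Hs_def)
  qed
  have "digit_sum (Hs n) a = (\<Sum>h\<in>{h. a h \<noteq> 0}. a h * h)"
    unfolding digit_sum_def using sub finite_Hs by (intro sum.mono_neutral_right) auto
  thus "a \<in> {a \<in> cfgs d (Hs n). digit_sum (Hs n) a = n}" using a'(1,4) sub by (auto simp: PiE_dflt_def)
next
  fix a assume a: "a \<in> {a \<in> cfgs d (Hs n). digit_sum (Hs n) a = n}"
  have sub: "{h. a h \<noteq> 0} \<subseteq> Hs n" using a by (auto simp: PiE_dflt_def) (metis less_irrefl)
  have "digit_sum (Hs n) a = (\<Sum>h\<in>{h. a h \<noteq> 0}. a h * h)"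
    unfolding digit_sum_def using sub finite_Hs by (intro sum.mono_neutral_right) auto
  moreover have "a h < d" for h using a d2 by (cases "h \<in> Hs n") (auto simp: PiE_dflt_def)
  moreover have "a h = 0" if "h \<notin> S" for h using a that by (auto simp: PiE_dflt_def Hs_def)
  moreover have "finite {h. a h \<noteq> 0}" using sub finite_Hs finite_subset by blast
  ultimately show "a \<in> reps n" using a by (auto simp: mb_reps_def)
qed

lemma finite_reps: "finite (reps n)"
  unfolding reps_eq using finite_cfgs[OF finite_Hs] by auto

text \<open>The weight of a configuration is exp (- r s), with s its digit sum, times a factor
  independent of the configuration, so fixing the digit sum leaves equal weights.\<close>

lemma digit_exp_at_reps:
  fixes F :: "(nat \<Rightarrow> nat) \<Rightarrow> 'a::real_normed_field"
  shows "digit_exp d r (Hs n) (\<lambda>a. of_bool (digit_sum (Hs n) a = n) * F a) =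
    of_real (exp (- r * real n) * (\<Prod>h\<in>Hs n. digit_wt d r h 0)) * (\<Sum>a\<in>reps n. F a)"
proof -
  have "digit_exp d r (Hs n) (\<lambda>a. of_bool (digit_sum (Hs n) a = n) * F a) =
    (\<Sum>a\<in>reps n. (\<Prod>h\<in>Hs n. digit_wt d r h (a h)) *\<^sub>R F a)"
    unfolding digit_exp_def reps_eq by (intro sum.mono_neutral_cong_right finite_cfgs finite_Hs) auto
  also have "\<dots> = (\<Sum>a\<in>reps n. (exp (- r * real n) * (\<Prod>h\<in>Hs n. digit_wt d r h 0)) *\<^sub>R F a)"
  proof (intro sum.cong refl arg_cong[where f = "\<lambda>x. x *\<^sub>R _"])
    fix a assume "a \<in> reps n"
    hence n: "digit_sum (Hs n) a = n" by (simp add: reps_eq)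
    have "(\<Prod>h\<in>Hs n. digit_wt d r h (a h)) = (\<Prod>h\<in>Hs n. digit_wt d r h 0 * exp (- r * real (a h) * real h))"
      by (intro prod.cong refl digit_wt_eq)
    also have "\<dots> = (\<Prod>h\<in>Hs n. digit_wt d r h 0) * exp (\<Sum>h\<in>Hs n. - r * real (a h) * real h)"
      by (simp only: prod.distrib exp_sum[OF finite_Hs])
    also have "(\<Sum>h\<in>Hs n. - r * real (a h) * real h) = - r * real (digit_sum (Hs n) a)"
      by (simp add: digit_sum_def sum_distrib_left mult.assoc)
    finally show "(\<Prod>h\<in>Hs n. digit_wt d r h (a h)) = exp (- r * real n) * (\<Prod>h\<in>Hs n. digit_wt d r h 0)" using n by simp
  qed
  also have "\<dots> = of_real (exp (- r * real n) * (\<Prod>h\<in>Hs n. digit_wt d r h 0)) * (\<Sum>a\<in>reps n. F a)"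
    by (simp add: scaleR_conv_of_real sum_distrib_left)
  finally show ?thesis .
qed

lemma digit_exp_at_eq_rep_exp:
  fixes F :: "(nat \<Rightarrow> nat) \<Rightarrow> 'a::real_normed_field"
  assumes "reps n \<noteq> {}"
  shows "digit_exp d r (Hs n) (\<lambda>a. of_bool (digit_sum (Hs n) a = n) * F a) =
    of_real (digit_exp d r (Hs n) (\<lambda>a. of_bool (digit_sum (Hs n) a = n))) * rep_exp n F"
proof -
  have c0: "card (reps n) \<noteq> 0" using assms finite_reps by simp
  define w where "w = exp (- r * real n) * (\<Prod>h\<in>Hs n. digit_wt d r h 0)"
  have "digit_exp d r (Hs n) (\<lambda>a. of_bool (digit_sum (Hs n) a = n)) = w * real (card (reps n))"
    using digit_exp_at_reps[of r n "\<lambda>_. 1::real"] by (simp add: w_def)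
  thus ?thesis unfolding digit_exp_at_reps rep_exp_def w_def[symmetric] using c0 by simp
qed

text \<open>What the conditioned law must satisfy. The first two properties leave one colour class
  free for smoothing: small digits separate from other digits, and nonnegative expectations grow by
  at most the factor C. The third makes a small digit vanish with model probability close to 1/d.
  The exponent 3 m keeps errors bounded after multiplication by two centred counts, each O((log
  n)^m).\<close>

definition decoupled :: "nat \<Rightarrow> nat \<Rightarrow> real \<Rightarrow> real \<Rightarrow> bool" where
  "decoupled K n C r \<longleftrightarrow> r > 0 \<and> reps n \<noteq> {} \<and>
     (\<forall>U V F G B D c. c < K \<longrightarrow> U \<subseteq> Hs n \<longrightarrow> V \<subseteq> Hs n \<longrightarrow> U \<inter> V = {} \<longrightarrow> (U \<union> V) \<inter> cls K c n = {} \<longrightarrow>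
       (\<forall>h\<in>U. real h \<le> small_bound n) \<longrightarrow> depends_on U F \<longrightarrow> depends_on V G \<longrightarrow>
       (\<forall>a. norm (F a :: complex) \<le> B) \<longrightarrow> (\<forall>a. norm (G a :: complex) \<le> D) \<longrightarrow>
       norm (rep_exp n (\<lambda>a. F a * G a) - digit_exp d r U F * rep_exp n G) \<le> B * D / ln (real n) ^ (3 * m)) \<and>
     (\<forall>V F c. c < K \<longrightarrow> V \<subseteq> Hs n \<longrightarrow> V \<inter> cls K c n = {} \<longrightarrow> depends_on V F \<longrightarrow> (\<forall>a. (0::real) \<le> F a) \<longrightarrow>
       rep_exp n F \<le> C * digit_exp d r V F) \<and>
     (\<forall>h. real h \<le> small_bound n \<longrightarrow> \<bar>digit_wt d r h 0 - 1 / real d\<bar> \<le> 1 / ln (real n) ^ (3 * m))"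

lemma goodI:
  assumes r: "r > 0" and Pn: "Pn = digit_exp d r (Hs n) (\<lambda>a. of_bool (digit_sum (Hs n) a = n) :: real)" and P0: "Pn > 0"
    and L: "L = ln (real n)"
    and decouple: "\<And>U V F G B D c. c < K \<Longrightarrow> U \<subseteq> Hs n \<Longrightarrow> V \<subseteq> Hs n \<Longrightarrow> U \<inter> V = {} \<Longrightarrow>
       (U \<union> V) \<inter> cls K c n = {} \<Longrightarrow> \<forall>h\<in>U. real h \<le> small_bound n \<Longrightarrow> depends_on U F \<Longrightarrow> depends_on V G \<Longrightarrow>
       \<forall>a. norm (F a :: complex) \<le> B \<Longrightarrow> \<forall>a. norm (G a :: complex) \<le> D \<Longrightarrow>
       norm (digit_exp d r (Hs n) (\<lambda>a. of_bool (digit_sum (Hs n) a = n) * (F a * G a)) -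
           digit_exp d r U F * digit_exp d r (Hs n) (\<lambda>a. of_bool (digit_sum (Hs n) a = n) * G a))
       \<le> B * D * (Pn / L ^ (3 * m))"
    and le: "\<And>V F c. c < K \<Longrightarrow> V \<subseteq> Hs n \<Longrightarrow> V \<inter> cls K c n = {} \<Longrightarrow> depends_on V F \<Longrightarrow> \<forall>a. (0::real) \<le> F a \<Longrightarrow>
       digit_exp d r (Hs n) (\<lambda>a. of_bool (digit_sum (Hs n) a = n) * F a) \<le> C * Pn * digit_exp d r V F"
    and w: "\<And>h. real h \<le> small_bound n \<Longrightarrow> \<bar>digit_wt d r h 0 - 1 / real d\<bar> \<le> 1 / L ^ (3 * m)"
  shows "decoupled K n C r"
proof -
  have ne: "reps n \<noteq> {}"
  proof
    assume "reps n = {}"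
    hence "digit_exp d r (Hs n) (\<lambda>a. of_bool (digit_sum (Hs n) a = n) * (1::real)) = 0" unfolding digit_exp_at_reps by simp
    thus False using P0 unfolding Pn by simp
  qed
  show ?thesis unfolding decoupled_def L[symmetric]
  proof (intro conjI allI impI)
    fix U V :: "nat set" and F G :: "(nat \<Rightarrow> nat) \<Rightarrow> complex" and B D :: real and c :: nat
    assume h: "c < K" "U \<subseteq> Hs n" "V \<subseteq> Hs n" "U \<inter> V = {}" "(U \<union> V) \<inter> cls K c n = {}"
        "\<forall>h\<in>U. real h \<le> small_bound n" "depends_on U F" "depends_on V G" "\<forall>a. norm (F a) \<le> B" "\<forall>a. norm (G a) \<le> D"
    have "norm (of_real Pn * rep_exp n (\<lambda>a. F a * G a) - digit_exp d r U F * (of_real Pn * rep_exp n G)) \<le> B * D * (Pn / L ^ (3 * m))"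
      using decouple[OF h] unfolding digit_exp_at_eq_rep_exp[OF ne] Pn[symmetric] .
    also have "of_real Pn * rep_exp n (\<lambda>a. F a * G a) - digit_exp d r U F * (of_real Pn * rep_exp n G) =
       of_real Pn * (rep_exp n (\<lambda>a. F a * G a) - digit_exp d r U F * rep_exp n G)" by (simp add: algebra_simps)
    finally have "Pn * norm (rep_exp n (\<lambda>a. F a * G a) - digit_exp d r U F * rep_exp n G) \<le> Pn * (B * D / L ^ (3 * m))"
      using P0 by (simp add: norm_mult mult_ac)
    thus "norm (rep_exp n (\<lambda>a. F a * G a) - digit_exp d r U F * rep_exp n G) \<le> B * D / L ^ (3 * m)"
      using P0 by (subst (asm) mult_le_cancel_left_pos)
  next
    fix V :: "nat set" and F :: "(nat \<Rightarrow> nat) \<Rightarrow> real" and c :: nat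
    assume h: "c < K" "V \<subseteq> Hs n" "V \<inter> cls K c n = {}" "depends_on V F" "\<forall>a. 0 \<le> F a"
    have "of_real Pn * rep_exp n F \<le> C * Pn * digit_exp d r V F"
      using le[OF h] unfolding digit_exp_at_eq_rep_exp[OF ne] Pn[symmetric] .
    hence "Pn * rep_exp n F \<le> Pn * (C * digit_exp d r V F)" by (simp add: mult_ac)
    thus "rep_exp n F \<le> C * digit_exp d r V F" using P0 by (subst (asm) mult_le_cancel_left_pos)
  qed (use r ne w in auto)
qed

text \<open>In the first two properties \<open>class_decay\<close> for the free class bounds the
  inversion integrals from above and \<open>local_lower\<close> bounds the probability of digit sum
  n from below. The third holds because r h is tiny for small h.\<close>

lemma eventually_decoupled:
  assumes K: "K \<ge> 1"
  shows "\<exists>C>0. \<forall>\<^sub>F n in sequentially. \<exists>r. decoupled K n C r"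
proof -
  obtain C0 where C0: "C0 > 0" and ev0: "\<forall>\<^sub>F n in sequentially. \<exists>r. 1 / real n \<le> r \<and> r \<le> 1 \<and>
     (\<Sum>h\<in>Hs n. real h * digit_mean d r h) = real n \<and> real n \<le> C0 * (1 / r) * ln (real n) ^ (m - 1)"
    using saddle by blast
  obtain c where c: "c > 0" and ev1: "\<forall>\<^sub>F n in sequentially. \<forall>r. 1 / real n \<le> r \<longrightarrow> r \<le> 1 \<longrightarrow>
     (\<Sum>h\<in>Hs n. real h * digit_mean d r h) = real n \<longrightarrow> real n \<le> C0 * (1 / r) * ln (real n) ^ (m - 1) \<longrightarrow>
     c / scale r n \<le> digit_exp d r (Hs n) (\<lambda>a. of_bool (digit_sum (Hs n) a = n))"
    using local_lower[OF C0] by blast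
  obtain C \<eta> where C: "C > 0" "\<eta> > 0" and ev2: "\<forall>\<^sub>F n in sequentially. \<forall>c r. c < K \<longrightarrow> 1 / real n \<le> r \<longrightarrow> r \<le> 1 \<longrightarrow>
      real n \<le> C0 * (1 / r) * ln (real n) ^ (m - 1) \<longrightarrow>
      (\<exists>\<Psi>. continuous_on UNIV \<Psi> \<and> (\<forall>x. 0 \<le> \<Psi> x) \<and> integral {-1/2..1/2} \<Psi> \<le> real n powr (-1 - \<eta>) \<and>
        (\<forall>x\<in>{-1/2..1/2}. norm (digit_char d r (cls K c n) x) \<le> C / (1 + (scale r n * x)\<^sup>2)\<^sup>2 + \<Psi> x))"
    using class_decay[OF K C0] by blast
  define C' where "C' = (C * pi + c) / c"
  have C': "C' > 0" unfolding C'_def using C c by (intro divide_pos_pos add_pos_pos mult_pos_pos) auto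
  \<comment> \<open>Collects the constants of M / scale; L >= A absorbs them because a spare factor
    1 / L^m is left over.\<close>
  define A where "A = 8 * pi\<^sup>2 * C * real d * CH * C0 / c"
  have A0: "A \<ge> 0" unfolding A_def using C CH_pos C0 c by auto
  show ?thesis
  proof (rule exI[of _ C'], rule conjI[OF C'])
    have ev3: "\<forall>\<^sub>F n in sequentially. max 1 (max A (real d * C0)) \<le> ln (real n)" by (rule eventually_ln_ge)
    have ev4: "\<forall>\<^sub>F n in sequentially. (max 1 (4 / c)) * ln (real n) ^ (4 * m) \<le> real n powr \<eta>"
      by (rule eventually_ln_power_le_powr) (use C in auto)
    show "\<forall>\<^sub>F n in sequentially. \<exists>r. decoupled K n C' r"
      using ev0 ev1 ev2 ev3 ev4 eventually_ge_at_top[of "3::nat"]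
    proof eventually_elim
      case (elim n)
      define L where "L = ln (real n)"
      have L1: "L \<ge> 1" "L \<ge> A" "L \<ge> real d * C0" using elim(4) by (auto simp: L_def)
      have n0: "real n > 0" "n \<ge> 1" using elim(6) by auto
      obtain r where r: "1 / real n \<le> r" "r \<le> 1" "(\<Sum>h\<in>Hs n. real h * digit_mean d r h) = real n"
        "real n \<le> C0 * (1 / r) * L ^ (m - 1)" using elim(1) unfolding L_def by blast
      have r0: "r > 0" using r(1) n0 by (meson divide_pos_pos less_le_trans zero_less_one)
      define \<sigma> where "\<sigma> = scale r n"
      define Pn where "Pn = digit_exp d r (Hs n) (\<lambda>a. of_bool (digit_sum (Hs n) a = n) :: real)"
      have sb: "1 / r \<le> \<sigma>" "\<sigma> \<le> real n * L ^ m" "\<sigma> > 0"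
        using scale_bounds[OF r(1,2) n0(2)] L1 unfolding \<sigma>_def L_def by auto
      have low: "c / \<sigma> \<le> Pn" using elim(2) r unfolding \<sigma>_def Pn_def L_def by blast
      have Pn0: "Pn > 0" using low c sb by (meson divide_pos_pos less_le_trans)
      have den: "1 + (\<sigma> * x)\<^sup>2 \<ge> 1" for x by simp
      have cden: "continuous_on T (\<lambda>x. q / (1 + (\<sigma> * x)\<^sup>2))" for T q
        using den by (intro continuous_intros) (metis not_one_le_zero)
      have cb: "continuous_on T (\<lambda>x. norm (digit_char d r A x))" for T A by (intro continuous_intros)
      \<comment> \<open>Relative to 1 / scale the minor arc contribution is a negative power of n up
        to logarithms, so it beats any fixed power of log n.\<close>
      have pn: "real n powr (-1 - \<eta>) * \<sigma> \<le> 1 / (max 1 (4 / c) * L ^ (3 * m))"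
      proof -
        have Lp: "L ^ (3 * m) > 0" using L1 by simp
        have m0: "max 1 (4 / c) > 0" by (simp add: less_max_iff_disj)
        have "real n powr (-1 - \<eta>) * \<sigma> \<le> real n powr (-1 - \<eta>) * (real n * L ^ m)" using sb by (intro mult_left_mono) auto
        also have "\<dots> = real n powr (- \<eta>) * L ^ m" using n0 by (simp add: powr_diff powr_minus field_simps)
        also have "\<dots> \<le> real n powr (- \<eta>) * (real n powr \<eta> / (max 1 (4 / c) * L ^ (3 * m)))"
        proof (intro mult_left_mono)
          have "L ^ m * (max 1 (4 / c) * L ^ (3 * m)) = max 1 (4 / c) * L ^ (4 * m)" by (simp add: power_add[symmetric])
          also have "\<dots> \<le> real n powr \<eta>" using elim(5) by (simp add: L_def)
          finally show "L ^ m \<le> real n powr \<eta> / (max 1 (4 / c) * L ^ (3 * m))" using Lp m0 by (simp add: pos_le_divide_eq)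
        qed auto
        also have "\<dots> = 1 / (max 1 (4 / c) * L ^ (3 * m))" using n0 by (simp add: powr_minus)
        finally show ?thesis .
      qed
      have "decoupled K n C' r"
      proof (rule goodI[OF r0 Pn_def Pn0 L_def])
        fix U V :: "nat set" and F G :: "(nat \<Rightarrow> nat) \<Rightarrow> complex" and B D :: real and cc :: nat
        assume h: "cc < K" "U \<subseteq> Hs n" "V \<subseteq> Hs n" "U \<inter> V = {}" "(U \<union> V) \<inter> cls K cc n = {}"
          "\<forall>h\<in>U. real h \<le> small_bound n" "depends_on U F" "depends_on V G" "\<forall>a. norm (F a) \<le> B" "\<forall>a. norm (G a) \<le> D"
        obtain \<Psi> where Psi: "continuous_on UNIV \<Psi>" "\<And>x. 0 \<le> \<Psi> x" "integral {-1/2..1/2} \<Psi> \<le> real n powr (-1 - \<eta>)"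
          "\<And>x. x \<in> {-1/2..1/2} \<Longrightarrow> norm (digit_char d r (cls K cc n) x) \<le> C / (1 + (\<sigma> * x)\<^sup>2)\<^sup>2 + \<Psi> x"
          using elim(3)[rule_format, of cc r] h(1) r unfolding L_def \<sigma>_def by auto
        have cPsi: "continuous_on T \<Psi>" for T using Psi(1) continuous_on_subset by blast
        have B0: "0 \<le> B" using h(9) norm_ge_zero order.trans by blast
        have D0: "0 \<le> D" using h(10) norm_ge_zero order.trans by blast
        define M where "M = real d * CH * L ^ m * small_bound n"
        have sm0: "small_bound n \<ge> 0" unfolding small_bound_def using L1 n0 by (intro divide_nonneg_nonneg) (auto simp: L_def)
        have M0: "M \<ge> 0" unfolding M_def using sm0 CH_pos L1 by auto
        have M: "real (digit_sum U a) \<le> M" if a: "a \<in> cfgs d U" for a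
        proof -
          have "real (digit_sum U a) = (\<Sum>h\<in>U. real (a h) * real h)" by (simp add: digit_sum_def)
          also have "\<dots> \<le> (\<Sum>h\<in>U. real d * small_bound n)"
          proof (rule sum_mono)
            fix k assume k: "k \<in> U"
            hence "a k < d" using a by (auto simp: PiE_dflt_def)
            thus "real (a k) * real k \<le> real d * small_bound n" using h(6) k by (intro mult_mono) auto
          qed
          also have "\<dots> = real (card U) * (real d * small_bound n)" by simp
          also have "\<dots> \<le> (CH * L ^ m) * (real d * small_bound n)"
          proof (intro mult_right_mono)
            have "real (card U) \<le> real (card (Hs n))" using h(2) finite_Hs by (simp add: card_mono)
            also have "\<dots> \<le> CH * L ^ m" unfolding L_def by (rule card_Hs_le) (use n0 L1 in \<open>auto simp: L_def\<close>)
            finally show "real (card U) \<le> CH * L ^ m" .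
          qed (use sm0 in auto)
          finally show ?thesis by (simp add: M_def mult_ac)
        qed
        have cs: "cls K cc n \<subseteq> Hs n - U - V" using h(5) cls_subset[of K cc n] by blast
        have "norm (digit_exp d r (Hs n) (\<lambda>a. of_bool (digit_sum (Hs n) a = n) * (F a * G a)) -
           digit_exp d r U F * digit_exp d r (Hs n) (\<lambda>a. of_bool (digit_sum (Hs n) a = n) * G a))
          \<le> B * D * integral {-1/2..1/2} (\<lambda>x. min 2 (4 * pi * \<bar>x\<bar> * M) * norm (digit_char d r (cls K cc n) x))"
          by (rule digit_exp_at_decouple[OF finite_Hs h(2-4) cs _ h(7,8)]) (use h d2 M in auto)
        also have "\<dots> \<le> B * D * (Pn / L ^ (3 * m))"
        proof (intro mult_left_mono)
          have "integral {-1/2..1/2} (\<lambda>x. min 2 (4 * pi * \<bar>x\<bar> * M) * norm (digit_char d r (cls K cc n) x))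
             \<le> integral {-1/2..1/2} (\<lambda>x. (4 * pi * M * C / \<sigma>) * (1 / (1 + (\<sigma> * x)\<^sup>2)) + 2 * \<Psi> x)"
          proof (rule integral_le)
            fix x :: real assume x: "x \<in> {-1/2..1/2}"
            define Dx where "Dx = 1 + (\<sigma> * x)\<^sup>2"
            have Dx: "Dx \<ge> 1" by (simp add: Dx_def)
            \<comment> \<open>Trades the factor |x| of the phase for one of the two factors
              \<open>Dx\<close>, gaining 1 / sigma.\<close>
            have "\<bar>\<sigma> * x\<bar> \<le> Dx"
            proof -
              have "0 \<le> (\<bar>\<sigma> * x\<bar> - 1)\<^sup>2" by simp
              also have "\<dots> = (\<sigma> * x)\<^sup>2 + 1 - 2 * \<bar>\<sigma> * x\<bar>" by (simp add: power2_diff)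
              finally show ?thesis by (simp add: Dx_def)
            qed
            hence xD: "\<bar>x\<bar> \<le> Dx / \<sigma>" using sb(3) by (simp add: abs_mult field_simps)
            have "min 2 (4 * pi * \<bar>x\<bar> * M) * norm (digit_char d r (cls K cc n) x) \<le> min 2 (4 * pi * \<bar>x\<bar> * M) * (C / Dx\<^sup>2 + \<Psi> x)"
              using Psi(4)[OF x] M0 by (intro mult_left_mono) (auto simp: Dx_def)
            also have "\<dots> = min 2 (4 * pi * \<bar>x\<bar> * M) * (C / Dx\<^sup>2) + min 2 (4 * pi * \<bar>x\<bar> * M) * \<Psi> x" by (simp add: distrib_left)
            also have "\<dots> \<le> (4 * pi * \<bar>x\<bar> * M) * (C / Dx\<^sup>2) + 2 * \<Psi> x"
              using C Psi(2)[of x] by (intro add_mono mult_right_mono) auto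
            also have "(4 * pi * \<bar>x\<bar> * M) * (C / Dx\<^sup>2) \<le> (4 * pi * (Dx / \<sigma>) * M) * (C / Dx\<^sup>2)"
              using xD M0 C by (intro mult_right_mono mult_left_mono) auto
            also have "\<dots> = (4 * pi * M * C / \<sigma>) * (1 / Dx)" using Dx by (simp add: power2_eq_square)
            finally show "min 2 (4 * pi * \<bar>x\<bar> * M) * norm (digit_char d r (cls K cc n) x)
               \<le> (4 * pi * M * C / \<sigma>) * (1 / (1 + (\<sigma> * x)\<^sup>2)) + 2 * \<Psi> x" by (simp add: Dx_def)
          qed (intro integrable_continuous_interval continuous_intros cPsi cb cden)+
          also have "\<dots> = integral {-1/2..1/2} (\<lambda>x. (4 * pi * M * C / \<sigma>) * (1 / (1 + (\<sigma> * x)\<^sup>2))) + integral {-1/2..1/2} (\<lambda>x. 2 * \<Psi> x)"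
            by (intro integral_add integrable_continuous_interval continuous_intros cPsi cden)
          also have "\<dots> = (4 * pi * M * C / \<sigma>) * integral {-1/2..1/2} (\<lambda>x. 1 / (1 + (\<sigma> * x)\<^sup>2)) + 2 * integral {-1/2..1/2} \<Psi>"
            by (simp only: integral_mult_right)
          also have "\<dots> \<le> (4 * pi * M * C / \<sigma>) * (pi / \<sigma>) + 2 * real n powr (-1 - \<eta>)"
            using integral_inverse_square_le[OF sb(3)] Psi(3) M0 C sb(3)
            by (intro add_mono mult_left_mono) auto
          also have "\<dots> \<le> c / (2 * L ^ (3 * m)) / \<sigma> + c / (2 * L ^ (3 * m)) / \<sigma>"
          proof (rule add_mono)
            have Lp: "L ^ (3 * m) > 0" "L ^ (6 * m) > 0" using L1 by auto
            have "C0 * (1 / r) * L ^ (m - 1) \<le> C0 * \<sigma> * L ^ (m - 1)"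
              using C0 sb(1) L1 by (intro mult_right_mono mult_left_mono) auto
            hence "real n \<le> C0 * \<sigma> * L ^ (m - 1)" using r(4) by linarith
            also have "\<dots> \<le> C0 * \<sigma> * L ^ m" using C0 sb(3) L1 by (intro mult_left_mono power_increasing) auto
            finally have nS: "real n \<le> C0 * \<sigma> * L ^ m" .
            have "4 * pi * M * C * pi * (2 * L ^ (3 * m)) = (8 * pi\<^sup>2 * C * real d * CH) * (L ^ m * L ^ (3 * m) / L ^ (6 * m)) * real n"
              unfolding M_def small_bound_def L_def[symmetric] by (simp add: power2_eq_square mult_ac)
            also have "\<dots> \<le> (8 * pi\<^sup>2 * C * real d * CH) * (L ^ m * L ^ (3 * m) / L ^ (6 * m)) * (C0 * \<sigma> * L ^ m)"
              using nS C CH_pos L1 by (intro mult_left_mono) auto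
            also have "\<dots> = A * c * \<sigma> * (L ^ m * L ^ (3 * m) * L ^ m / L ^ (6 * m))"
              using c by (simp add: A_def)
            also have "L ^ m * L ^ (3 * m) * L ^ m / L ^ (6 * m) = 1 / L ^ m"
            proof -
              have "L ^ m * L ^ (3 * m) * L ^ m * L ^ m = L ^ (6 * m)" by (simp add: power_add[symmetric])
              thus ?thesis using L1 Lp by (simp add: field_simps)
            qed
            also have "A * c * \<sigma> * (1 / L ^ m) \<le> c * \<sigma>"
            proof -
              have "A \<le> L ^ 1" using L1 by simp
              also have "\<dots> \<le> L ^ m" using L1 m2 by (intro power_increasing) auto
              finally have "A / L ^ m \<le> 1" using L1 by simp
              hence "c * \<sigma> * (A / L ^ m) \<le> c * \<sigma> * 1" using c sb(3) by (intro mult_left_mono) auto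
              thus ?thesis by (simp add: mult_ac)
            qed
            finally have "4 * pi * M * C * pi * (2 * L ^ (3 * m)) \<le> c * \<sigma>" .
            thus "(4 * pi * M * C / \<sigma>) * (pi / \<sigma>) \<le> c / (2 * L ^ (3 * m)) / \<sigma>"
              using sb(3) Lp by (simp add: field_simps)
            have "2 * real n powr (-1 - \<eta>) * \<sigma> \<le> 2 * (1 / (4 / c * L ^ (3 * m)))"
            proof -
              have "1 / (max 1 (4 / c) * L ^ (3 * m)) \<le> 1 / (4 / c * L ^ (3 * m))"
                using Lp c by (intro divide_left_mono mult_right_mono mult_pos_pos) (auto simp: less_max_iff_disj)
              thus ?thesis using pn by linarith
            qed
            also have "\<dots> = c / (2 * L ^ (3 * m))" using c by simp
            finally show "2 * real n powr (-1 - \<eta>) \<le> c / (2 * L ^ (3 * m)) / \<sigma>"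
              using sb(3) by (subst pos_le_divide_eq) auto
          qed
          also have "\<dots> = (c / \<sigma>) / L ^ (3 * m)" by (simp add: field_simps)
          also have "\<dots> \<le> Pn / L ^ (3 * m)" using low L1 by (intro divide_right_mono) auto
          finally show "integral {-1/2..1/2} (\<lambda>x. min 2 (4 * pi * \<bar>x\<bar> * M) * norm (digit_char d r (cls K cc n) x)) \<le> Pn / L ^ (3 * m)" .
        qed (use B0 D0 in auto)
        finally show "norm (digit_exp d r (Hs n) (\<lambda>a. of_bool (digit_sum (Hs n) a = n) * (F a * G a)) -
           digit_exp d r U F * digit_exp d r (Hs n) (\<lambda>a. of_bool (digit_sum (Hs n) a = n) * G a)) \<le> B * D * (Pn / L ^ (3 * m))" .
      next
        fix V :: "nat set" and F :: "(nat \<Rightarrow> nat) \<Rightarrow> real" and cc :: nat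
        assume h: "cc < K" "V \<subseteq> Hs n" "V \<inter> cls K cc n = {}" "depends_on V F" "\<forall>a. 0 \<le> F a"
        obtain \<Psi> where Psi: "continuous_on UNIV \<Psi>" "\<And>x. 0 \<le> \<Psi> x" "integral {-1/2..1/2} \<Psi> \<le> real n powr (-1 - \<eta>)"
          "\<And>x. x \<in> {-1/2..1/2} \<Longrightarrow> norm (digit_char d r (cls K cc n) x) \<le> C / (1 + (\<sigma> * x)\<^sup>2)\<^sup>2 + \<Psi> x"
          using elim(3)[rule_format, of cc r] h(1) r unfolding L_def \<sigma>_def by auto
        have cPsi: "continuous_on T \<Psi>" for T using Psi(1) continuous_on_subset by blast
        have "integral {-1/2..1/2} (\<lambda>x. norm (digit_char d r (cls K cc n) x)) \<le> integral {-1/2..1/2} (\<lambda>x. C * (1 / (1 + (\<sigma> * x)\<^sup>2)) + \<Psi> x)"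
        proof (rule integral_le)
          fix x :: real assume x: "x \<in> {-1/2..1/2}"
          have "C / (1 + (\<sigma> * x)\<^sup>2)\<^sup>2 \<le> C / (1 + (\<sigma> * x)\<^sup>2)"
          proof -
            define Dx where "Dx = 1 + (\<sigma> * x)\<^sup>2"
            have Dx: "Dx \<ge> 1" by (simp add: Dx_def)
            hence "C / Dx / Dx \<le> C / Dx / 1" using C by (intro divide_left_mono) auto
            thus ?thesis unfolding Dx_def[symmetric] by (simp add: power2_eq_square)
          qed
          thus "norm (digit_char d r (cls K cc n) x) \<le> C * (1 / (1 + (\<sigma> * x)\<^sup>2)) + \<Psi> x" using Psi(4)[OF x] by simp
        qed (intro integrable_continuous_interval continuous_intros cPsi cb cden)+
        also have "\<dots> = integral {-1/2..1/2} (\<lambda>x. C * (1 / (1 + (\<sigma> * x)\<^sup>2))) + integral {-1/2..1/2} \<Psi>"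
          by (intro integral_add integrable_continuous_interval continuous_intros cPsi cden)
        also have "\<dots> = C * integral {-1/2..1/2} (\<lambda>x. 1 / (1 + (\<sigma> * x)\<^sup>2)) + integral {-1/2..1/2} \<Psi>"
          by (simp only: integral_mult_right)
        also have "\<dots> \<le> C * (pi / \<sigma>) + c / \<sigma>"
        proof (rule add_mono)
          show "C * integral {-1/2..1/2} (\<lambda>x. 1 / (1 + (\<sigma> * x)\<^sup>2)) \<le> C * (pi / \<sigma>)"
            using integral_inverse_square_le[OF sb(3)] C by (intro mult_left_mono) auto
          have "1 / (max 1 (4 / c) * L ^ (3 * m)) \<le> 1 / (4 / c * 1)"
            using c L1 by (intro divide_left_mono mult_mono mult_pos_pos) (auto simp: less_max_iff_disj)
          also have "\<dots> \<le> c" using c by simp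
          finally have "real n powr (-1 - \<eta>) * \<sigma> \<le> c" using pn by linarith
          hence "real n powr (-1 - \<eta>) \<le> c / \<sigma>" using sb(3) by (simp add: field_simps)
          thus "integral {-1/2..1/2} \<Psi> \<le> c / \<sigma>" using Psi(3) by linarith
        qed
        also have "\<dots> = (C * pi + c) / \<sigma>" by (simp add: add_divide_distrib)
        also have "\<dots> = C' * (c / \<sigma>)" unfolding C'_def using c by simp
        also have "\<dots> \<le> C' * Pn" using low C' by (intro mult_left_mono) auto
        finally have I: "integral {-1/2..1/2} (\<lambda>x. norm (digit_char d r (cls K cc n) x)) \<le> C' * Pn" .
        have E0: "0 \<le> digit_exp d r V F" unfolding digit_exp_def using h(5)
          by (auto intro!: sum_nonneg mult_nonneg_nonneg prod_nonneg digit_wt_nonneg)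
        have cs: "cls K cc n \<subseteq> Hs n - V" using h(3) cls_subset[of K cc n] by blast
        have "digit_exp d r (Hs n) (\<lambda>a. of_bool (digit_sum (Hs n) a = n) * F a) \<le>
            digit_exp d r V F * integral {-1/2..1/2} (\<lambda>x. norm (digit_char d r (cls K cc n) x))"
          by (rule digit_exp_at_le[OF finite_Hs h(2) cs _ h(4)]) (use h d2 in auto)
        also have "\<dots> \<le> digit_exp d r V F * (C' * Pn)" using I E0 by (intro mult_left_mono)
        finally show "digit_exp d r (Hs n) (\<lambda>a. of_bool (digit_sum (Hs n) a = n) * F a) \<le> C' * Pn * digit_exp d r V F" by (simp add: mult_ac)
      next
        fix h :: nat assume h: "real h \<le> small_bound n"
        have Lp: "L ^ (3 * m) > 0" "L ^ (6 * m) > 0" using L1 by auto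
        have "r * real n \<le> C0 * L ^ (m - 1)" using r(4) r0 by (simp add: field_simps)
        hence rn: "r * real n \<le> C0 * L ^ (m - 1)" .
        have "\<bar>digit_wt d r h 0 - 1 / real d\<bar> \<le> real d * (r * real h)" using d2 r0 by (intro digit_wt_0_approx) auto
        also have "\<dots> \<le> real d * (r * (real n / L ^ (6 * m)))"
          using h r0 by (intro mult_left_mono) (auto simp: small_bound_def L_def)
        also have "\<dots> = real d * (r * real n) / L ^ (6 * m)" by simp
        also have "\<dots> \<le> real d * (C0 * L ^ (m - 1)) / L ^ (6 * m)" using rn Lp by (intro divide_right_mono mult_left_mono) auto
        also have "\<dots> \<le> L ^ (3 * m) / L ^ (6 * m)"
        proof (intro divide_right_mono)
          have "real d * C0 * L ^ (m - 1) \<le> L * L ^ (m - 1)" using L1 by (intro mult_right_mono) auto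
          also have "\<dots> = L ^ Suc (m - 1)" by simp
          also have "\<dots> \<le> L ^ (3 * m)" using L1 m2 by (intro power_increasing) auto
          finally show "real d * (C0 * L ^ (m - 1)) \<le> L ^ (3 * m)" by (simp add: mult_ac)
        qed (use Lp in auto)
        also have "\<dots> = 1 / L ^ (3 * m)"
        proof -
          have "L ^ (6 * m) = L ^ (3 * m) * L ^ (3 * m)" by (simp add: power_add[symmetric])
          thus ?thesis using Lp by simp
        qed
        finally show "\<bar>digit_wt d r h 0 - 1 / real d\<bar> \<le> 1 / L ^ (3 * m)" .
      qed
      thus ?case by blast
    qed
  qed
qed

lemma decoupled_complex:
  assumes "decoupled K n C r" "c < K" "U \<subseteq> Hs n" "V \<subseteq> Hs n" "U \<inter> V = {}" "(U \<union> V) \<inter> cls K c n = {}"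
    "\<And>h. h \<in> U \<Longrightarrow> real h \<le> small_bound n" "depends_on U F" "depends_on V G"
    "\<And>a. norm (F a :: complex) \<le> B" "\<And>a. norm (G a :: complex) \<le> D"
  shows "norm (rep_exp n (\<lambda>a. F a * G a) - digit_exp d r U F * rep_exp n G) \<le> B * D / ln (real n) ^ (3 * m)"
  by (rule assms(1)[unfolded decoupled_def, THEN conjunct2, THEN conjunct2, THEN conjunct1, rule_format, OF assms(2-11)])

lemma rep_exp_of_real: "rep_exp n (\<lambda>a. of_real (F a)) = of_real (rep_exp n F)"
  by (simp add: rep_exp_def)

lemma decoupled_real:
  fixes F G :: "(nat \<Rightarrow> nat) \<Rightarrow> real"
  assumes "decoupled K n C r" "c < K" "U \<subseteq> Hs n" "V \<subseteq> Hs n" "U \<inter> V = {}" "(U \<union> V) \<inter> cls K c n = {}"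
    "\<And>h. h \<in> U \<Longrightarrow> real h \<le> small_bound n" "depends_on U F" "depends_on V G"
    "\<And>a. \<bar>F a\<bar> \<le> B" "\<And>a. \<bar>G a\<bar> \<le> D"
  shows "\<bar>rep_exp n (\<lambda>a. F a * G a) - digit_exp d r U F * rep_exp n G\<bar> \<le> B * D / ln (real n) ^ (3 * m)"
proof -
  have "norm (rep_exp n (\<lambda>a. complex_of_real (F a) * complex_of_real (G a)) -
      digit_exp d r U (\<lambda>a. complex_of_real (F a)) * rep_exp n (\<lambda>a. complex_of_real (G a))) \<le> B * D / ln (real n) ^ (3 * m)"
    by (rule decoupled_complex[OF assms(1-7) depends_comp[OF assms(8)] depends_comp[OF assms(9)]]) (use assms(10,11) in auto)
  also have "rep_exp n (\<lambda>a. complex_of_real (F a) * complex_of_real (G a)) -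
      digit_exp d r U (\<lambda>a. complex_of_real (F a)) * rep_exp n (\<lambda>a. complex_of_real (G a)) =
      complex_of_real (rep_exp n (\<lambda>a. F a * G a) - digit_exp d r U F * rep_exp n G)"
    unfolding of_real_mult[symmetric] rep_exp_of_real digit_exp_of_real of_real_diff[symmetric] ..
  finally show ?thesis by (simp only: norm_of_real)
qed

lemma decoupled_le:
  assumes "decoupled K n C r" "c < K" "V \<subseteq> Hs n" "V \<inter> cls K c n = {}" "depends_on V F" "\<And>a. (0::real) \<le> F a"
  shows "rep_exp n F \<le> C * digit_exp d r V F"
  by (rule assms(1)[unfolded decoupled_def, THEN conjunct2, THEN conjunct2, THEN conjunct2, THEN conjunct1, rule_format, OF assms(2-6)])

lemma decoupled_digit_wt:
  assumes "decoupled K n C r" "real h \<le> small_bound n"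
  shows "\<bar>digit_wt d r h 0 - 1 / real d\<bar> \<le> 1 / ln (real n) ^ (3 * m)"
  using assms unfolding decoupled_def by blast

end

subsection \<open>Mean, variance and limit law\<close>

context multibase
begin

lemma rep_exp_add: "rep_exp n (\<lambda>a. F a + G a) = rep_exp n F + rep_exp n G"
  by (simp add: rep_exp_def sum.distrib add_divide_distrib)
lemma rep_exp_diff: "rep_exp n (\<lambda>a. F a - G a) = rep_exp n F - rep_exp n G"
  by (simp add: rep_exp_def sum_subtractf diff_divide_distrib)
lemma rep_exp_cmult: "rep_exp n (\<lambda>a. c * F a) = c * rep_exp n F"
  by (simp add: rep_exp_def sum_distrib_left)
lemma rep_exp_sum: "rep_exp n (\<lambda>a. \<Sum>i\<in>I. F i a) = (\<Sum>i\<in>I. rep_exp n (F i))"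
  unfolding rep_exp_def by (subst sum.swap) (simp add: sum_divide_distrib)
lemma rep_exp_const: "reps n \<noteq> {} \<Longrightarrow> rep_exp n (\<lambda>_. c) = c"
  using finite_reps[of n] by (simp add: rep_exp_def)
lemma rep_exp_cong: "(\<And>a. a \<in> reps n \<Longrightarrow> F a = G a) \<Longrightarrow> rep_exp n F = rep_exp n G"
  by (simp add: rep_exp_def)
lemma rep_exp_mono: "(\<And>a. a \<in> reps n \<Longrightarrow> F a \<le> G a) \<Longrightarrow> rep_exp n F \<le> (rep_exp n G :: real)"
  unfolding rep_exp_def by (intro divide_right_mono sum_mono) auto
lemma norm_rep_exp_le: "norm (rep_exp n F) \<le> rep_exp n (\<lambda>a. norm (F a))"
  unfolding rep_exp_def by (simp add: norm_divide divide_right_mono norm_sum)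

lemma rep_exp_square_le: "(rep_exp n F)\<^sup>2 \<le> rep_exp n (\<lambda>a. (F a)\<^sup>2 :: real)"
proof (cases "card (reps n) = 0")
  case False
  have "(\<Sum>a\<in>reps n. F a)\<^sup>2 \<le> (\<Sum>a\<in>reps n. (F a)\<^sup>2) * card (reps n)" by (rule sum_squared_le_sum_of_squares)
  hence "(\<Sum>a\<in>reps n. F a)\<^sup>2 / (real (card (reps n)))\<^sup>2 \<le> (\<Sum>a\<in>reps n. (F a)\<^sup>2) * card (reps n) / (real (card (reps n)))\<^sup>2"
    by (intro divide_right_mono) auto
  thus ?thesis using False by (simp add: rep_exp_def power_divide power2_eq_square)
qed (simp add: rep_exp_def)

definition small_class :: "nat \<Rightarrow> nat \<Rightarrow> nat \<Rightarrow> nat set" where "small_class K c n = {h \<in> cls K c n. real h \<le> small_bound n}"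
definition big_class :: "nat \<Rightarrow> nat \<Rightarrow> nat \<Rightarrow> nat set" where "big_class K c n = {h \<in> cls K c n. small_bound n < real h}"
definition small_part :: "nat \<Rightarrow> nat set" where "small_part n = {h \<in> Hs n. real h \<le> small_bound n}"
definition big_part :: "nat \<Rightarrow> nat set" where "big_part n = {h \<in> Hs n. small_bound n < real h}"

text \<open>Centring by the mean of the independent model, not by the mean over representations:
  decoupled products then have main term 0 and consist of error only.\<close>

definition centred :: "real \<Rightarrow> nat set \<Rightarrow> (nat \<Rightarrow> nat) \<Rightarrow> real" where
  "centred r A a = real (nonzeros A a) - (\<Sum>h\<in>A. 1 - digit_wt d r h 0)"
definition nz_var :: "real \<Rightarrow> nat set \<Rightarrow> real" where
  "nz_var r A = (\<Sum>h\<in>A. (1 - digit_wt d r h 0) * digit_wt d r h 0)"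

lemma d1: "d \<ge> 1" using d2 by simp

lemma depends_centred: "depends_on A (centred r A)"
  unfolding centred_def by (rule depends_comp[OF depends_nonzeros, of _ "\<lambda>x. real x - (\<Sum>h\<in>A. 1 - digit_wt d r h 0)"])

lemma abs_centred_le: assumes "finite A" shows "\<bar>centred r A a\<bar> \<le> real (card A)"
proof -
  have "nonzeros A a \<le> (\<Sum>h\<in>A. 1)" unfolding nonzeros_def by (intro sum_mono) auto
  hence "0 \<le> real (nonzeros A a)" "real (nonzeros A a) \<le> real (card A)" by auto
  moreover have "0 \<le> (\<Sum>h\<in>A. 1 - digit_wt d r h 0)" using digit_wt_le_1[OF d1] by (intro sum_nonneg) (simp add: algebra_simps)
  moreover have "(\<Sum>h\<in>A. 1 - digit_wt d r h 0) \<le> (\<Sum>h\<in>A. 1)" using digit_wt_nonneg by (intro sum_mono) (simp add: algebra_simps)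
  ultimately show ?thesis unfolding centred_def by simp
qed

lemma digit_exp_centred: assumes "finite A" shows "digit_exp d r A (centred r A) = 0"
  unfolding centred_def digit_exp_diff using digit_exp_nonzeros(1)[OF assms d1, of r] assms d1 by (simp add: digit_exp_const)

lemma digit_exp_centred_sq: assumes "finite A" shows "digit_exp d r A (\<lambda>a. (centred r A a)\<^sup>2) = nz_var r A"
  unfolding centred_def nz_var_def by (rule digit_exp_nonzeros(2)[OF assms d1])

lemma nz_var_bounds: assumes "finite A" shows "0 \<le> nz_var r A" "nz_var r A \<le> real (card A)"
proof -
  show "0 \<le> nz_var r A" unfolding nz_var_def using digit_wt_nonneg digit_wt_le_1[OF d1] by (intro sum_nonneg mult_nonneg_nonneg) auto
  have "nz_var r A \<le> (\<Sum>h\<in>A. 1)" unfolding nz_var_def using digit_wt_nonneg digit_wt_le_1[OF d1] by (intro sum_mono mult_le_one) auto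
  thus "nz_var r A \<le> real (card A)" by simp
qed

lemma class_union:
  assumes "K \<ge> 1"
  shows "(\<Union>c<K. small_class K c n) = small_part n" "(\<Union>c<K. big_class K c n) = big_part n"
  using assms unfolding small_class_def big_class_def small_part_def big_part_def cls_def colour_def by auto

lemma sum_classes:
  assumes "K \<ge> 1"
  shows "(\<Sum>c<K. \<Sum>h\<in>small_class K c n. f h) = (\<Sum>h\<in>small_part n. f h)" "(\<Sum>c<K. \<Sum>h\<in>big_class K c n. f h) = (\<Sum>h\<in>big_part n. f h)"
proof -
  have fin: "finite (small_class K c n)" "finite (big_class K c n)" for c using finite_cls by (auto simp: small_class_def big_class_def)
  show "(\<Sum>c<K. \<Sum>h\<in>small_class K c n. f h) = (\<Sum>h\<in>small_part n. f h)"
    unfolding class_union(1)[OF assms, symmetric] using fin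
    by (intro sum.UNION_disjoint[symmetric]) (auto simp: small_class_def cls_def)
  show "(\<Sum>c<K. \<Sum>h\<in>big_class K c n. f h) = (\<Sum>h\<in>big_part n. f h)"
    unfolding class_union(2)[OF assms, symmetric] using fin
    by (intro sum.UNION_disjoint[symmetric]) (auto simp: big_class_def cls_def)
qed

lemma centred_eq_sum: "centred r A a = (\<Sum>h\<in>A. of_bool (a h \<noteq> 0) - (1 - digit_wt d r h 0))"
  by (simp add: centred_def nonzeros_def sum_subtractf)

lemma fin_parts: "finite (small_class K c n)" "finite (big_class K c n)" "finite (small_part n)" "finite (big_part n)"
  "small_class K c n \<subseteq> Hs n" "big_class K c n \<subseteq> Hs n" "small_part n \<subseteq> Hs n" "big_part n \<subseteq> Hs n"
  using finite_cls finite_Hs by (auto simp: small_class_def big_class_def small_part_def big_part_def cls_def)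

lemma Hs_split: "Hs n = small_part n \<union> big_part n" "small_part n \<inter> big_part n = {}"
  by (auto simp: small_part_def big_part_def)

lemma centred_Hs: "K \<ge> 1 \<Longrightarrow> centred r (Hs n) a = (\<Sum>c<K. centred r (small_class K c n) a) + (\<Sum>c<K. centred r (big_class K c n) a)"
  unfolding centred_eq_sum sum_classes unfolding Hs_split(1)
  by (intro sum.union_disjoint fin_parts Hs_split)

lemma other_class: assumes "K \<ge> 3" obtains c'' where "c'' < K" "c'' \<noteq> c" "c'' \<noteq> (c'::nat)"
proof -
  have "\<exists>c''\<in>{..<3::nat}. c'' \<notin> {c, c'}"
  proof (rule ccontr)
    assume "\<not> ?thesis"
    hence "{..<3::nat} \<subseteq> {c, c'}" by auto
    hence "card {..<3::nat} \<le> card {c, c'}" by (intro card_mono) auto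
    also have "\<dots> \<le> 2" by (simp add: card_insert_if)
    finally show False by simp
  qed
  then obtain x where "x < 3" "x \<noteq> c" "x \<noteq> c'" by auto
  thus ?thesis using that[of x] assms by linarith
qed

context
  fixes K n :: nat and C r :: real
  assumes decoupled: "decoupled K n C r" and K: "K \<ge> 3" and C: "C > 0" and n1: "n \<ge> 1" and L1: "ln (real n) \<ge> 1"
begin

lemma reps_ne: "reps n \<noteq> {}" using decoupled by (simp add: decoupled_def)

lemma card_part_le: "A \<subseteq> Hs n \<Longrightarrow> real (card A) \<le> CH * ln (real n) ^ m"
  using card_mono[OF finite_Hs, of A n] card_Hs_le[OF n1 L1] by linarith

lemma abs_centred_part_le: assumes "A \<subseteq> Hs n" shows "\<bar>centred r A a\<bar> \<le> CH * ln (real n) ^ m"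
  using abs_centred_le[OF finite_subset[OF assms finite_Hs], of r a] card_part_le[OF assms] by linarith

lemma err1: "CH * ln (real n) ^ m * 1 / ln (real n) ^ (3 * m) \<le> CH"
proof -
  have "ln (real n) ^ m \<le> ln (real n) ^ (3 * m)" using L1 by (intro power_increasing) auto
  hence "ln (real n) ^ m / ln (real n) ^ (3 * m) \<le> 1" using L1 by (subst divide_le_eq_1_pos) auto
  hence "CH * (ln (real n) ^ m / ln (real n) ^ (3 * m)) \<le> CH * 1" using CH_pos by (intro mult_left_mono) auto
  thus ?thesis by simp
qed

lemma err2: "CH * ln (real n) ^ m * (CH * ln (real n) ^ m) / ln (real n) ^ (3 * m) \<le> CH\<^sup>2"
proof -
  have "ln (real n) ^ m * ln (real n) ^ m \<le> ln (real n) ^ (3 * m)"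
    unfolding power_add[symmetric] using L1 by (intro power_increasing) auto
  hence "ln (real n) ^ m * ln (real n) ^ m / ln (real n) ^ (3 * m) \<le> 1" using L1 by (subst divide_le_eq_1_pos) auto
  hence "CH\<^sup>2 * (ln (real n) ^ m * ln (real n) ^ m / ln (real n) ^ (3 * m)) \<le> CH\<^sup>2 * 1" by (intro mult_left_mono) auto
  thus ?thesis by (simp add: power2_eq_square mult_ac)
qed

lemma rep_exp_small_class: assumes "c < K" shows "\<bar>rep_exp n (centred r (small_class K c n))\<bar> \<le> CH"
proof -
  obtain c'' where c'': "c'' < K" "c'' \<noteq> c" using other_class[OF K, of c c] by blast
  have "\<bar>rep_exp n (\<lambda>a. centred r (small_class K c n) a * 1) - digit_exp d r (small_class K c n) (centred r (small_class K c n)) * rep_exp n (\<lambda>_. 1)\<bar>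
     \<le> CH * ln (real n) ^ m * 1 / ln (real n) ^ (3 * m)"
    by (rule decoupled_real[OF decoupled c''(1) _ _ _ _ _ depends_centred, where V = "{}"])
       (use c'' in \<open>auto simp: small_class_def cls_def depends_const intro: abs_centred_part_le\<close>)
  thus ?thesis using err1 by (simp add: digit_exp_centred fin_parts)
qed

text \<open>The first factor has model mean 0, so the mixed moment is pure decoupling error.\<close>

lemma rep_exp_small_class_small_class: assumes "c < K" "c' < K" "c \<noteq> c'"
  shows "\<bar>rep_exp n (\<lambda>a. centred r (small_class K c n) a * centred r (small_class K c' n) a)\<bar> \<le> CH\<^sup>2"
proof -
  obtain c'' where c'': "c'' < K" "c'' \<noteq> c" "c'' \<noteq> c'" using other_class[OF K] by blast
  have "\<bar>rep_exp n (\<lambda>a. centred r (small_class K c n) a * centred r (small_class K c' n) a) - digit_exp d r (small_class K c n) (centred r (small_class K c n)) * rep_exp n (centred r (small_class K c' n))\<bar>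
     \<le> CH * ln (real n) ^ m * (CH * ln (real n) ^ m) / ln (real n) ^ (3 * m)"
    by (rule decoupled_real[OF decoupled c''(1) _ _ _ _ _ depends_centred depends_centred])
       (use c'' assms in \<open>auto simp: small_class_def cls_def intro: abs_centred_part_le\<close>)
  thus ?thesis using err2 by (simp add: digit_exp_centred fin_parts)
qed

lemma rep_exp_small_class_big_class: assumes "c < K" "c' < K"
  shows "\<bar>rep_exp n (\<lambda>a. centred r (small_class K c n) a * centred r (big_class K c' n) a)\<bar> \<le> CH\<^sup>2"
proof -
  obtain c'' where c'': "c'' < K" "c'' \<noteq> c" "c'' \<noteq> c'" using other_class[OF K] by blast
  have "\<bar>rep_exp n (\<lambda>a. centred r (small_class K c n) a * centred r (big_class K c' n) a) - digit_exp d r (small_class K c n) (centred r (small_class K c n)) * rep_exp n (centred r (big_class K c' n))\<bar>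
     \<le> CH * ln (real n) ^ m * (CH * ln (real n) ^ m) / ln (real n) ^ (3 * m)"
    by (rule decoupled_real[OF decoupled c''(1) _ _ _ _ _ depends_centred depends_centred])
       (use c'' assms in \<open>auto simp: small_class_def big_class_def cls_def intro: abs_centred_part_le\<close>)
  thus ?thesis using err2 by (simp add: digit_exp_centred fin_parts)
qed

lemma rep_exp_small_class_sq: assumes "c < K"
  shows "\<bar>rep_exp n (\<lambda>a. (centred r (small_class K c n) a)\<^sup>2) - nz_var r (small_class K c n)\<bar> \<le> CH\<^sup>2"
proof -
  obtain c'' where c'': "c'' < K" "c'' \<noteq> c" using other_class[OF K, of c c] by blast
  have "\<bar>rep_exp n (\<lambda>a. (centred r (small_class K c n) a)\<^sup>2 * 1) - digit_exp d r (small_class K c n) (\<lambda>a. (centred r (small_class K c n) a)\<^sup>2) * rep_exp n (\<lambda>_. 1)\<bar>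
     \<le> (CH * ln (real n) ^ m * (CH * ln (real n) ^ m)) * 1 / ln (real n) ^ (3 * m)"
  proof (rule decoupled_real[OF decoupled c''(1) _ _ _ _ _ depends_comp[OF depends_centred], where V = "{}"])
    fix a
    have "\<bar>centred r (small_class K c n) a\<bar> * \<bar>centred r (small_class K c n) a\<bar> \<le> CH * ln (real n) ^ m * (CH * ln (real n) ^ m)"
      using CH_pos L1 by (intro mult_mono abs_centred_part_le fin_parts) auto
    thus "\<bar>(centred r (small_class K c n) a)\<^sup>2\<bar> \<le> CH * ln (real n) ^ m * (CH * ln (real n) ^ m)"
      by (simp add: power2_eq_square abs_mult)
  qed (use c'' in \<open>auto simp: small_class_def cls_def depends_const\<close>)
  thus ?thesis using err2 by (simp add: digit_exp_centred_sq fin_parts rep_exp_const[OF reps_ne])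
qed

text \<open>Big digits do not decouple. The constant-factor bound costs C times their number, which
  is affordable because only O((log n)^(m-1) log log n) big elements exist.\<close>

lemma rep_exp_big_class_sq: assumes "c < K"
  shows "rep_exp n (\<lambda>a. (centred r (big_class K c n) a)\<^sup>2) \<le> C * real (card (big_class K c n))"
proof -
  obtain c'' where c'': "c'' < K" "c'' \<noteq> c" using other_class[OF K, of c c] by blast
  have "rep_exp n (\<lambda>a. (centred r (big_class K c n) a)\<^sup>2) \<le> C * digit_exp d r (big_class K c n) (\<lambda>a. (centred r (big_class K c n) a)\<^sup>2)"
    by (rule decoupled_le[OF decoupled c''(1) _ _ depends_comp[OF depends_centred]]) (use c'' in \<open>auto simp: big_class_def cls_def\<close>)
  also have "\<dots> \<le> C * real (card (big_class K c n))"
    unfolding digit_exp_centred_sq[OF fin_parts(2)] using C by (intro mult_left_mono nz_var_bounds fin_parts) auto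
  finally show ?thesis .
qed

abbreviation "small_total \<equiv> (\<lambda>a. \<Sum>c<K. centred r (small_class K c n) a)"
abbreviation "big_total \<equiv> (\<lambda>a. \<Sum>c<K. centred r (big_class K c n) a)"

lemma rep_exp_G: "\<bar>rep_exp n small_total\<bar> \<le> real K * CH"
proof -
  have "\<bar>rep_exp n small_total\<bar> \<le> (\<Sum>c<K. \<bar>rep_exp n (centred r (small_class K c n))\<bar>)" unfolding rep_exp_sum by (rule sum_abs)
  also have "\<dots> \<le> (\<Sum>c<K. CH)" by (intro sum_mono rep_exp_small_class) auto
  finally show ?thesis by simp
qed

lemma rep_exp_G_sq: "\<bar>rep_exp n (\<lambda>a. (small_total a)\<^sup>2) - nz_var r (small_part n)\<bar> \<le> (real K)\<^sup>2 * CH\<^sup>2"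
proof -
  have "rep_exp n (\<lambda>a. (small_total a)\<^sup>2) = (\<Sum>c<K. \<Sum>c'<K. rep_exp n (\<lambda>a. centred r (small_class K c n) a * centred r (small_class K c' n) a))"
    by (simp add: power2_eq_square sum_product rep_exp_sum)
  moreover have "nz_var r (small_part n) = (\<Sum>c<K. \<Sum>c'<K. if c' = c then nz_var r (small_class K c n) else 0)"
    using sum_classes(1)[of K "\<lambda>h. (1 - digit_wt d r h 0) * digit_wt d r h 0" n] K by (simp add: nz_var_def)
  ultimately have "\<bar>rep_exp n (\<lambda>a. (small_total a)\<^sup>2) - nz_var r (small_part n)\<bar> =
     \<bar>\<Sum>c<K. \<Sum>c'<K. rep_exp n (\<lambda>a. centred r (small_class K c n) a * centred r (small_class K c' n) a) - (if c' = c then nz_var r (small_class K c n) else 0)\<bar>"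
    by (simp add: sum_subtractf)
  also have "\<dots> \<le> (\<Sum>c<K. \<Sum>c'<K. \<bar>rep_exp n (\<lambda>a. centred r (small_class K c n) a * centred r (small_class K c' n) a) - (if c' = c then nz_var r (small_class K c n) else 0)\<bar>)"
    by (rule order.trans[OF sum_abs]) (intro sum_mono sum_abs)
  also have "\<dots> \<le> (\<Sum>c<K. \<Sum>c'<K. CH\<^sup>2)"
  proof (intro sum_mono)
    fix c c' assume c: "c \<in> {..<K}" "c' \<in> {..<K}"
    show "\<bar>rep_exp n (\<lambda>a. centred r (small_class K c n) a * centred r (small_class K c' n) a) - (if c' = c then nz_var r (small_class K c n) else 0)\<bar> \<le> CH\<^sup>2"
      using rep_exp_small_class_sq[of c] rep_exp_small_class_small_class[of c c'] c by (cases "c' = c") (auto simp: power2_eq_square)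
  qed
  also have "\<dots> = (real K)\<^sup>2 * CH\<^sup>2" by (simp add: power2_eq_square)
  finally show ?thesis .
qed

lemma rep_exp_GT: "\<bar>rep_exp n (\<lambda>a. small_total a * big_total a)\<bar> \<le> (real K)\<^sup>2 * CH\<^sup>2"
proof -
  have "rep_exp n (\<lambda>a. small_total a * big_total a) = (\<Sum>c<K. \<Sum>c'<K. rep_exp n (\<lambda>a. centred r (small_class K c n) a * centred r (big_class K c' n) a))"
    by (simp add: sum_product rep_exp_sum)
  hence "\<bar>rep_exp n (\<lambda>a. small_total a * big_total a)\<bar> \<le> (\<Sum>c<K. \<Sum>c'<K. \<bar>rep_exp n (\<lambda>a. centred r (small_class K c n) a * centred r (big_class K c' n) a)\<bar>)"
    by (simp, intro order.trans[OF sum_abs] sum_mono sum_abs)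
  also have "\<dots> \<le> (\<Sum>c<K. \<Sum>c'<K. CH\<^sup>2)" by (intro sum_mono rep_exp_small_class_big_class) auto
  finally show ?thesis by (simp add: power2_eq_square)
qed

text \<open>The constant-factor bound needs a free class and so does not cover all big digits at
  once; Cauchy-Schwarz over the K classes reduces the square to single classes.\<close>

lemma rep_exp_T_sq: "rep_exp n (\<lambda>a. (big_total a)\<^sup>2) \<le> real K * C * real (card (big_part n))"
proof -
  have "rep_exp n (\<lambda>a. (big_total a)\<^sup>2) \<le> rep_exp n (\<lambda>a. real K * (\<Sum>c<K. (centred r (big_class K c n) a)\<^sup>2))"
    using sum_squared_le_sum_of_squares[of _ "{..<K}"] by (intro rep_exp_mono) (simp add: mult.commute)
  also have "\<dots> = real K * (\<Sum>c<K. rep_exp n (\<lambda>a. (centred r (big_class K c n) a)\<^sup>2))" by (simp add: rep_exp_cmult rep_exp_sum)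
  also have "\<dots> \<le> real K * (\<Sum>c<K. C * real (card (big_class K c n)))" by (intro mult_left_mono sum_mono rep_exp_big_class_sq) auto
  also have "(\<Sum>c<K. C * real (card (big_class K c n))) = C * real (card (big_part n))"
    using sum_classes(2)[of K "\<lambda>_. 1::real" n] K by (simp flip: sum_distrib_left)
  finally show ?thesis by simp
qed

lemma rep_exp_centred_sq: "(rep_exp n (centred r (Hs n)))\<^sup>2 \<le> 2 * (real K)\<^sup>2 * CH\<^sup>2 + 2 * real K * C * real (card (big_part n))"
proof -
  have "rep_exp n (centred r (Hs n)) = rep_exp n small_total + rep_exp n big_total"
    unfolding rep_exp_add[symmetric] using K by (intro rep_exp_cong centred_Hs) simp
  hence "(rep_exp n (centred r (Hs n)))\<^sup>2 \<le> 2 * (rep_exp n small_total)\<^sup>2 + 2 * (rep_exp n big_total)\<^sup>2"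
    using zero_le_power2[of "rep_exp n small_total - rep_exp n big_total"] by (simp add: power2_eq_square algebra_simps)
  moreover have "(rep_exp n small_total)\<^sup>2 \<le> (real K * CH)\<^sup>2" using rep_exp_G CH_pos K by (intro abs_le_square_iff[THEN iffD1]) (simp add: abs_mult)
  moreover have "(rep_exp n big_total)\<^sup>2 \<le> real K * C * real (card (big_part n))" using rep_exp_square_le[of n big_total] rep_exp_T_sq by linarith
  ultimately show ?thesis by (simp add: power_mult_distrib)
qed

text \<open>The square of small plus big total is expanded. The coefficient 5 adds the small square
  (1), twice the mixed term (2) and the squared mean (2); the coefficient 3 adds the big square (1)
  and the squared mean (2).\<close>

lemma variance_approx:
  "\<bar>rep_exp n (\<lambda>a. (centred r (Hs n) a)\<^sup>2) - (rep_exp n (centred r (Hs n)))\<^sup>2 - nz_var r (small_part n)\<bar> \<le> 5 * (real K)\<^sup>2 * CH\<^sup>2 + 3 * real K * C * real (card (big_part n))"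
proof -
  have "rep_exp n (\<lambda>a. (centred r (Hs n) a)\<^sup>2) = rep_exp n (\<lambda>a. (small_total a)\<^sup>2 + 2 * (small_total a * big_total a) + (big_total a)\<^sup>2)"
    using K by (intro rep_exp_cong) (simp add: centred_Hs[of K] power2_sum)
  also have "\<dots> = rep_exp n (\<lambda>a. (small_total a)\<^sup>2) + 2 * rep_exp n (\<lambda>a. small_total a * big_total a) + rep_exp n (\<lambda>a. (big_total a)\<^sup>2)"
    by (simp only: rep_exp_add rep_exp_cmult)
  finally have eq: "rep_exp n (\<lambda>a. (centred r (Hs n) a)\<^sup>2) = \<dots>" .
  have "0 \<le> rep_exp n (\<lambda>a. (big_total a)\<^sup>2)" using rep_exp_square_le[of n big_total] zero_le_power2[of "rep_exp n big_total"] by linarith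
  thus ?thesis using rep_exp_G_sq rep_exp_GT rep_exp_T_sq rep_exp_centred_sq zero_le_power2[of "rep_exp n (centred r (Hs n))"] unfolding eq abs_le_iff by linarith
qed

text \<open>The small digits are centred up to O(1); the non-zero big digits number between 0 and
  all of them, which the error term allows.\<close>

lemma mean_approx:
  "\<bar>rep_exp n (\<lambda>a. real (nonzeros (Hs n) a)) - (\<Sum>h\<in>small_part n. 1 - digit_wt d r h 0)\<bar> \<le> real K * CH + real (card (big_part n))"
proof -
  have "real (nonzeros (Hs n) a) = small_total a + (\<Sum>h\<in>small_part n. 1 - digit_wt d r h 0) + real (nonzeros (big_part n) a)" for a
  proof -
    have "nonzeros (Hs n) a = nonzeros (small_part n) a + nonzeros (big_part n) a"
      unfolding nonzeros_def Hs_split(1) by (intro sum.union_disjoint fin_parts Hs_split)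
    moreover have "small_total a = centred r (small_part n) a" using sum_classes(1)[of K] K unfolding centred_eq_sum by simp
    ultimately show ?thesis by (simp add: centred_def)
  qed
  hence "rep_exp n (\<lambda>a. real (nonzeros (Hs n) a)) = rep_exp n small_total + (\<Sum>h\<in>small_part n. 1 - digit_wt d r h 0) + rep_exp n (\<lambda>a. real (nonzeros (big_part n) a))"
    by (simp only: rep_exp_add rep_exp_const[OF reps_ne])
  moreover have "0 \<le> rep_exp n (\<lambda>a. real (nonzeros (big_part n) a))" unfolding rep_exp_def by (intro divide_nonneg_nonneg sum_nonneg) auto
  moreover have "rep_exp n (\<lambda>a. real (nonzeros (big_part n) a)) \<le> rep_exp n (\<lambda>_. real (card (big_part n)))"
  proof (rule rep_exp_mono)
    fix a
    have "nonzeros (big_part n) a \<le> (\<Sum>h\<in>big_part n. 1)" unfolding nonzeros_def by (intro sum_mono) auto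
    thus "real (nonzeros (big_part n) a) \<le> real (card (big_part n))" by simp
  qed
  hence "rep_exp n (\<lambda>a. real (nonzeros (big_part n) a)) \<le> real (card (big_part n))" by (simp only: rep_exp_const[OF reps_ne])
  ultimately show ?thesis using rep_exp_G by linarith
qed

text \<open>The centred weight consists of the small digits outside class c, which decouple from the
  conditioning, and a remainder \<open>R\<close> of small second moment. The three error terms are
  the mean square of \<open>R\<close>, the decoupling error and the Gaussian error of independent
  digits.\<close>

lemma clt_approx:
  fixes \<tau> :: real
  assumes c: "c < K"
  shows "norm (rep_exp n (\<lambda>a. cis (\<tau> * (centred r (Hs n) a - rep_exp n (centred r (Hs n))))) -
      complex_of_real (exp (- (\<tau>\<^sup>2 * (nz_var r (small_part n) - nz_var r (small_class K c n)) / 2))))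
    \<le> \<bar>\<tau>\<bar> * sqrt (3 * (real (card (small_class K c n)) + 3 * (real K)\<^sup>2 * CH\<^sup>2 + 3 * real K * C * real (card (big_part n))))
      + 1 / ln (real n) ^ (3 * m) + \<bar>\<tau>\<bar> ^ 3 * (CH * ln (real n) ^ m)"
proof -
  define U where "U = small_part n - small_class K c n"
  have U: "finite U" "U \<subseteq> Hs n" using fin_parts(3,7) by (auto simp: U_def)
  have sub: "small_class K c n \<subseteq> small_part n" by (auto simp: small_class_def small_part_def cls_def)
  have vvU: "nz_var r U = nz_var r (small_part n) - nz_var r (small_class K c n)"
    unfolding nz_var_def U_def by (rule sum_diff[OF fin_parts(3) sub])
  have czU: "centred r U a = centred r (small_part n) a - centred r (small_class K c n) a" for a
    unfolding centred_eq_sum U_def by (rule sum_diff[OF fin_parts(3) sub])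
  have Gs: "small_total a = centred r (small_part n) a" for a using sum_classes(1)[of K] K unfolding centred_eq_sum by simp
  define e where "e = rep_exp n (centred r (Hs n))"
  \<comment> \<open>The omitted class, all big digits, and the shift between the model mean and the
    mean over representations.\<close>
  define R where "R = (\<lambda>a. centred r (small_class K c n) a + big_total a - e)"
  have dec: "centred r (Hs n) a - e = centred r U a + R a" for a
    using centred_Hs[of K r n a] K by (simp add: R_def czU Gs)
  have "rep_exp n (\<lambda>a. (R a)\<^sup>2) \<le> rep_exp n (\<lambda>a. 3 * ((centred r (small_class K c n) a)\<^sup>2 + (big_total a)\<^sup>2 + e\<^sup>2))"
  proof (rule rep_exp_mono)
    fix a
    have "(x + y - z)\<^sup>2 \<le> 3 * (x\<^sup>2 + y\<^sup>2 + z\<^sup>2)" for x y z :: real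
    proof -
      have "0 \<le> (x - y)\<^sup>2 + (x + z)\<^sup>2 + (y + z)\<^sup>2" by simp
      thus ?thesis by (simp add: power2_eq_square algebra_simps)
    qed
    thus "(R a)\<^sup>2 \<le> 3 * ((centred r (small_class K c n) a)\<^sup>2 + (big_total a)\<^sup>2 + e\<^sup>2)" by (simp add: R_def)
  qed
  also have "\<dots> = 3 * (rep_exp n (\<lambda>a. (centred r (small_class K c n) a)\<^sup>2) + rep_exp n (\<lambda>a. (big_total a)\<^sup>2) + e\<^sup>2)"
    by (simp only: rep_exp_cmult rep_exp_add rep_exp_const[OF reps_ne])
  also have "\<dots> \<le> 3 * (real (card (small_class K c n)) + 3 * (real K)\<^sup>2 * CH\<^sup>2 + 3 * real K * C * real (card (big_part n)))"
  proof -
    have "rep_exp n (\<lambda>a. (centred r (small_class K c n) a)\<^sup>2) \<le> real (card (small_class K c n)) + CH\<^sup>2"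
      using rep_exp_small_class_sq[OF c] nz_var_bounds[OF fin_parts(1), of r K c n] by linarith
    moreover have "1 * CH\<^sup>2 \<le> (real K)\<^sup>2 * CH\<^sup>2" using K by (intro mult_right_mono) auto
    ultimately show ?thesis using rep_exp_T_sq rep_exp_centred_sq unfolding e_def[symmetric] by (simp add: algebra_simps)
  qed
  finally have R2: "rep_exp n (\<lambda>a. (R a)\<^sup>2) \<le> 3 * (real (card (small_class K c n)) + 3 * (real K)\<^sup>2 * CH\<^sup>2 + 3 * real K * C * real (card (big_part n)))" .
  have "norm (rep_exp n (\<lambda>a. cis (\<tau> * (centred r (Hs n) a - e))) - rep_exp n (\<lambda>a. cis (\<tau> * centred r U a))) \<le> rep_exp n (\<lambda>a. \<bar>\<tau>\<bar> * \<bar>R a\<bar>)"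
  proof -
    have "norm (rep_exp n (\<lambda>a. cis (\<tau> * (centred r (Hs n) a - e))) - rep_exp n (\<lambda>a. cis (\<tau> * centred r U a))) \<le>
       rep_exp n (\<lambda>a. norm (cis (\<tau> * (centred r (Hs n) a - e)) - cis (\<tau> * centred r U a)))"
      unfolding rep_exp_diff[symmetric] by (rule norm_rep_exp_le)
    also have "\<dots> \<le> rep_exp n (\<lambda>a. \<bar>\<tau>\<bar> * \<bar>R a\<bar>)"
    proof (rule rep_exp_mono)
      fix a
      have "cis (\<tau> * (centred r (Hs n) a - e)) - cis (\<tau> * centred r U a) = cis (\<tau> * centred r U a) * (cis (\<tau> * R a) - 1)"
        unfolding dec by (simp add: right_diff_distrib cis_mult distrib_left)
      thus "norm (cis (\<tau> * (centred r (Hs n) a - e)) - cis (\<tau> * centred r U a)) \<le> \<bar>\<tau>\<bar> * \<bar>R a\<bar>"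
        using norm_cis_minus_1_le[of "\<tau> * R a"] by (simp add: norm_mult abs_mult)
    qed
    finally show ?thesis .
  qed
  also have "\<dots> = \<bar>\<tau>\<bar> * rep_exp n (\<lambda>a. \<bar>R a\<bar>)" by (rule rep_exp_cmult)
  also have "\<dots> \<le> \<bar>\<tau>\<bar> * sqrt (3 * (real (card (small_class K c n)) + 3 * (real K)\<^sup>2 * CH\<^sup>2 + 3 * real K * C * real (card (big_part n))))"
    using rep_exp_square_le[of n "\<lambda>a. \<bar>R a\<bar>"] R2 by (intro mult_left_mono real_le_rsqrt) auto
  finally have 1: "norm (rep_exp n (\<lambda>a. cis (\<tau> * (centred r (Hs n) a - e))) - rep_exp n (\<lambda>a. cis (\<tau> * centred r U a))) \<le> \<dots>" .
  have 2: "norm (rep_exp n (\<lambda>a. cis (\<tau> * centred r U a)) - digit_exp d r U (\<lambda>a. cis (\<tau> * centred r U a))) \<le> 1 / ln (real n) ^ (3 * m)"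
  proof -
    have "norm (rep_exp n (\<lambda>a. cis (\<tau> * centred r U a) * 1) - digit_exp d r U (\<lambda>a. cis (\<tau> * centred r U a)) * rep_exp n (\<lambda>_. 1)) \<le> 1 * 1 / ln (real n) ^ (3 * m)"
      by (rule decoupled_complex[OF decoupled c U(2) _ _ _ _ depends_comp[OF depends_centred], where V = "{}"])
         (auto simp: U_def small_part_def small_class_def depends_const)
    thus ?thesis by (simp add: rep_exp_const[OF reps_ne])
  qed
  have 3: "norm (digit_exp d r U (\<lambda>a. cis (\<tau> * centred r U a)) - complex_of_real (exp (- (\<tau>\<^sup>2 * nz_var r U / 2)))) \<le> \<bar>\<tau>\<bar> ^ 3 * (CH * ln (real n) ^ m)"
  proof -
    have "norm (digit_exp d r U (\<lambda>a. cis (\<tau> * centred r U a)) - complex_of_real (exp (- (\<tau>\<^sup>2 * nz_var r U / 2)))) \<le> \<bar>\<tau>\<bar> ^ 3 * real (card U)"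
      unfolding centred_def nz_var_def by (rule norm_digit_exp_nonzeros_gauss[OF U(1) d1])
    also have "\<dots> \<le> \<bar>\<tau>\<bar> ^ 3 * (CH * ln (real n) ^ m)" using card_part_le[OF U(2)] by (intro mult_left_mono) auto
    finally show ?thesis .
  qed
  have "norm (rep_exp n (\<lambda>a. cis (\<tau> * (centred r (Hs n) a - e))) - complex_of_real (exp (- (\<tau>\<^sup>2 * nz_var r U / 2)))) \<le>
     norm (rep_exp n (\<lambda>a. cis (\<tau> * (centred r (Hs n) a - e))) - rep_exp n (\<lambda>a. cis (\<tau> * centred r U a))) +
     norm (rep_exp n (\<lambda>a. cis (\<tau> * centred r U a)) - digit_exp d r U (\<lambda>a. cis (\<tau> * centred r U a))) +
     norm (digit_exp d r U (\<lambda>a. cis (\<tau> * centred r U a)) - complex_of_real (exp (- (\<tau>\<^sup>2 * nz_var r U / 2))))"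
    using norm_triangle_ineq norm_triangle_le by (smt (verit) diff_add_cancel add_diff_eq)
  thus ?thesis using 1 2 3 unfolding vvU e_def[symmetric] by linarith
qed

end

end

section \<open>Asymptotics of counts, mean, variance and characteristic function\<close>

lemma abs_exp_diff_le:
  fixes x y :: real
  assumes "x \<ge> 0" "y \<ge> 0"
  shows "\<bar>exp (- x) - exp (- y)\<bar> \<le> \<bar>x - y\<bar>"
proof -
  have *: "exp (- x) - exp (- y) \<le> y - x" if "0 \<le> x" "x \<le> y" for x y :: real
  proof -
    have "exp (- x) - exp (- y) = exp (- x) * (1 - exp (- (y - x)))" by (simp add: right_diff_distrib flip: exp_add)
    also have "\<dots> \<le> 1 * (y - x)"
    proof (intro mult_mono)
      show "1 - exp (- (y - x)) \<le> y - x" using exp_ge_add_one_self[of "- (y - x)"] by linarith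
    qed (use that in auto)
    finally show ?thesis by simp
  qed
  show ?thesis using *[of x y] *[of y x] assms by (cases "x \<le> y") auto
qed

context multibase
begin

definition rate :: "nat \<Rightarrow> real" where "rate n = ln (real n) ^ (m - 1) * ln (ln (real n))"

lemma eventually_rate_ge: "\<forall>\<^sub>F n in sequentially. 1 \<le> ln (real n) \<and> 1 \<le> ln (ln (real n)) \<and> ln (real n) ^ (m - 1) \<le> rate n \<and> 1 \<le> rate n"
proof -
  have "\<forall>\<^sub>F n in sequentially. exp 1 \<le> ln (real n)" by (rule eventually_ln_ge)
  thus ?thesis
  proof eventually_elim
    case (elim n)
    have L: "ln (real n) > 0" using elim by (meson exp_gt_zero less_le_trans)
    have l1: "1 \<le> ln (ln (real n))" using elim L by (subst ln_ge_iff) auto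
    have L1: "1 \<le> ln (real n)" using elim exp_ge_add_one_self[of 1] by linarith
    have "1 \<le> ln (real n) ^ (m - 1)" using L1 by (intro one_le_power)
    moreover have "ln (real n) ^ (m - 1) * 1 \<le> rate n" unfolding rate_def using l1 L1 by (intro mult_left_mono) auto
    ultimately show ?case using L1 l1 by (intro conjI) linarith+
  qed
qed

lemma eventually_rate_le:
  assumes "e > 0"
  shows "\<forall>\<^sub>F n in sequentially. c * rate n \<le> e * ln (real n) ^ m"
proof -
  have "(\<lambda>n. ln (ln (real n)) / ln (real n)) \<longlonglongrightarrow> 0" by real_asymp
  hence "(\<lambda>n. c * (ln (ln (real n)) / ln (real n))) \<longlonglongrightarrow> c * 0" by (intro tendsto_intros)
  hence "\<forall>\<^sub>F n in sequentially. c * (ln (ln (real n)) / ln (real n)) < e"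
    by (rule order_tendstoD) (use assms in auto)
  thus ?thesis using eventually_rate_ge
  proof eventually_elim
    case (elim n)
    hence "c * ln (ln (real n)) \<le> e * ln (real n)" by (simp add: field_simps)
    hence "ln (real n) ^ (m - 1) * (c * ln (ln (real n))) \<le> ln (real n) ^ (m - 1) * (e * ln (real n))"
      using elim by (intro mult_left_mono) auto
    moreover have "ln (real n) ^ (m - 1) * ln (real n) = ln (real n) ^ m" using m2 by (cases m) auto
    ultimately show ?case by (simp add: rate_def mult_ac)
  qed
qed

text \<open>On the logarithmic scale the big elements fill a window of length 6 m log log n; this is
  the source of the log log in the error term.\<close>

lemma card_big_part_le: "\<exists>C>0. \<forall>\<^sub>F n in sequentially. real (card (big_part n)) \<le> C * rate n"
proof -
  define C where "C = kap * real m * (1 + Om) ^ (m - 1) * (Om + 6 * real m)"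
  have C: "C > 0" unfolding C_def using kap_pos Om_nonneg m2 by (intro mult_pos_pos zero_less_power add_nonneg_pos[of Om] add_pos_nonneg[of 1]) auto
  have "\<forall>\<^sub>F n in sequentially. real (card (big_part n)) \<le> C * rate n"
    using eventually_rate_ge eventually_ge_at_top[of 1]
  proof eventually_elim
    case (elim n)
    define L where "L = ln (real n)"
    define s where "s = L - real (6 * m) * ln L"
    have L: "L \<ge> 1" "ln L \<ge> 1" using elim by (auto simp: L_def)
    have "small_bound n = exp s"
    proof -
      have "exp (real (6 * m) * ln L) = L ^ (6 * m)" using L by (subst exp_of_nat_mult) auto
      moreover have "exp L = real n" using elim by (simp add: L_def)
      ultimately show ?thesis unfolding s_def exp_diff small_bound_def L_def by simp
    qed
    hence "big_part n = {h \<in> S. exp s < real h \<and> real h \<le> exp L}"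
      using elim by (auto simp: big_part_def Hs_def L_def)
    hence "real (card (big_part n)) \<le> kap * real m * (L + Om) ^ (m - 1) * (L + Om - s)"
      using window_card_le[of L s] L by (simp add: s_def)
    also have "\<dots> \<le> kap * real m * ((1 + Om) * L) ^ (m - 1) * ((Om + 6 * real m) * ln L)"
    proof (intro mult_mono mult_left_mono power_mono)
      have "Om * 1 \<le> Om * L" using L Om_nonneg by (intro mult_left_mono) auto
      thus "L + Om \<le> (1 + Om) * L" by (simp add: algebra_simps)
      have "Om * 1 \<le> Om * ln L" using L Om_nonneg by (intro mult_left_mono) auto
      thus "L + Om - s \<le> (Om + 6 * real m) * ln L" by (simp add: s_def algebra_simps)
      have "0 \<le> real (6 * m) * ln L" using L by (intro mult_nonneg_nonneg) auto
      thus "0 \<le> L + Om - s" using Om_nonneg unfolding s_def by linarith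
    qed (use kap_pos Om_nonneg L in \<open>auto intro!: mult_nonneg_nonneg\<close>)
    also have "\<dots> = C * rate n" by (simp add: C_def rate_def L_def power_mult_distrib mult_ac)
    finally show ?case .
  qed
  thus ?thesis using C by blast
qed

lemma card_Hs_approx: "\<exists>C>0. \<forall>\<^sub>F n in sequentially. \<bar>real (card (Hs n)) - kap * ln (real n) ^ m\<bar> \<le> C * rate n"
proof -
  define C where "C = kap * (real m * (1 + Om) ^ (m - 1) * Om) + 1"
  have C: "C > 0" unfolding C_def using kap_pos Om_nonneg by (intro add_nonneg_pos mult_nonneg_nonneg) auto
  obtain k where k: "m = Suc k" using m2 by (cases m) auto
  have "\<forall>\<^sub>F n in sequentially. \<bar>real (card (Hs n)) - kap * ln (real n) ^ m\<bar> \<le> C * rate n"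
    using eventually_rate_ge eventually_ge_at_top[of 1]
  proof eventually_elim
    case (elim n)
    define L where "L = ln (real n)"
    have L: "L \<ge> 1" using elim by (auto simp: L_def)
    have c: "real (card (Hs n)) = real (mb_cnt m p L)" using card_Hs[of n] elim by (simp add: L_def)
    have "kap * (L + Om) ^ m - kap * L ^ m = kap * ((L + Om) ^ Suc k - L ^ Suc k)" by (simp add: k right_diff_distrib)
    also have "\<dots> \<le> kap * (real (Suc k) * (L + Om) ^ k * (L + Om - L))"
      using kap_pos Om_nonneg L by (intro mult_left_mono power_Suc_diff_le) auto
    also have "\<dots> \<le> kap * (real (Suc k) * ((1 + Om) * L) ^ k * Om)"
    proof -
      have "Om * 1 \<le> Om * L" using L Om_nonneg by (intro mult_left_mono) auto
      hence "L + Om \<le> (1 + Om) * L" by (simp add: algebra_simps)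
      thus ?thesis using kap_pos Om_nonneg L by (intro mult_left_mono mult_mono power_mono) auto
    qed
    also have "\<dots> = kap * (real m * (1 + Om) ^ (m - 1) * Om) * L ^ (m - 1)" by (simp add: k power_mult_distrib)
    also have "\<dots> \<le> kap * (real m * (1 + Om) ^ (m - 1) * Om) * rate n"
      using elim kap_pos Om_nonneg by (intro mult_left_mono) (auto simp: L_def)
    also have "\<dots> \<le> C * rate n" unfolding C_def using elim by (intro mult_right_mono) auto
    finally have "kap * (L + Om) ^ m - kap * L ^ m \<le> C * rate n" .
    thus ?case using cnt_ge[of L] cnt_le[of L] L c unfolding L_def[symmetric] by linarith
  qed
  thus ?thesis using C by blast
qed

text \<open>An error (log n)^(-3 m) per digit, summed over O((log n)^m) digits, stays bounded, so
  uniform digits may be substituted.\<close>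

lemma decoupled_small_part:
  assumes g: "decoupled K n C r" and n: "n \<ge> 1" "ln (real n) \<ge> 1"
  shows "\<bar>(\<Sum>h\<in>small_part n. 1 - digit_wt d r h 0) - (1 - 1 / real d) * real (card (small_part n))\<bar> \<le> CH"
    and "\<bar>nz_var r (small_part n) - (1 - 1 / real d) * (1 / real d) * real (card (small_part n))\<bar> \<le> CH"
proof -
  define e where "e = 1 / ln (real n) ^ (3 * m)"
  have rep_exp: "real (card (small_part n)) * e \<le> CH"
  proof -
    have "ln (real n) ^ m \<le> ln (real n) ^ (3 * m)" using n by (intro power_increasing) auto
    hence l: "ln (real n) ^ m * e \<le> 1" 
      unfolding e_def times_divide_eq_right using n zero_less_power[of "ln (real n)" "3 * m"]
      by (subst divide_le_eq_1_pos) linarith+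
    have "real (card (small_part n)) \<le> real (card (Hs n))" using card_mono[OF finite_Hs fin_parts(7)] by simp
    also have "\<dots> \<le> CH * ln (real n) ^ m" by (rule card_Hs_le[OF n])
    finally have "real (card (small_part n)) * e \<le> CH * ln (real n) ^ m * e" using n by (intro mult_right_mono) (auto simp: e_def)
    also have "\<dots> \<le> CH * 1" using l CH_pos unfolding mult.assoc by (intro mult_left_mono) auto
    finally show ?thesis by simp
  qed
  have w: "\<bar>digit_wt d r h 0 - 1 / real d\<bar> \<le> e" if "h \<in> small_part n" for h
    using decoupled_digit_wt[OF g, of h] that by (simp add: small_part_def e_def)
  have "\<bar>(\<Sum>h\<in>small_part n. 1 - digit_wt d r h 0) - (1 - 1 / real d) * real (card (small_part n))\<bar> = \<bar>\<Sum>h\<in>small_part n. 1 / real d - digit_wt d r h 0\<bar>"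
    by (simp add: sum_subtractf algebra_simps)
  also have "\<dots> \<le> (\<Sum>h\<in>small_part n. e)" by (rule order.trans[OF sum_abs]) (intro sum_mono, use w in \<open>auto simp: abs_minus_commute\<close>)
  finally show "\<bar>(\<Sum>h\<in>small_part n. 1 - digit_wt d r h 0) - (1 - 1 / real d) * real (card (small_part n))\<bar> \<le> CH" using rep_exp by simp
  have "\<bar>nz_var r (small_part n) - (1 - 1 / real d) * (1 / real d) * real (card (small_part n))\<bar> =
     \<bar>\<Sum>h\<in>small_part n. (1 - digit_wt d r h 0) * digit_wt d r h 0 - (1 - 1 / real d) * (1 / real d)\<bar>"
    unfolding nz_var_def by (simp add: sum_subtractf mult_ac)
  also have "\<dots> \<le> (\<Sum>h\<in>small_part n. e)"
  proof (rule order.trans[OF sum_abs], rule sum_mono)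
    fix h assume h: "h \<in> small_part n"
    define x where "x = digit_wt d r h 0"
    define y where "y = 1 / real d"
    have x: "0 \<le> x" "x \<le> 1" unfolding x_def using digit_wt_nonneg digit_wt_le_1[OF d1] by auto
    have y: "0 \<le> y" "y \<le> 1" unfolding y_def using d2 by auto
    have "\<bar>(1 - x) * x - (1 - y) * y\<bar> = \<bar>x - y\<bar> * \<bar>1 - x - y\<bar>" by (simp add: abs_mult[symmetric] algebra_simps)
    also have "\<dots> \<le> \<bar>x - y\<bar> * 1" using x y by (intro mult_left_mono) auto
    also have "\<dots> \<le> e" using w[OF h] by (simp add: x_def y_def)
    finally show "\<bar>(1 - digit_wt d r h 0) * digit_wt d r h 0 - (1 - 1 / real d) * (1 / real d)\<bar> \<le> e" by (simp add: x_def y_def)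
  qed
  finally show "\<bar>nz_var r (small_part n) - (1 - 1 / real d) * (1 / real d) * real (card (small_part n))\<bar> \<le> CH" using rep_exp by simp
qed

definition rep_mean :: "nat \<Rightarrow> real" where "rep_mean n = rep_exp n (\<lambda>a. real (nonzeros (Hs n) a))"
definition rep_var :: "nat \<Rightarrow> real" where "rep_var n = rep_exp n (\<lambda>a. (real (nonzeros (Hs n) a) - rep_mean n)\<^sup>2)"

lemma nonzeros_minus_rep_mean:
  assumes "reps n \<noteq> {}"
  shows "real (nonzeros (Hs n) a) - rep_mean n = centred r (Hs n) a - rep_exp n (centred r (Hs n))"
proof -
  have "rep_exp n (centred r (Hs n)) = rep_mean n - (\<Sum>h\<in>Hs n. 1 - digit_wt d r h 0)"
    unfolding centred_def rep_mean_def rep_exp_diff by (simp add: rep_exp_const[OF assms])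
  thus ?thesis by (simp add: centred_def)
qed

lemma rep_var_eq:
  assumes "reps n \<noteq> {}"
  shows "rep_var n = rep_exp n (\<lambda>a. (centred r (Hs n) a)\<^sup>2) - (rep_exp n (centred r (Hs n)))\<^sup>2"
proof -
  define e where "e = rep_exp n (centred r (Hs n))"
  have "rep_var n = rep_exp n (\<lambda>a. (centred r (Hs n) a)\<^sup>2 - 2 * e * centred r (Hs n) a + e\<^sup>2)"
    unfolding rep_var_def nonzeros_minus_rep_mean[OF assms, of _ r] e_def by (simp add: power2_eq_square algebra_simps)
  also have "\<dots> = rep_exp n (\<lambda>a. (centred r (Hs n) a)\<^sup>2) - 2 * e * e + e\<^sup>2"
    by (simp only: rep_exp_add rep_exp_diff rep_exp_cmult rep_exp_const[OF assms] e_def[symmetric])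
  finally show ?thesis by (simp add: e_def power2_eq_square)
qed

lemma mean_variance:
  "\<exists>C>0. \<forall>\<^sub>F n in sequentially. reps n \<noteq> {} \<and>
     \<bar>rep_mean n - (1 - 1 / real d) * (kap * ln (real n) ^ m)\<bar> \<le> C * rate n \<and>
     \<bar>rep_var n - (1 - 1 / real d) * (1 / real d) * (kap * ln (real n) ^ m)\<bar> \<le> C * rate n"
proof -
  obtain Cg where Cg: "Cg > 0" "\<forall>\<^sub>F n in sequentially. \<exists>r. decoupled 3 n Cg r" using eventually_decoupled[of 3] by auto
  obtain Cb where Cb: "Cb > 0" "\<forall>\<^sub>F n in sequentially. real (card (big_part n)) \<le> Cb * rate n" using card_big_part_le by blast
  obtain Ch where Ch: "Ch > 0" "\<forall>\<^sub>F n in sequentially. \<bar>real (card (Hs n)) - kap * ln (real n) ^ m\<bar> \<le> Ch * rate n"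
    using card_Hs_approx by blast
  \<comment> \<open>The bounds at K = 3: 3 CH from \<open>mean_approx\<close> plus CH for uniform
    digits in the mean; 45 = 5 * 9 and 9 = 3 * 3 from \<open>variance_approx\<close>.\<close>
  define C where "C = max (4 * CH + 2 * Cb + Ch) (45 * CH\<^sup>2 + 9 * Cg * Cb + CH + Cb + Ch)"
  have C: "C > 0" unfolding C_def using CH_pos Cb Ch by (intro less_max_iff_disj[THEN iffD2] disjI1) auto
  have "\<forall>\<^sub>F n in sequentially. reps n \<noteq> {} \<and>
     \<bar>rep_mean n - (1 - 1 / real d) * (kap * ln (real n) ^ m)\<bar> \<le> C * rate n \<and>
     \<bar>rep_var n - (1 - 1 / real d) * (1 / real d) * (kap * ln (real n) ^ m)\<bar> \<le> C * rate n"
    using Cg(2) Cb(2) Ch(2) eventually_rate_ge eventually_ge_at_top[of 1]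
  proof eventually_elim
    case (elim n)
    then obtain r where g: "decoupled 3 n Cg r" by blast
    have L1: "ln (real n) \<ge> 1" and rt: "rate n \<ge> 1" and n1: "n \<ge> 1" using elim by auto
    have ne: "reps n \<noteq> {}" using g by (simp add: decoupled_def)
    note ctx = g order.refl Cg(1) n1 L1
    have cHs: "real (card (Hs n)) = real (card (small_part n)) + real (card (big_part n))"
      using card_Un_disjoint[OF fin_parts(3,4) Hs_split(2)] Hs_split(1) by simp
    \<comment> \<open>Replacing the number of small elements by its leading term costs the big part
      and the counting error.\<close>
    define x where "x = real (card (small_part n)) - kap * ln (real n) ^ m"
    have x: "\<bar>x\<bar> \<le> (Cb + Ch) * rate n" using elim(2,3) cHs unfolding x_def by (simp add: algebra_simps abs_le_iff)
    have sc: "\<bar>u * x\<bar> \<le> (Cb + Ch) * rate n" if "0 \<le> u" "u \<le> 1" for u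
    proof -
      have "\<bar>u * x\<bar> \<le> 1 * \<bar>x\<bar>" using that unfolding abs_mult by (intro mult_right_mono) auto
      thus ?thesis using x by simp
    qed
    have u1: "0 \<le> 1 - 1 / real d" "1 - 1 / real d \<le> 1" using d2 by auto
    have u2: "0 \<le> (1 - 1 / real d) * (1 / real d)" "(1 - 1 / real d) * (1 / real d) \<le> 1"
      using d2 u1 by (intro mult_nonneg_nonneg mult_le_one; simp)+
    have k: "c \<le> c * rate n" if "c \<ge> 0" for c using mult_left_mono[OF rt that] by simp
    have "\<bar>rep_mean n - (\<Sum>h\<in>small_part n. 1 - digit_wt d r h 0)\<bar> \<le> 3 * CH + real (card (big_part n))"
      using mean_approx[OF ctx] unfolding rep_mean_def by simp
    hence "\<bar>rep_mean n - (1 - 1 / real d) * (kap * ln (real n) ^ m) - (1 - 1 / real d) * x\<bar> \<le> 4 * CH + real (card (big_part n))"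
      using decoupled_small_part(1)[OF g n1 L1] unfolding x_def by (simp add: right_diff_distrib abs_le_iff)
    hence "\<bar>rep_mean n - (1 - 1 / real d) * (kap * ln (real n) ^ m)\<bar> \<le> 4 * CH + Cb * rate n + (Cb + Ch) * rate n"
      using sc[OF u1] elim(2) unfolding abs_le_iff by linarith
    also have "\<dots> \<le> (4 * CH + 2 * Cb + Ch) * rate n" using k[of "4 * CH"] CH_pos by (simp add: algebra_simps)
    also have "\<dots> \<le> C * rate n" using rt by (intro mult_right_mono) (auto simp: C_def)
    finally have m: "\<bar>rep_mean n - (1 - 1 / real d) * (kap * ln (real n) ^ m)\<bar> \<le> C * rate n" .
    have "\<bar>rep_var n - nz_var r (small_part n)\<bar> \<le> 45 * CH\<^sup>2 + 9 * Cg * real (card (big_part n))"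
      using variance_approx[OF ctx] unfolding rep_var_eq[OF ne, of r] by simp
    hence "\<bar>rep_var n - (1 - 1 / real d) * (1 / real d) * (kap * ln (real n) ^ m) - (1 - 1 / real d) * (1 / real d) * x\<bar> \<le> 45 * CH\<^sup>2 + 9 * Cg * real (card (big_part n)) + CH"
      using decoupled_small_part(2)[OF g n1 L1] unfolding x_def right_diff_distrib[of _ "real (card (small_part n))"] abs_le_iff by linarith
    hence "\<bar>rep_var n - (1 - 1 / real d) * (1 / real d) * (kap * ln (real n) ^ m)\<bar> \<le> 45 * CH\<^sup>2 + 9 * Cg * real (card (big_part n)) + CH + (Cb + Ch) * rate n"
      using sc[OF u2] unfolding abs_le_iff by linarith
    also have "9 * Cg * real (card (big_part n)) \<le> 9 * Cg * (Cb * rate n)" using elim(2) Cg by (intro mult_left_mono) auto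
    finally have "\<bar>rep_var n - (1 - 1 / real d) * (1 / real d) * (kap * ln (real n) ^ m)\<bar> \<le> 45 * CH\<^sup>2 + 9 * Cg * (Cb * rate n) + CH + (Cb + Ch) * rate n" by simp
    also have "\<dots> \<le> (45 * CH\<^sup>2 + 9 * Cg * Cb + CH + Cb + Ch) * rate n"
      using k[of "45 * CH\<^sup>2 + CH"] CH_pos by (simp add: algebra_simps)
    also have "\<dots> \<le> C * rate n" using rt by (intro mult_right_mono) (auto simp: C_def)
    finally show ?case using ne m by blast
  qed
  thus ?thesis using C by blast
qed

text \<open>The order of limits matters: the omitted class costs an error that tends to 0 with 1/K
  uniformly in n, so K is fixed first in terms of e, and large n then removes all other
  errors.\<close>

lemma char_tendsto:
  "(\<lambda>n. rep_exp n (\<lambda>a. cis (t * ((real (nonzeros (Hs n) a) - rep_mean n) / sqrt (rep_var n))))) \<longlonglongrightarrow> complex_of_real (exp (- (t\<^sup>2 / 2)))"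
proof (rule tendstoI)
  fix e :: real assume e: "e > 0"
  \<comment> \<open>Half of the leading coefficient of the variance, so that the variance is at
    least gamma (log n)^m for large n.\<close>
  define \<gamma> where "\<gamma> = (1 - 1 / real d) * (1 / real d) * kap / 2"
  have \<gamma>: "\<gamma> > 0" unfolding \<gamma>_def using d2 kap_pos by (intro divide_pos_pos mult_pos_pos) auto
  \<comment> \<open>The two errors that survive large n: the mean square size of the omitted class
    and the variance missing in the Gaussian limit.\<close>
  have "(\<lambda>K::nat. \<bar>t\<bar> * sqrt (6 * CH / (\<gamma> * real K)) + t\<^sup>2 * (CH / (\<gamma> * real K))) \<longlonglongrightarrow> \<bar>t\<bar> * sqrt 0 + t\<^sup>2 * 0"
  proof (intro tendsto_intros)
    show "(\<lambda>K::nat. 6 * CH / (\<gamma> * real K)) \<longlonglongrightarrow> 0"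
      unfolding divide_divide_eq_left[symmetric] by (rule lim_const_over_n)
    show "(\<lambda>K::nat. CH / (\<gamma> * real K)) \<longlonglongrightarrow> 0"
      unfolding divide_divide_eq_left[symmetric] by (rule lim_const_over_n)
  qed
  hence "\<forall>\<^sub>F K::nat in sequentially. \<bar>t\<bar> * sqrt (6 * CH / (\<gamma> * real K)) + t\<^sup>2 * (CH / (\<gamma> * real K)) < e / 2"
    by (rule order_tendstoD) (use e in auto)
  then obtain K where K: "K \<ge> 3" "\<bar>t\<bar> * sqrt (6 * CH / (\<gamma> * real K)) + t\<^sup>2 * (CH / (\<gamma> * real K)) < e / 2"
    using eventually_happens'[OF sequentially_bot eventually_conj[OF _ eventually_ge_at_top[of 3]]] by blast
  obtain Cv where Cv: "Cv > 0" "\<forall>\<^sub>F n in sequentially. reps n \<noteq> {} \<and>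
     \<bar>rep_mean n - (1 - 1 / real d) * (kap * ln (real n) ^ m)\<bar> \<le> Cv * rate n \<and>
     \<bar>rep_var n - (1 - 1 / real d) * (1 / real d) * (kap * ln (real n) ^ m)\<bar> \<le> Cv * rate n"
    using mean_variance by blast
  obtain Cg where Cg: "Cg > 0" "\<forall>\<^sub>F n in sequentially. \<exists>r. decoupled K n Cg r" using eventually_decoupled[of K] K by auto
  obtain Cb where Cb: "Cb > 0" "\<forall>\<^sub>F n in sequentially. real (card (big_part n)) \<le> Cb * rate n" using card_big_part_le by blast
  define CE where "CE = 5 * (real K)\<^sup>2 * CH\<^sup>2 + 3 * real K * Cg * Cb"
  have ev1: "\<forall>\<^sub>F n in sequentially. CE * rate n \<le> CH / real K * ln (real n) ^ m"
    by (rule eventually_rate_le) (use CH_pos K in auto)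
  have ev2: "\<forall>\<^sub>F n in sequentially. Cv * rate n \<le> \<gamma> * ln (real n) ^ m"
    by (rule eventually_rate_le) (use \<gamma> in auto)
  have "(\<lambda>n. 1 / ln (real n)) \<longlonglongrightarrow> 0" by real_asymp
  hence ev3: "\<forall>\<^sub>F n in sequentially. 1 / ln (real n) < e / 4" by (rule order_tendstoD) (use e in auto)
  have "(\<lambda>n. \<bar>t\<bar> ^ 3 * (CH / \<gamma>) * (1 / sqrt (\<gamma> * ln (real n)))) \<longlonglongrightarrow> \<bar>t\<bar> ^ 3 * (CH / \<gamma>) * 0"
  proof (intro tendsto_intros)
    show "(\<lambda>n. 1 / sqrt (\<gamma> * ln (real n))) \<longlonglongrightarrow> 0" using \<gamma> by real_asymp
  qed
  hence ev4: "\<forall>\<^sub>F n in sequentially. \<bar>t\<bar> ^ 3 * (CH / \<gamma>) * (1 / sqrt (\<gamma> * ln (real n))) < e / 4"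
    by (rule order_tendstoD) (use e in auto)
  show "\<forall>\<^sub>F n in sequentially. dist (rep_exp n (\<lambda>a. cis (t * ((real (nonzeros (Hs n) a) - rep_mean n) / sqrt (rep_var n))))) (complex_of_real (exp (- (t\<^sup>2 / 2)))) < e"
    using Cv(2) Cg(2) Cb(2) ev1 ev2 ev3 ev4 eventually_rate_ge eventually_ge_at_top[of 1]
  proof eventually_elim
    case (elim n)
    then obtain r where g: "decoupled K n Cg r" by blast
    define L where "L = ln (real n)"
    have L1: "L \<ge> 1" and rt: "rate n \<ge> 1" and n1: "n \<ge> 1" using elim by (auto simp: L_def)
    have ne: "reps n \<noteq> {}" using g by (simp add: decoupled_def)
    note ctx = g K(1) Cg(1) n1 L1[unfolded L_def]
    have Lm: "L ^ m > 0" "L \<le> L ^ m" using L1 self_le_power[of L m] m2 by auto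
    have K0: "real K > 0" using K by simp
    have V: "\<gamma> * L ^ m \<le> rep_var n"
    proof -
      have "(1 - 1 / real d) * (1 / real d) * (kap * L ^ m) = 2 * (\<gamma> * L ^ m)" by (simp add: \<gamma>_def)
      thus ?thesis using elim(1) elim(5) unfolding L_def[symmetric] abs_le_iff by linarith
    qed
    have gL: "\<gamma> * L ^ m > 0" using \<gamma> Lm by simp
    have V0: "rep_var n > 0" using V gL by linarith
    have E: "5 * (real K)\<^sup>2 * CH\<^sup>2 + 3 * real K * Cg * real (card (big_part n)) \<le> CH / real K * L ^ m"
    proof -
      have "5 * (real K)\<^sup>2 * CH\<^sup>2 * 1 \<le> 5 * (real K)\<^sup>2 * CH\<^sup>2 * rate n" using rt by (intro mult_left_mono) auto
      moreover have "3 * real K * Cg * real (card (big_part n)) \<le> 3 * real K * Cg * (Cb * rate n)"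
        using elim(3) Cg by (intro mult_left_mono) auto
      ultimately have "5 * (real K)\<^sup>2 * CH\<^sup>2 + 3 * real K * Cg * real (card (big_part n)) \<le> CE * rate n"
        by (simp add: CE_def algebra_simps)
      thus ?thesis using elim(4) by (simp add: L_def)
    qed
    \<comment> \<open>Pigeonhole: among the K disjoint classes one has at most the average
      size.\<close>
    obtain c where c: "c < K" "real (card (small_class K c n)) \<le> CH / real K * L ^ m"
    proof -
      have "\<exists>c<K. real (card (small_class K c n)) \<le> CH / real K * L ^ m"
      proof (rule ccontr)
        assume "\<not> ?thesis"
        hence "(\<Sum>c<K. CH / real K * L ^ m) < (\<Sum>c<K. real (card (small_class K c n)))"
          using K by (intro sum_strict_mono) (auto simp: not_le lessThan_empty_iff)
        also have "\<dots> = real (card (small_part n))" using sum_classes(1)[of K "\<lambda>_. 1::real" n] K by simp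
        also have "\<dots> \<le> CH * L ^ m" unfolding L_def by (rule card_part_le[OF ctx fin_parts(7)])
        finally show False using K0 by simp
      qed
      thus ?thesis using that by blast
    qed
    define \<tau> where "\<tau> = t / sqrt (rep_var n)"
    have \<tau>2: "\<tau>\<^sup>2 = t\<^sup>2 / rep_var n" using V0 by (simp add: \<tau>_def power_divide)
    have \<tau>1: "\<bar>\<tau>\<bar> \<le> \<bar>t\<bar> / sqrt (\<gamma> * L ^ m)"
      unfolding \<tau>_def using V gL V0 by (simp add: frac_le)
    have vsub: "nz_var r (small_class K c n) \<le> nz_var r (small_part n)"
      unfolding nz_var_def using digit_wt_nonneg digit_wt_le_1[OF d1]
      by (intro sum_mono2 fin_parts) (auto simp: small_class_def small_part_def cls_def)
    have main: "norm (rep_exp n (\<lambda>a. cis (\<tau> * (centred r (Hs n) a - rep_exp n (centred r (Hs n))))) -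
      complex_of_real (exp (- (\<tau>\<^sup>2 * (nz_var r (small_part n) - nz_var r (small_class K c n)) / 2))))
    \<le> \<bar>\<tau>\<bar> * sqrt (3 * (real (card (small_class K c n)) + 3 * (real K)\<^sup>2 * CH\<^sup>2 + 3 * real K * Cg * real (card (big_part n))))
      + 1 / L ^ (3 * m) + \<bar>\<tau>\<bar> ^ 3 * (CH * L ^ m)"
      unfolding L_def by (rule clt_approx[OF ctx c(1)])
    have t1: "\<bar>\<tau>\<bar> * sqrt (3 * (real (card (small_class K c n)) + 3 * (real K)\<^sup>2 * CH\<^sup>2 + 3 * real K * Cg * real (card (big_part n)))) \<le> \<bar>t\<bar> * sqrt (6 * CH / (\<gamma> * real K))"
    proof -
      have "3 * (real K)\<^sup>2 * CH\<^sup>2 \<le> 5 * (real K)\<^sup>2 * CH\<^sup>2" by (intro mult_right_mono) auto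
      hence le3: "3 * (real (card (small_class K c n)) + 3 * (real K)\<^sup>2 * CH\<^sup>2 + 3 * real K * Cg * real (card (big_part n))) \<le> 6 * CH / real K * L ^ m"
      proof -
        have *: "3 * (x + y + z) \<le> 3 * (u + u)" if "x \<le> u" "y' + z \<le> u" "y \<le> y'" for x y y' z u :: real
          using that by (intro mult_left_mono) linarith+
        have "3 * (real (card (small_class K c n)) + 3 * (real K)\<^sup>2 * CH\<^sup>2 + 3 * real K * Cg * real (card (big_part n)))
            \<le> 3 * (CH / real K * L ^ m + CH / real K * L ^ m)"
          by (rule *[OF c(2) E]) fact
        thus ?thesis by (simp add: mult_ac)
      qed
      have "\<bar>\<tau>\<bar> * sqrt (3 * (real (card (small_class K c n)) + 3 * (real K)\<^sup>2 * CH\<^sup>2 + 3 * real K * Cg * real (card (big_part n))))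
         \<le> (\<bar>t\<bar> / sqrt (\<gamma> * L ^ m)) * sqrt (6 * CH / real K * L ^ m)"
        by (rule mult_mono[OF \<tau>1 real_sqrt_le_mono[OF le3]])
           (use gL Cg in \<open>auto intro!: add_nonneg_nonneg mult_nonneg_nonneg\<close>)
      also have "\<dots> = \<bar>t\<bar> * sqrt ((6 * CH / real K * L ^ m) / (\<gamma> * L ^ m))"
        unfolding real_sqrt_divide[of "6 * CH / real K * L ^ m" "\<gamma> * L ^ m"] by simp
      also have "(6 * CH / real K * L ^ m) / (\<gamma> * L ^ m) = 6 * CH / (\<gamma> * real K)" using L1 by simp
      finally show ?thesis .
    qed
    have t2: "1 / L ^ (3 * m) < e / 4"
    proof -
      have "L ^ 1 \<le> L ^ (3 * m)" using L1 m2 by (intro power_increasing) auto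
      hence "1 / L ^ (3 * m) \<le> 1 / L" using L1 by (intro divide_left_mono) auto
      thus ?thesis using elim(6) by (simp add: L_def)
    qed
    have t3: "\<bar>\<tau>\<bar> ^ 3 * (CH * L ^ m) < e / 4"
    proof -
      define w where "w = sqrt (\<gamma> * L ^ m)"
      have w: "w > 0" "w * w = \<gamma> * L ^ m" using gL by (auto simp: w_def)
      have "\<bar>\<tau>\<bar> ^ 3 * (CH * L ^ m) \<le> (\<bar>t\<bar> / w) ^ 3 * (CH * L ^ m)"
        using \<tau>1 CH_pos Lm unfolding w_def[symmetric] by (intro mult_right_mono power_mono) auto
      also have "\<dots> = \<bar>t\<bar> ^ 3 * (CH * L ^ m / (w * w)) * (1 / w)" by (simp add: power_divide power3_eq_cube)
      also have "CH * L ^ m / (w * w) = CH / \<gamma>" unfolding w(2) using L1 by simp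
      also have "\<bar>t\<bar> ^ 3 * (CH / \<gamma>) * (1 / w) \<le> \<bar>t\<bar> ^ 3 * (CH / \<gamma>) * (1 / sqrt (\<gamma> * L))"
        unfolding w_def using \<gamma> CH_pos L1 Lm by (intro mult_left_mono divide_left_mono real_sqrt_le_mono) auto
      also have "\<dots> < e / 4" using elim(7) unfolding L_def .
      finally show ?thesis .
    qed
    have t4: "norm (complex_of_real (exp (- (\<tau>\<^sup>2 * (nz_var r (small_part n) - nz_var r (small_class K c n)) / 2))) - complex_of_real (exp (- (t\<^sup>2 / 2)))) \<le> t\<^sup>2 * (CH / (\<gamma> * real K))"
    proof -
      have "norm (complex_of_real (exp (- (\<tau>\<^sup>2 * (nz_var r (small_part n) - nz_var r (small_class K c n)) / 2))) - complex_of_real (exp (- (t\<^sup>2 / 2)))) =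
        \<bar>exp (- (\<tau>\<^sup>2 * (nz_var r (small_part n) - nz_var r (small_class K c n)) / 2)) - exp (- (t\<^sup>2 / 2))\<bar>"
        by (simp only: of_real_diff[symmetric] norm_of_real)
      also have "\<dots> \<le> \<bar>\<tau>\<^sup>2 * (nz_var r (small_part n) - nz_var r (small_class K c n)) / 2 - t\<^sup>2 / 2\<bar>"
        using vsub by (intro abs_exp_diff_le) auto
      also have "\<tau>\<^sup>2 * (nz_var r (small_part n) - nz_var r (small_class K c n)) / 2 - t\<^sup>2 / 2 = t\<^sup>2 / (2 * rep_var n) * (nz_var r (small_part n) - nz_var r (small_class K c n) - rep_var n)"
        unfolding \<tau>2 using V0 by (simp add: field_simps)
      also have "\<bar>\<dots>\<bar> = t\<^sup>2 / (2 * rep_var n) * \<bar>nz_var r (small_part n) - nz_var r (small_class K c n) - rep_var n\<bar>" using V0 by (simp add: abs_mult)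
      also have "\<dots> \<le> t\<^sup>2 / (2 * (\<gamma> * L ^ m)) * (2 * (CH / real K * L ^ m))"
      proof (intro mult_mono)
        show "t\<^sup>2 / (2 * rep_var n) \<le> t\<^sup>2 / (2 * (\<gamma> * L ^ m))" using V gL by (intro divide_left_mono) auto
        show "\<bar>nz_var r (small_part n) - nz_var r (small_class K c n) - rep_var n\<bar> \<le> 2 * (CH / real K * L ^ m)"
          using variance_approx[OF ctx] nz_var_bounds[OF fin_parts(1), of r K c n] c(2) E unfolding rep_var_eq[OF ne, of r] abs_le_iff by linarith
      qed (use gL in auto)
      also have "\<dots> = t\<^sup>2 * (CH / (\<gamma> * real K))" using L1 \<gamma> K0 by (simp add: field_simps)
      finally show ?thesis .
    qed
    have "(\<lambda>a. cis (t * ((real (nonzeros (Hs n) a) - rep_mean n) / sqrt (rep_var n)))) = (\<lambda>a. cis (\<tau> * (centred r (Hs n) a - rep_exp n (centred r (Hs n)))))"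
      by (simp add: \<tau>_def nonzeros_minus_rep_mean[OF ne, of _ r])
    hence "dist (rep_exp n (\<lambda>a. cis (t * ((real (nonzeros (Hs n) a) - rep_mean n) / sqrt (rep_var n))))) (complex_of_real (exp (- (t\<^sup>2 / 2)))) \<le>
       norm (rep_exp n (\<lambda>a. cis (\<tau> * (centred r (Hs n) a - rep_exp n (centred r (Hs n))))) -
      complex_of_real (exp (- (\<tau>\<^sup>2 * (nz_var r (small_part n) - nz_var r (small_class K c n)) / 2)))) +
       norm (complex_of_real (exp (- (\<tau>\<^sup>2 * (nz_var r (small_part n) - nz_var r (small_class K c n)) / 2))) - complex_of_real (exp (- (t\<^sup>2 / 2))))"
      by (simp only: dist_norm[symmetric]) (rule dist_triangle)
    also have "\<dots> < e" using main t1 t2 t3 t4 K(2) by linarith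
    finally show ?case .
  qed
qed

section \<open>Translation to the distribution of the Hamming weight\<close>

lemma hweight_eq: assumes "a \<in> reps n" shows "hweight a = nonzeros (Hs n) a"
proof -
  have "{h. a h \<noteq> 0} \<subseteq> Hs n" using assms unfolding reps_eq by (auto simp: PiE_dflt_def) (metis less_irrefl)
  hence "{h. a h \<noteq> 0} = Hs n \<inter> {h. a h \<noteq> 0}" by auto
  thus ?thesis unfolding hweight_def nonzeros_def using finite_Hs by (simp add: of_bool_def sum.If_cases)
qed

lemma integral_W_dist:
  fixes f :: "real \<Rightarrow> 'b::{banach, second_countable_topology, real_normed_field}"
  assumes "reps n \<noteq> {}"
  shows "(\<integral>x. f x \<partial>measure_pmf (W_dist d m p n)) = rep_exp n (\<lambda>a. f (real (nonzeros (Hs n) a)))"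
proof -
  have "(\<integral>x. f x \<partial>measure_pmf (W_dist d m p n)) = (\<integral>a. f (real (hweight a)) \<partial>measure_pmf (pmf_of_set (reps n)))"
    by (simp add: W_dist_def)
  also have "\<dots> = (\<Sum>a\<in>reps n. pmf (pmf_of_set (reps n)) a *\<^sub>R f (real (hweight a)))"
    using assms finite_reps by (intro integral_measure_pmf) auto
  also have "\<dots> = (\<Sum>a\<in>reps n. f (real (nonzeros (Hs n) a)) / of_nat (card (reps n)))"
    using assms finite_reps by (intro sum.cong refl) (simp add: hweight_eq scaleR_conv_of_real)
  finally show ?thesis by (simp add: rep_exp_def sum_divide_distrib)
qed

lemma W_mean_eq: "reps n \<noteq> {} \<Longrightarrow> W_mean d m p n = rep_mean n"
  unfolding W_mean_def rep_mean_def by (rule integral_W_dist)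

lemma W_var_eq: assumes "reps n \<noteq> {}" shows "W_var d m p n = rep_var n"
  unfolding W_var_def rep_var_def W_mean_def[symmetric] W_mean_eq[OF assms] by (rule integral_W_dist[OF assms])

lemma mb_kappa_eq: "mb_kappa d m p * (real d - 1) / (real d * ln (real d)) = (1 - 1 / real d) * kap"
  "mb_kappa d m p * (real d - 1) / ((real d)\<^sup>2 * ln (real d)) = (1 - 1 / real d) * (1 / real d) * kap"
proof -
  have "mb_kappa d m p = ln (real d) * kap" unfolding mb_kappa_def kap_def by (simp add: prod_dividef)
  moreover have "ln (real d) \<noteq> 0" "real d \<noteq> 0" using d2 by auto
  ultimately show "mb_kappa d m p * (real d - 1) / (real d * ln (real d)) = (1 - 1 / real d) * kap"
    "mb_kappa d m p * (real d - 1) / ((real d)\<^sup>2 * ln (real d)) = (1 - 1 / real d) * (1 / real d) * kap"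
    by (simp_all add: field_simps power2_eq_square)
qed

lemma W_mean_var_bigo:
  "(\<lambda>n. W_mean d m p n - mb_kappa d m p * (real d - 1) / (real d * ln (real d)) * ln (real n) ^ m)
       \<in> O(\<lambda>n. ln (real n) ^ (m - 1) * ln (ln (real n)))"
  "(\<lambda>n. W_var d m p n - mb_kappa d m p * (real d - 1) / ((real d)\<^sup>2 * ln (real d)) * ln (real n) ^ m)
       \<in> O(\<lambda>n. ln (real n) ^ (m - 1) * ln (ln (real n)))"
proof -
  obtain C where ev: "\<forall>\<^sub>F n in sequentially. reps n \<noteq> {} \<and>
     \<bar>rep_mean n - (1 - 1 / real d) * (kap * ln (real n) ^ m)\<bar> \<le> C * rate n \<and>
     \<bar>rep_var n - (1 - 1 / real d) * (1 / real d) * (kap * ln (real n) ^ m)\<bar> \<le> C * rate n"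
    using mean_variance by blast
  show "(\<lambda>n. W_mean d m p n - mb_kappa d m p * (real d - 1) / (real d * ln (real d)) * ln (real n) ^ m)
       \<in> O(\<lambda>n. ln (real n) ^ (m - 1) * ln (ln (real n)))"
  proof (rule bigoI[of _ C])
    show "\<forall>\<^sub>F n in sequentially. norm (W_mean d m p n - mb_kappa d m p * (real d - 1) / (real d * ln (real d)) * ln (real n) ^ m)
      \<le> C * norm (ln (real n) ^ (m - 1) * ln (ln (real n)))"
      using ev eventually_rate_ge
    proof eventually_elim
      case (elim n)
      thus ?case unfolding mb_kappa_eq rate_def[symmetric] by (simp add: W_mean_eq mult.assoc)
    qed
  qed
  show "(\<lambda>n. W_var d m p n - mb_kappa d m p * (real d - 1) / ((real d)\<^sup>2 * ln (real d)) * ln (real n) ^ m)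
       \<in> O(\<lambda>n. ln (real n) ^ (m - 1) * ln (ln (real n)))"
  proof (rule bigoI[of _ C])
    show "\<forall>\<^sub>F n in sequentially. norm (W_var d m p n - mb_kappa d m p * (real d - 1) / ((real d)\<^sup>2 * ln (real d)) * ln (real n) ^ m)
      \<le> C * norm (ln (real n) ^ (m - 1) * ln (ln (real n)))"
      using ev eventually_rate_ge
    proof eventually_elim
      case (elim n)
      thus ?case unfolding mb_kappa_eq rate_def[symmetric] by (simp add: W_var_eq mult.assoc)
    qed
  qed
qed

lemma W_clt:
  "weak_conv_m
       (\<lambda>n. measure_pmf (map_pmf (\<lambda>w. (w - W_mean d m p n) / sqrt (W_var d m p n)) (W_dist d m p n)))
       std_normal_distribution"
proof -
  define Q where "Q = (\<lambda>n. map_pmf (\<lambda>w. (w - W_mean d m p n) / sqrt (W_var d m p n)) (W_dist d m p n))"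
  \<comment> \<open>The measure of a pmf lives on the full power set, while Levy continuity concerns
    Borel distributions; the push-forward to \<open>borel\<close> has the same distribution
    function.\<close>
  define M where "M = (\<lambda>n. distr (measure_pmf (Q n)) borel (\<lambda>x. x))"
  have meas: "(\<lambda>x::real. x) \<in> measurable (measure_pmf (Q n)) borel" for n by simp
  have "weak_conv_m M std_normal_distribution"
  proof (rule levy_continuity)
    show "real_distribution (M n)" for n
      unfolding M_def real_distribution_def real_distribution_axioms_def
      by (auto intro!: measure_pmf.prob_space_distr)
    show "real_distribution std_normal_distribution" by (rule real_dist_normal_dist)
    fix t :: real
    have "\<forall>\<^sub>F n in sequentially. rep_exp n (\<lambda>a. cis (t * ((real (nonzeros (Hs n) a) - rep_mean n) / sqrt (rep_var n)))) = char (M n) t"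
    proof -
      obtain C where "\<forall>\<^sub>F n in sequentially. reps n \<noteq> {} \<and>
       \<bar>rep_mean n - (1 - 1 / real d) * (kap * ln (real n) ^ m)\<bar> \<le> C * rate n \<and>
       \<bar>rep_var n - (1 - 1 / real d) * (1 / real d) * (kap * ln (real n) ^ m)\<bar> \<le> C * rate n"
        using mean_variance by blast
      thus ?thesis
      proof eventually_elim
        case (elim n)
        hence ne: "reps n \<noteq> {}" by blast
        have "char (M n) t = (\<integral>x. iexp (t * x) \<partial>measure_pmf (Q n))"
          unfolding char_def M_def by (subst integral_distr[OF meas]) auto
        also have "\<dots> = (\<integral>w. cis (t * ((w - W_mean d m p n) / sqrt (W_var d m p n))) \<partial>measure_pmf (W_dist d m p n))"
          by (simp add: Q_def cis_conv_exp)
        also have "\<dots> = rep_exp n (\<lambda>a. cis (t * ((real (nonzeros (Hs n) a) - rep_mean n) / sqrt (rep_var n))))"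
          unfolding W_mean_eq[OF ne] W_var_eq[OF ne] by (rule integral_W_dist[OF ne])
        finally show ?case ..
      qed
    qed
    from tendsto_cong[OF this] char_tendsto[of t]
    show "(\<lambda>n. char (M n) t) \<longlonglongrightarrow> char std_normal_distribution t"
      by (simp add: char_std_normal_distribution)
  qed
  moreover have "cdf (M n) = cdf (measure_pmf (Q n))" for n
    by (simp add: fun_eq_iff cdf_def M_def measure_distr[OF meas])
  ultimately show ?thesis unfolding weak_conv_m_def Q_def by simp
qed

end

theorem mainTheorem4:
  fixes d m :: nat and p :: "nat \<Rightarrow> nat"
  assumes "d \<ge> 2" and "m \<ge> 2"
    and "1 < p 0"
    and "\<And>i j. i < j \<Longrightarrow> j < m \<Longrightarrow> p i < p j"
    and "\<And>i j. i < m \<Longrightarrow> j < m \<Longrightarrow> i \<noteq> j \<Longrightarrow> coprime (p i) (p j)"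
  shows
    "((\<lambda>n. W_mean d m p n - mb_kappa d m p * (real d - 1) / (real d * ln (real d)) * ln (real n) ^ m)
       \<in> O(\<lambda>n. ln (real n) ^ (m - 1) * ln (ln (real n))))
    \<and> ((\<lambda>n. W_var d m p n - mb_kappa d m p * (real d - 1) / ((real d)\<^sup>2 * ln (real d)) * ln (real n) ^ m)
       \<in> O(\<lambda>n. ln (real n) ^ (m - 1) * ln (ln (real n))))
    \<and> (weak_conv_m
       (\<lambda>n. measure_pmf (map_pmf (\<lambda>w. (w - W_mean d m p n) / sqrt (W_var d m p n)) (W_dist d m p n)))
       std_normal_distribution)"
proof -
  interpret multibase d m p by unfold_locales (fact assms)+
  show ?thesis using W_mean_var_bigo W_clt by blast
qed

end
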